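(* Let $b_1,b_2\in H^\infty_1$ be two rational functions that are not inner. Assume that $S_{b_1}\cong S_{b_2}$ (unitary equivalence of the forward shift operators on the de Branges-Rovnyak spaces $\mathcal H(b_1)$ and $\mathcal H(b_2)$). Then $b_1$ and $b_2$ have the same Carathéodory angular derivative points; that is, for every $\zeta\in\mathbb T$, $b_1$ has a Carathéodory angular derivative at $\zeta$ if and only if $b_2$ has a Carathéodory angular derivative at $\zeta$.
   Context: $\mathbb D=\{z\in\mathbb C:|z|<1\}$, $\mathbb T=\partial\mathbb D$. $H^2$ is the Hardy space of analytic functions on $\mathbb D$ with square-summable Taylor coefficients, $H^\infty$ is the algebra of bounded analytic functions on $\mathbb D$ with the supremum norm, and $H^\infty_1=\{b\in H^\infty:\|b\|_\infty\leq 1\}$. A function in $H^\infty$ is inner if its radial boundary values have modulus $1$ almost everywhere on $\mathbb T$ (unimodular constants are inner). For $b\in H^\infty_1$, $T_b:H^2\to H^2$ is multiplication by $b$ and $T_{\overline b}=T_b^*$. The de Branges-Rovnyak space is $\mathcal H(b)=(I-T_bT_{\overline b})^{1/2}H^2$ with inner product $\langle (I-T_bT_{\overline b})^{1/2}f,(I-T_bT_{\overline b})^{1/2}g\rangle_b=\langle f,g\rangle_2$ for $f,g\in H^2\ominus\ker (I-T_bT_{\overline b})^{1/2}$, where $\langle\cdot,\cdot\rangle_2$ is the inner product of $H^2$. It is a reproducing kernel Hilbert space on $\mathbb D$ with kernel $k^b_\omega(z)=\frac{1-\overline{b(\omega)}b(z)}{1-\overline\omega z}$. It is known that a rational function $b\in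 H^\infty_1$ that is not inner is a non-extreme point of $H^\infty_1$ (an extreme point being an element of $H^\infty_1$ that does not lie in any open line segment connecting two distinct points of $H^\infty_1$), and that for non-extreme $b$ the forward shift $Sf(z)=zf(z)$ maps $\mathcal H(b)$ into itself; $S_b=S|_{\mathcal H(b)}$ is then a bounded operator on $\mathcal H(b)$. Bounded operators $T_1$ on $\mathcal H_1$ and $T_2$ on $\mathcal H_2$ (Hilbert spaces) are unitarily equivalent, written $T_1\cong T_2$, if there is a unitary $U:\mathcal H_1\to\mathcal H_2$ with $UT_1=T_2U$. A function $b\in H^\infty_1$ has a Carathéodory angular derivative at $\zeta\in\mathbb T$ if $b$ and $b'$ have non-tangential limits at $\zeta$ and the limit $b(\zeta)$ satisfies $|b(\zeta)|=1$. By a well-known result of Carathéodory, this is equivalent to $\liminf_{z\to\zeta}\frac{1-|b(z)|^2}{1-|z|^2}<\infty$ (with $z\in\mathbb D$). *)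

theory Defs
  imports "HOL-Complex_Analysis.Complex_Analysis"
begin

text \<open>
  The elements of the Hilbert spaces below are functions on the open unit disc. They are encoded as
  total functions that vanish off the disc, so that equality of such functions is equality on the
  disc. Symbols \<open>b\<close> are not normalised in this way: all notions below depend only on the
  restriction of \<open>b\<close> to the disc.
\<close>

type_synonym cfun = "complex \<Rightarrow> complex"

definition taylor_coeff :: "cfun \<Rightarrow> nat \<Rightarrow> complex" where
  "taylor_coeff f n = (deriv ^^ n) f 0 / fact n"

definition H2 :: "cfun set" where
  "H2 = {f. f holomorphic_on ball 0 1 \<and> (\<forall>z. z \<notin> ball 0 1 \<longrightarrow> f z = 0) \<and>
            summable (\<lambda>n. (cmod (taylor_coeff f n))\<^sup>2)}"

definition H2_inner :: "cfun \<Rightarrow> cfun \<Rightarrow> complex" where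
  "H2_inner f g = (\<Sum>n. taylor_coeff f n * cnj (taylor_coeff g n))"

definition H2_norm :: "cfun \<Rightarrow> real" where
  "H2_norm f = sqrt (Re (H2_inner f f))"

definition Hinf :: "cfun set" where
  "Hinf = {b. b holomorphic_on ball 0 1 \<and> bounded (b ` ball 0 1)}"

definition Hinf_norm :: "cfun \<Rightarrow> real" where
  "Hinf_norm b = (SUP z\<in>ball 0 1. cmod (b z))"

definition Hinf_unit_ball :: "cfun set" where
  "Hinf_unit_ball = {b \<in> Hinf. Hinf_norm b \<le> 1}"

definition inner_function :: "cfun \<Rightarrow> bool" where
  "inner_function b \<longleftrightarrow> b \<in> Hinf \<and>
     (AE t in lebesgue_on {0..2 * pi}.
        \<exists>L. ((\<lambda>r. b (of_real r * cis t)) \<longlongrightarrow> L) (at_left 1) \<and> cmod L = 1)"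

definition rational_on_disc :: "cfun \<Rightarrow> bool" where
  "rational_on_disc b \<longleftrightarrow>
     (\<exists>p q. \<forall>z\<in>ball 0 1. poly q z \<noteq> 0 \<and> b z = poly p z / poly q z)"

subsection \<open>Operators\<close>

definition linear_map_on :: "cfun set \<Rightarrow> (cfun \<Rightarrow> cfun) \<Rightarrow> bool" where
  "linear_map_on V T \<longleftrightarrow>
     (\<forall>f\<in>V. \<forall>g\<in>V. \<forall>c d. T (\<lambda>z. c * f z + d * g z) = (\<lambda>z. c * T f z + d * T g z))"

definition H2_bounded_operator :: "(cfun \<Rightarrow> cfun) \<Rightarrow> bool" where
  "H2_bounded_operator T \<longleftrightarrow> T ` H2 \<subseteq> H2 \<and> linear_map_on H2 T \<and>
     (\<exists>C. \<forall>f\<in>H2. H2_norm (T f) \<le> C * H2_norm f)"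

definition H2_positive :: "(cfun \<Rightarrow> cfun) \<Rightarrow> bool" where
  "H2_positive T \<longleftrightarrow> H2_bounded_operator T \<and> (\<forall>f\<in>H2. H2_inner (T f) f \<in> \<real>\<^sub>\<ge>\<^sub>0)"

definition H2_adjoint :: "(cfun \<Rightarrow> cfun) \<Rightarrow> cfun \<Rightarrow> cfun" where
  "H2_adjoint T g = (THE h. h \<in> H2 \<and> (\<forall>f\<in>H2. H2_inner (T f) g = H2_inner f h))"

text \<open>
  The positive square root of a positive operator is unique only as a map on \<open>H2\<close>; its values at
  functions outside \<open>H2\<close> are arbitrary (hence \<open>SOME\<close> instead of \<open>THE\<close>) and never used.
\<close>

definition H2_sqrt :: "(cfun \<Rightarrow> cfun) \<Rightarrow> cfun \<Rightarrow> cfun" where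
  "H2_sqrt A = (SOME R. H2_positive R \<and> (\<forall>f\<in>H2. R (R f) = A f))"

definition mult_op :: "cfun \<Rightarrow> cfun \<Rightarrow> cfun" where
  "mult_op b f = (\<lambda>z. b z * f z)"

definition shift :: "cfun \<Rightarrow> cfun" where
  "shift f = (\<lambda>z. z * f z)"

definition unitarily_equivalent ::
  "cfun set \<Rightarrow> (cfun \<Rightarrow> cfun \<Rightarrow> complex) \<Rightarrow> (cfun \<Rightarrow> cfun) \<Rightarrow>
   cfun set \<Rightarrow> (cfun \<Rightarrow> cfun \<Rightarrow> complex) \<Rightarrow> (cfun \<Rightarrow> cfun) \<Rightarrow> bool" where
  "unitarily_equivalent V\<^sub>1 ip\<^sub>1 T\<^sub>1 V\<^sub>2 ip\<^sub>2 T\<^sub>2 \<longleftrightarrow>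
     (\<exists>U. linear_map_on V\<^sub>1 U \<and> U ` V\<^sub>1 = V\<^sub>2 \<and>
          (\<forall>f\<in>V\<^sub>1. \<forall>g\<in>V\<^sub>1. ip\<^sub>2 (U f) (U g) = ip\<^sub>1 f g) \<and>
          (\<forall>f\<in>V\<^sub>1. U (T\<^sub>1 f) = T\<^sub>2 (U f)))"

subsection \<open>De Branges-Rovnyak spaces\<close>

definition dBR_root :: "cfun \<Rightarrow> cfun \<Rightarrow> cfun" where
  "dBR_root b = H2_sqrt (\<lambda>f z. f z - mult_op b (H2_adjoint (mult_op b) f) z)"

definition dBR :: "cfun \<Rightarrow> cfun set" where
  "dBR b = dBR_root b ` H2"

definition dBR_root_ker :: "cfun \<Rightarrow> cfun set" where
  "dBR_root_ker b = {f \<in> H2. dBR_root b f = (\<lambda>z. 0)}"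

text \<open>The root is injective on the orthogonal complement of its kernel, with the same range.\<close>

definition dBR_preimage :: "cfun \<Rightarrow> cfun \<Rightarrow> cfun" where
  "dBR_preimage b u =
     (THE f. f \<in> H2 \<and> (\<forall>k\<in>dBR_root_ker b. H2_inner f k = 0) \<and> dBR_root b f = u)"

definition dBR_inner :: "cfun \<Rightarrow> cfun \<Rightarrow> cfun \<Rightarrow> complex" where
  "dBR_inner b u v = H2_inner (dBR_preimage b u) (dBR_preimage b v)"

subsection \<open>Angular derivatives\<close>

definition stolz_region :: "complex \<Rightarrow> real \<Rightarrow> complex set" where
  "stolz_region \<zeta> \<alpha> = {z \<in> ball 0 1. cmod (z - \<zeta>) < \<alpha> * (1 - cmod z)}"

definition nontangential_limit :: "cfun \<Rightarrow> complex \<Rightarrow> complex \<Rightarrow> bool" where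
  "nontangential_limit f \<zeta> L \<longleftrightarrow> (\<forall>\<alpha>>1. (f \<longlongrightarrow> L) (at \<zeta> within stolz_region \<zeta> \<alpha>))"

definition has_caratheodory_angular_derivative :: "cfun \<Rightarrow> complex \<Rightarrow> bool" where
  "has_caratheodory_angular_derivative b \<zeta> \<longleftrightarrow>
     (\<exists>L M. nontangential_limit b \<zeta> L \<and> nontangential_limit (deriv b) \<zeta> M \<and> cmod L = 1)"

end

theory Submission
  imports Defs
begin

text \<open>
  A bounded rational function \<open>b\<close> has an extension \<open>B\<close> that is analytic across the unit circle.
  Hence \<open>b\<close> has an angular derivative at \<open>\<zeta>\<close> if and only if \<open>cmod (B \<zeta>) = 1\<close>
  (\<open>angular_derivative_iff_unimodular\<close>). The theorem follows from a description of these points by a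
  unitary invariant of the shift \<open>S\<close> on the space \<open>dBR b\<close>: for rational \<open>b\<close> that are not inner,
  \<open>cmod (B \<zeta>) = 1\<close> if and only if the range of \<open>S - \<zeta>\<close> is not dense in \<open>dBR b\<close>. Equivalently,
  \<open>cnj \<zeta>\<close> is an eigenvalue of the adjoint of \<open>S\<close>.

  If \<open>cmod (B \<zeta>) = 1\<close>, then the squared norms \<open>(1 - cmod (b w)^2) / (1 - cmod w^2)\<close> of the
  reproducing kernels are bounded for \<open>w\<close> on the radius to \<open>\<zeta>\<close>. A function \<open>(z - \<zeta>) * g\<close> in the range
  tends to 0 along this radius, and then so does every function in the closure of the range; but the
  constant 1 is in the space (\<open>not_dense_if_unimodular\<close>).

  If \<open>cmod (B \<zeta>) < 1\<close>, let \<open>k\<close> be orthogonal to the range. Every \<open>f\<close> that is analytic on the closed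
  disc and vanishes at \<open>\<zeta>\<close> has the form \<open>(z - \<zeta>) * g\<close> with \<open>g\<close> analytic on the closed disc, and such
  \<open>g\<close> are in the space; so \<open>f\<close> is orthogonal to \<open>k\<close>. For suitable combinations \<open>f\<close> of the
  reproducing kernels at \<open>w\<close> and at \<open>r * \<zeta>\<close> this expresses \<open>k w\<close> through \<open>k (r * \<zeta>)\<close>, with
  coefficients that show \<open>k w = 0\<close> in the limit \<open>r \<rightarrow> 1\<close> (\<open>dense_if_not_unimodular\<close>).

  Both halves rest on the fact that functions analytic on the closed disc belong to \<open>dBR b\<close>
  (\<open>analytic_in_dBR\<close>). A function \<open>g\<close> is in the range of the root \<open>R\<close> of \<open>1 - T T*\<close>, where \<open>T\<close> is
  multiplication by \<open>b\<close>, as soon as \<open>h \<mapsto> \<langle>h, g\<rangle>\<close> is bounded by a multiple of the norm of \<open>R h\<close>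
  (\<open>dBR_memI\<close>). Since \<open>b\<close> is rational and not inner, \<open>1 - cmod (B z)^2\<close> is bounded below on the
  circle by a multiple of \<open>cmod (P z)^2\<close> for a polynomial \<open>P\<close> with all zeros on the circle
  (\<open>rational_gap\<close>), and hyponormality of \<open>T\<close> turns this into a lower bound for the norm of \<open>R h\<close> by
  the norm of \<open>P * h\<close> (\<open>norm_root_lower\<close>). Finally \<open>\<langle>h, g\<rangle>\<close> is bounded by the norm of \<open>P * h\<close>
  because the adjoint of multiplication by \<open>P\<close> maps the functions analytic on the closed disc onto
  themselves (\<open>adjoint_linear_factor_surj\<close>). The invariance of \<open>dBR b\<close> under \<open>S\<close> is obtained by the
  same criterion from \<open>b\<close> being in the space (\<open>dBR_shift_invariant\<close>).

  The definition of \<open>dBR b\<close> presupposes that square roots and adjoints exist. A root is a power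
  series in the contraction \<open>T T*\<close> (\<open>contraction_complement_sqrt\<close>), and the adjoint comes from the
  Riesz theorem (\<open>riesz_on_subspace\<close>).
\<close>

section \<open>Real Hilbert spaces\<close>

text \<open>
  The minimising sequences of the convex functional \<open>m \<mapsto> norm m ^ 2 - 2 * \<phi> m\<close> are Cauchy by the
  parallelogram law. As \<open>M\<close> is not required to be closed, this contains both the Riesz
  representation theorem (\<open>M = UNIV\<close>) and the projection theorem (\<open>\<phi> = inner h\<close>).
\<close>

lemma riesz_on_subspace:
  fixes \<phi> :: "'a :: {real_inner, banach} \<Rightarrow> real"
  assumes M: "subspace M"
    and add: "\<And>x y. x \<in> M \<Longrightarrow> y \<in> M \<Longrightarrow> \<phi> (x + y) = \<phi> x + \<phi> y"
    and scale: "\<And>c x. x \<in> M \<Longrightarrow> \<phi> (c *\<^sub>R x) = c * \<phi> x"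
    and bnd: "\<And>x. x \<in> M \<Longrightarrow> \<bar>\<phi> x\<bar> \<le> C * norm x"
  shows "\<exists>u\<in>closure M. \<forall>m\<in>M. \<phi> m = inner m u"
proof -
  define J where "J m = (norm m)\<^sup>2 - 2 * \<phi> m" for m
  have J_lb: "J m \<ge> - C\<^sup>2" if "m \<in> M" for m
  proof -
    have "0 \<le> (norm m - C)\<^sup>2" by simp
    moreover have "\<phi> m \<le> C * norm m" using bnd[OF that] by linarith
    ultimately show ?thesis unfolding J_def power2_diff by (simp add: algebra_simps)
  qed
  have M0: "0 \<in> M" using M by (simp add: subspace_0)
  define I where "I = Inf (J ` M)"
  have bb: "bdd_below (J ` M)" using J_lb by (auto intro!: bdd_belowI)
  have I_le: "I \<le> J m" if "m \<in> M" for m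
    unfolding I_def using bb that by (auto intro: cInf_lower)
  define \<epsilon> where "\<epsilon> = (\<lambda>n. inverse (real (Suc n)))"
  have \<epsilon>: "\<epsilon> n > 0" "\<epsilon> \<longlonglongrightarrow> 0" for n
    using LIMSEQ_inverse_real_of_nat unfolding \<epsilon>_def by auto
  have "\<exists>m\<in>M. J m < I + \<epsilon> n" for n
  proof -
    have "Inf (J ` M) < I + \<epsilon> n" by (simp add: I_def \<epsilon>)
    then show ?thesis using M0 bb by (subst (asm) cInf_less_iff) auto
  qed
  then obtain s where sM: "\<And>n. s n \<in> M" and sJ: "\<And>n. J (s n) < I + \<epsilon> n"
    by metis
  have par: "(norm (x - y))\<^sup>2 = 2 * (J x + J y - 2 * J ((1/2) *\<^sub>R (x + y)))" if "x \<in> M" "y \<in> M" for x y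
  proof -
    have "\<phi> ((1/2) *\<^sub>R (x + y)) = (\<phi> x + \<phi> y) / 2"
      using that M by (simp add: scale add subspace_add)
    then show ?thesis
      unfolding J_def power2_norm_eq_inner
      by (simp add: inner_add_left inner_add_right inner_diff_left inner_diff_right
          inner_commute algebra_simps)
  qed
  have sdist: "(norm (s m - s n))\<^sup>2 \<le> 4 * \<epsilon> N" if "m \<ge> N" "n \<ge> N" for m n N
  proof -
    have mid: "(1/2) *\<^sub>R (s m + s n) \<in> M" using sM M by (simp add: subspace_add subspace_scale)
    have "\<epsilon> m \<le> \<epsilon> N" "\<epsilon> n \<le> \<epsilon> N"
      using that by (auto simp: \<epsilon>_def intro!: le_imp_inverse_le)
    then show ?thesis using par[OF sM sM, of m n] sJ[of m] sJ[of n] I_le[OF mid] by argo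
  qed
  have "Cauchy s"
  proof (rule metric_CauchyI)
    fix e :: real assume e: "e > 0"
    obtain N where N: "\<epsilon> N < e\<^sup>2 / 4"
      using reals_Archimedean[of "e\<^sup>2 / 4"] e by (auto simp: \<epsilon>_def)
    have "dist (s m) (s n) < e" if "m \<ge> N" "n \<ge> N" for m n
    proof -
      have "(norm (s m - s n))\<^sup>2 < e\<^sup>2" using sdist[OF that] N by linarith
      then show ?thesis using e by (simp add: dist_norm power2_less_imp_less)
    qed
    then show "\<exists>N. \<forall>m\<ge>N. \<forall>n\<ge>N. dist (s m) (s n) < e" by blast
  qed
  then obtain u where u: "s \<longlonglongrightarrow> u" by (meson Cauchy_convergent convergent_def)
  have ucl: "u \<in> closure M" using u sM closure_sequential by blast
  have "\<phi> m = inner m u" if m: "m \<in> M" for m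
  proof -
    define d where "d = inner m u - \<phi> m"
    have ineq: "0 \<le> t\<^sup>2 * (norm m)\<^sup>2 + 2 * t * d" for t
    proof -
      have "- \<epsilon> n \<le> t\<^sup>2 * (norm m)\<^sup>2 + 2 * t * (inner m (s n) - \<phi> m)" for n
      proof -
        have "I \<le> J (s n + t *\<^sub>R m)" using sM m M by (intro I_le) (simp add: subspace_add subspace_scale)
        also have "J (s n + t *\<^sub>R m) = J (s n) + (t\<^sup>2 * (norm m)\<^sup>2 + 2 * t * (inner m (s n) - \<phi> m))"
        proof -
          have "\<phi> (s n + t *\<^sub>R m) = \<phi> (s n) + t * \<phi> m"
            using sM m M by (simp add: add scale subspace_scale)
          then show ?thesis
            unfolding J_def power2_norm_eq_inner
            by (simp add: inner_add_left inner_add_right inner_commute algebra_simps power2_eq_square)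
        qed
        finally show ?thesis using sJ[of n] by linarith
      qed
      moreover have "(\<lambda>n. - \<epsilon> n) \<longlonglongrightarrow> - 0"
        by (intro tendsto_minus \<epsilon>)
      moreover have "(\<lambda>n. t\<^sup>2 * (norm m)\<^sup>2 + 2 * t * (inner m (s n) - \<phi> m)) \<longlonglongrightarrow>
          t\<^sup>2 * (norm m)\<^sup>2 + 2 * t * (inner m u - \<phi> m)"
        by (intro tendsto_intros u)
      ultimately show ?thesis unfolding d_def using LIMSEQ_le by (metis (no_types, lifting) add.inverse_neutral)
    qed
    have "d = 0"
    proof (rule ccontr)
      assume "d \<noteq> 0"
      define q where "q = (norm m)\<^sup>2 + 1"
      have q: "q > 0" "(norm m)\<^sup>2 < q" unfolding q_def by (auto intro: add_nonneg_pos)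
      have "0 \<le> (- d / q)\<^sup>2 * (norm m)\<^sup>2 + 2 * (- d / q) * d" by (rule ineq)
      also have "\<dots> < (- d / q)\<^sup>2 * q + 2 * (- d / q) * d"
        using q \<open>d \<noteq> 0\<close> by (intro add_strict_right_mono mult_strict_left_mono) auto
      also have "\<dots> = - (d\<^sup>2 / q)" using q by (simp add: field_simps power2_eq_square)
      also have "\<dots> \<le> 0" using q by simp
      finally show False by simp
    qed
    then show ?thesis by (simp add: d_def)
  qed
  with ucl show ?thesis by blast
qed

section \<open>Square roots of defects of contractions\<close>

text \<open>
  The Taylor coefficients of \<open>sqrt (1 - x)\<close>. They are absolutely summable, so that the series
  can be evaluated at an arbitrary contraction.
\<close>

definition sqrt_coeff :: "nat \<Rightarrow> real" where
  "sqrt_coeff n = (-1) ^ n * ((1/2) gchoose n)"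

lemma sqrt_coeff_0: "sqrt_coeff 0 = 1"
  by (simp add: sqrt_coeff_def)

lemma sqrt_coeff_convolution:
  "(\<Sum>i\<le>n. sqrt_coeff i * sqrt_coeff (n - i)) = (if n = 0 then 1 else if n = 1 then -1 else 0)"
proof -
  have "(\<Sum>i\<le>n. sqrt_coeff i * sqrt_coeff (n - i)) =
        (\<Sum>i\<le>n. (-1) ^ n * (((1/2) gchoose i) * ((1/2) gchoose (n - i))))"
    by (intro sum.cong refl) (auto simp: sqrt_coeff_def power_add[symmetric] mult_ac)
  also have "\<dots> = (-1) ^ n * ((1::real) gchoose n)"
    using gbinomial_Vandermonde[of "1/2::real" "1/2" n]
    by (simp add: sum_distrib_left[symmetric] atLeast0AtMost)
  also have "(1::real) gchoose n = of_nat (1 choose n)"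
    using binomial_gbinomial[of 1 n, where 'a = real] by simp
  finally show ?thesis by (cases n rule: nat.exhaust; cases "n - 1") (auto simp: binomial_eq_0)
qed

text \<open>
  The partial sums \<open>p n\<close> of the coefficients are nonnegative and decreasing; so all coefficients but
  the first are nonpositive, and the sum of their absolute values telescopes to at most 1.
\<close>

lemma sqrt_coeff_summable:
  shows "\<And>n. n > 0 \<Longrightarrow> sqrt_coeff n \<le> 0"
    and "summable (\<lambda>n. \<bar>sqrt_coeff n\<bar>)"
    and "(\<Sum>n. \<bar>sqrt_coeff (Suc n)\<bar>) \<le> 1"
proof -
  define p :: "nat \<Rightarrow> real" where "p n = (-1) ^ n * ((-1/2) gchoose n)" for n
  have p_sum: "(\<Sum>k\<le>n. sqrt_coeff k) = p n" for n
    using gbinomial_sum_lower_neg[of "1/2::real" n] by (simp add: sqrt_coeff_def p_def mult.commute)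
  have p_Suc: "p (Suc n) = p n * ((real n + 1/2) / (real n + 1))" for n
    unfolding p_def using gbinomial_factors by (simp add: gbinomial_rec gbinomial_mult_1 gbinomial_prod_rev field_simps)
  have p_nonneg: "p n \<ge> 0" for n
    by (induction n) (auto simp: p_Suc p_def[of 0] intro!: mult_nonneg_nonneg divide_nonneg_nonneg)
  have p_dec: "p (Suc n) \<le> p n" for n
    using p_nonneg[of n] unfolding p_Suc by (intro mult_left_le) auto
  have c_Suc: "sqrt_coeff (Suc n) = p (Suc n) - p n" for n
    using p_sum[of n] p_sum[of "Suc n"] by simp
  show nonpos: "sqrt_coeff n \<le> 0" if "n > 0" for n
    using that p_dec[of "n - 1"] c_Suc[of "n - 1"] by (cases n) auto
  have part: "(\<Sum>k<n. \<bar>sqrt_coeff (Suc k)\<bar>) = 1 - p n" for n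
    by (induction n) (use p_dec in \<open>auto simp: c_Suc p_def[of 0]\<close>)
  have "summable (\<lambda>n. \<bar>sqrt_coeff (Suc n)\<bar>)"
    by (rule summableI_nonneg_bounded[where x = 1]) (use part p_nonneg in auto)
  then show "summable (\<lambda>n. \<bar>sqrt_coeff n\<bar>)" using summable_Suc_iff[of "\<lambda>n. \<bar>sqrt_coeff n\<bar>"] by simp
  show "(\<Sum>n. \<bar>sqrt_coeff (Suc n)\<bar>) \<le> 1"
    by (rule suminf_le_const) (use \<open>summable (\<lambda>n. \<bar>sqrt_coeff (Suc n)\<bar>)\<close> part p_nonneg in auto)
qed

lemma norm_contraction_power:
  fixes T :: "'a :: real_normed_vector \<Rightarrow> 'a"
  assumes "\<And>x. norm (T x) \<le> norm x"
  shows "norm ((T ^^ n) x) \<le> norm x"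
  by (induction n) (auto intro: order_trans[OF assms])

lemma bounded_linear_funpow:
  fixes T :: "'a :: real_normed_vector \<Rightarrow> 'a"
  assumes "bounded_linear T"
  shows "bounded_linear (T ^^ n)"
proof (induction n)
  case 0
  show ?case by (simp add: bounded_linear_ident id_def)
next
  case (Suc n)
  then show ?case using bounded_linear_compose[OF assms] by (simp add: o_def)
qed

text \<open>The rearrangement behind the Cauchy product, for terms that are not products of scalars.\<close>

lemma infsum_Cauchy_product_order:
  fixes g :: "nat \<Rightarrow> nat \<Rightarrow> 'a :: banach"
  assumes "(\<lambda>(i, j). g i j) summable_on UNIV \<times> UNIV"
  shows "(\<Sum>\<^sub>\<infinity>i. \<Sum>\<^sub>\<infinity>j. g i j) = (\<Sum>\<^sub>\<infinity>n. \<Sum>i\<le>n. g i (n - i))"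
proof -
  have bij: "bij_betw (\<lambda>(n, i). (i, n - i)) (SIGMA n:UNIV. {..n}) (UNIV \<times> (UNIV :: nat set))"
    by (rule bij_betwI[where g = "\<lambda>(i, j). (i + j, i)"]) auto
  have s: "(\<lambda>(n, i). g i (n - i)) summable_on (SIGMA n:UNIV. {..n})"
    using summable_on_reindex_bij_betw[OF bij, of "\<lambda>(i, j). g i j"] assms
    by (simp add: case_prod_unfold)
  have "(\<Sum>\<^sub>\<infinity>i. \<Sum>\<^sub>\<infinity>j. g i j) = infsum (\<lambda>(i, j). g i j) (UNIV \<times> UNIV)"
    using infsum_Sigma'_banach[OF assms] by simp
  also have "\<dots> = infsum (\<lambda>(n, i). g i (n - i)) (SIGMA n:UNIV. {..n})"
    using infsum_reindex_bij_betw[OF bij, of "\<lambda>(i, j). g i j"] by (simp add: case_prod_unfold)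
  also have "\<dots> = (\<Sum>\<^sub>\<infinity>n. \<Sum>\<^sub>\<infinity>i\<in>{..n}. g i (n - i))"
    using infsum_Sigma'_banach[OF s] by simp
  finally show ?thesis by simp
qed

lemma suminf_eq_infsum:
  fixes f :: "nat \<Rightarrow> 'a :: banach"
  assumes "summable (\<lambda>n. norm (f n))"
  shows "suminf f = infsum f UNIV"
  using norm_summable_imp_has_sum[OF assms summable_sums[OF summable_norm_cancel[OF assms]]]
  by (simp add: infsumI)

text \<open>
  The square root is the norm convergent series \<open>\<Sum>n. sqrt_coeff n * T^n\<close>. It is positive because
  the coefficients of \<open>T^n\<close> with \<open>n > 0\<close> are nonpositive and add up to at least \<open>- 1\<close>. The last
  property serves to make the root of a complex linear operator complex linear, with \<open>J\<close> the
  multiplication by the imaginary unit.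
\<close>

theorem contraction_complement_sqrt:
  fixes T :: "'a :: {real_inner, banach} \<Rightarrow> 'a"
  assumes T: "bounded_linear T" and contr: "\<And>x. norm (T x) \<le> norm x"
    and sym: "\<And>x y. inner (T x) y = inner x (T y)"
  obtains S where "bounded_linear S" and "\<And>x. S (S x) = x - T x"
    and "\<And>x y. inner (S x) y = inner x (S y)" and "\<And>x. inner (S x) x \<ge> 0"
    and "\<And>J x. bounded_linear J \<Longrightarrow> (\<And>x. J (T x) = T (J x)) \<Longrightarrow> J (S x) = S (J x)"
proof -
  let ?c = sqrt_coeff
  define S where "S x = (\<Sum>n. ?c n *\<^sub>R (T ^^ n) x)" for x
  define K where "K = (\<Sum>n. \<bar>?c n\<bar>)"
  note np = norm_contraction_power[of T, OF contr]
  have term_le: "norm (?c n *\<^sub>R (T ^^ n) x) \<le> \<bar>?c n\<bar> * norm x" for n x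
    using np[of n x] by (simp add: mult_left_mono)
  have sumc: "summable (\<lambda>n. \<bar>?c n\<bar> * norm x)" for x :: 'a
    by (intro summable_mult2 sqrt_coeff_summable)
  have nsum: "summable (\<lambda>n. norm (?c n *\<^sub>R (T ^^ n) x))" for x
    by (rule summable_comparison_test'[OF sumc[of x], of 0]) (use term_le in auto)
  have sm: "summable (\<lambda>n. ?c n *\<^sub>R (T ^^ n) x)" for x
    using summable_norm_cancel[OF nsum] .
  have Tlin: "linear (T ^^ n)" for n
    using bounded_linear_funpow[OF T] by (rule bounded_linear.linear)
  have bl: "bounded_linear S"
  proof (rule bounded_linear_intro)
    show "S (x + y) = S x + S y" for x y
      unfolding S_def by (subst suminf_add[OF sm sm]) (simp add: linear_add[OF Tlin] scaleR_add_right)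
    show "S (r *\<^sub>R x) = r *\<^sub>R S x" for r x
      using suminf_scaleR_right[OF sm, of r x]
      by (simp add: S_def linear_scale[OF Tlin] mult.commute)
    show "norm (S x) \<le> norm x * K" for x
    proof -
      have "norm (S x) \<le> (\<Sum>n. norm (?c n *\<^sub>R (T ^^ n) x))"
        unfolding S_def by (rule summable_norm[OF nsum])
      also have "\<dots> \<le> (\<Sum>n. \<bar>?c n\<bar> * norm x)" by (intro suminf_le term_le nsum sumc)
      also have "\<dots> = norm x * K"
        unfolding K_def using suminf_mult2[OF sqrt_coeff_summable(2), of "norm x"] by (simp add: mult.commute)
      finally show ?thesis .
    qed
  qed
  have sq: "S (S x) = x - T x" for x
  proof -
    define g where "g i j = (?c i * ?c j) *\<^sub>R (T ^^ (i + j)) x" for i j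
    have abs: "(\<lambda>(i, j). g i j) summable_on UNIV \<times> UNIV"
    proof (rule abs_summable_summable)
      have c: "(\<lambda>n. \<bar>?c n\<bar> * r) summable_on UNIV" for r
        using sqrt_coeff_summable(2)
        by (intro summable_on_cmult_left norm_summable_imp_summable_on) auto
      have "(\<lambda>(i, j). \<bar>?c i\<bar> * \<bar>?c j\<bar>) summable_on UNIV \<times> UNIV"
        using c[of 1] c by (intro summable_on_SigmaI[where g = "\<lambda>i. \<bar>?c i\<bar> * (\<Sum>\<^sub>\<infinity>j. \<bar>?c j\<bar>)"])
          (auto intro!: has_sum_cmult_right)
      then have "(\<lambda>p. (\<bar>?c (fst p)\<bar> * \<bar>?c (snd p)\<bar>) * norm x) summable_on UNIV \<times> UNIV"
        by (intro summable_on_cmult_left) (simp add: case_prod_unfold)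
      then show "(\<lambda>p. norm (case p of (i, j) \<Rightarrow> g i j)) summable_on UNIV \<times> UNIV"
        by (rule Infinite_Sum.abs_summable_on_comparison_test')
          (auto simp: g_def abs_mult intro!: mult_left_mono np)
    qed
    have "S (S x) = (\<Sum>i. \<Sum>j. g i j)"
    proof -
      have "?c i *\<^sub>R (T ^^ i) (S x) = (\<Sum>j. g i j)" for i
      proof -
        have b: "bounded_linear (\<lambda>y. ?c i *\<^sub>R (T ^^ i) y)"
          by (intro bounded_linear_compose[OF bounded_linear_scaleR_right bounded_linear_funpow[OF T]])
        have "?c i *\<^sub>R (T ^^ i) (S x) = (\<Sum>j. ?c i *\<^sub>R (T ^^ i) (?c j *\<^sub>R (T ^^ j) x))"
          unfolding S_def using bounded_linear.suminf[OF b sm] by simp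
        also have "\<dots> = (\<Sum>j. g i j)"
          by (simp add: g_def linear_scale[OF Tlin] funpow_add)
        finally show ?thesis .
      qed
      then show ?thesis unfolding S_def[of "S x"] by simp
    qed
    also have "\<dots> = (\<Sum>\<^sub>\<infinity>i. \<Sum>\<^sub>\<infinity>j. g i j)"
    proof -
      have gb: "norm (g i j) \<le> \<bar>?c j\<bar> * (\<bar>?c i\<bar> * norm x)" for i j
        using mult_left_mono[OF np[of "i + j" x], of "\<bar>?c j\<bar> * \<bar>?c i\<bar>"]
        by (simp add: g_def abs_mult mult_ac)
      have gs: "summable (\<lambda>j. norm (g i j))" for i
        by (rule summable_comparison_test'[OF summable_mult2[OF sqrt_coeff_summable(2)], of 0])
          (use gb in auto)
      have "norm (\<Sum>j. g i j) \<le> \<bar>?c i\<bar> * (K * norm x)" for i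
      proof -
        have "norm (\<Sum>j. g i j) \<le> (\<Sum>j. norm (g i j))" by (rule summable_norm[OF gs])
        also have "\<dots> \<le> (\<Sum>j. \<bar>?c j\<bar> * (\<bar>?c i\<bar> * norm x))"
          by (intro suminf_le gb gs summable_mult2 sqrt_coeff_summable)
        also have "\<dots> = \<bar>?c i\<bar> * (K * norm x)"
          unfolding K_def using suminf_mult2[OF sqrt_coeff_summable(2), of "\<bar>?c i\<bar> * norm x"]
          by (simp add: mult_ac)
        finally show ?thesis .
      qed
      then have "summable (\<lambda>i. norm (\<Sum>j. g i j))"
        by (intro summable_comparison_test'[OF summable_mult2[OF sqrt_coeff_summable(2)], of 0]) auto
      then have "(\<Sum>i. \<Sum>j. g i j) = (\<Sum>\<^sub>\<infinity>i. \<Sum>j. g i j)" by (rule suminf_eq_infsum)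
      then show ?thesis using suminf_eq_infsum[OF gs] by simp
    qed
    also have "\<dots> = (\<Sum>\<^sub>\<infinity>n. \<Sum>i\<le>n. g i (n - i))"
      by (rule infsum_Cauchy_product_order[OF abs])
    also have "(\<lambda>n. \<Sum>i\<le>n. g i (n - i)) = (\<lambda>n. (if n = 0 then 1 else if n = 1 then -1 else 0) *\<^sub>R (T ^^ n) x)"
    proof
      fix n
      have "(\<Sum>i\<le>n. g i (n - i)) = (\<Sum>i\<le>n. (?c i * ?c (n - i)) *\<^sub>R (T ^^ n) x)"
        by (intro sum.cong) (auto simp: g_def)
      then show "(\<Sum>i\<le>n. g i (n - i)) = (if n = 0 then 1 else if n = 1 then -1 else 0) *\<^sub>R (T ^^ n) x"
        by (simp only: scaleR_sum_left[symmetric] sqrt_coeff_convolution)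
    qed
    also have "infsum \<dots> UNIV = infsum (\<lambda>n. (if n = 0 then 1 else if n = 1 then -1 else 0) *\<^sub>R (T ^^ n) x) {0, 1}"
      by (rule infsum_cong_neutral) auto
    also have "\<dots> = x - T x" by simp
    finally show ?thesis .
  qed
  have symn: "inner ((T ^^ n) x) y = inner x ((T ^^ n) y)" for n x y
    by (induction n arbitrary: x y) (auto simp: sym funpow_swap1)
  have inner_S: "inner (S x) y = (\<Sum>n. ?c n * inner ((T ^^ n) x) y)" for x y
    unfolding S_def using bounded_linear.suminf[OF bounded_linear_inner_left[of y] sm[of x]] by simp
  have symS: "inner (S x) y = inner x (S y)" for x y
  proof -
    have "inner ((T ^^ n) x) y = inner ((T ^^ n) y) x" for n
      unfolding symn[of n x y] by (rule inner_commute)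
    then show ?thesis using inner_S[of x y] inner_S[of y x] inner_commute[of x "S y"] by simp
  qed
  have pos: "inner (S x) x \<ge> 0" for x
  proof -
    have b: "\<bar>inner ((T ^^ n) x) x\<bar> \<le> (norm x)\<^sup>2" for n
    proof -
      have "\<bar>inner ((T ^^ n) x) x\<bar> \<le> norm ((T ^^ n) x) * norm x" by (rule Cauchy_Schwarz_ineq2)
      also have "\<dots> \<le> norm x * norm x" by (intro mult_right_mono np) auto
      finally show ?thesis by (simp add: power2_eq_square)
    qed
    have s1: "summable (\<lambda>n. ?c n * inner ((T ^^ n) x) x)"
      using bounded_linear.summable[OF bounded_linear_inner_left[of x] sm[of x]] by simp
    have s0: "summable (\<lambda>n. \<bar>?c (Suc n)\<bar>)"
      using sqrt_coeff_summable(2) summable_Suc_iff[of "\<lambda>n. \<bar>?c n\<bar>"] by simp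
    have s2: "summable (\<lambda>n. \<bar>?c (Suc n)\<bar> * (norm x)\<^sup>2)"
      by (intro summable_mult2 s0)
    have "- ((norm x)\<^sup>2) \<le> - ((\<Sum>n. \<bar>?c (Suc n)\<bar>) * (norm x)\<^sup>2)"
      using mult_right_mono[OF sqrt_coeff_summable(3), of "(norm x)\<^sup>2"] by simp
    also have "\<dots> = (\<Sum>n. - (\<bar>?c (Suc n)\<bar> * (norm x)\<^sup>2))"
      using suminf_minus[OF s2] suminf_mult2[OF s0, of "(norm x)\<^sup>2"] by simp
    also have "\<dots> \<le> (\<Sum>n. ?c (Suc n) * inner ((T ^^ Suc n) x) x)"
    proof (rule suminf_le)
      fix n
      have "\<bar>?c (Suc n) * inner ((T ^^ Suc n) x) x\<bar> \<le> \<bar>?c (Suc n)\<bar> * (norm x)\<^sup>2"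
        unfolding abs_mult by (intro mult_left_mono b) auto
      then show "- (\<bar>?c (Suc n)\<bar> * (norm x)\<^sup>2) \<le> ?c (Suc n) * inner ((T ^^ Suc n) x) x" by linarith
    next
      show "summable (\<lambda>n. - (\<bar>?c (Suc n)\<bar> * (norm x)\<^sup>2))" using s2 by (rule summable_minus)
      show "summable (\<lambda>n. ?c (Suc n) * inner ((T ^^ Suc n) x) x)"
        using s1 summable_Suc_iff[of "\<lambda>n. ?c n * inner ((T ^^ n) x) x"] by simp
    qed
    also have "\<dots> = inner (S x) x - (norm x)\<^sup>2"
      unfolding inner_S using suminf_split_head[OF s1] by (simp add: sqrt_coeff_0 power2_norm_eq_inner)
    finally show ?thesis by simp
  qed
  have comm: "J (S x) = S (J x)" if J: "bounded_linear J" and JT: "\<And>x. J (T x) = T (J x)" for J x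
  proof -
    have "J ((T ^^ n) x) = (T ^^ n) (J x)" for n by (induction n) (auto simp: JT)
    then show ?thesis
      unfolding S_def using bounded_linear.suminf[OF J sm, of x]
      by (simp add: linear_scale[OF bounded_linear.linear[OF J]])
  qed
  show ?thesis using that[OF bl sq symS pos comm] by blast
qed

section \<open>Taylor coefficients and means over circles\<close>

lemma taylor_coeff_sums:
  assumes "f holomorphic_on ball 0 1" and "cmod z < 1"
  shows "(\<lambda>n. taylor_coeff f n * z ^ n) sums f z"
  using holomorphic_power_series[OF assms(1), of z] assms(2) by (simp add: taylor_coeff_def)

lemma power_series_on_disc:
  assumes "\<And>z. cmod z < 1 \<Longrightarrow> (\<lambda>n. a n * z ^ n) sums f z"
  shows "f holomorphic_on ball 0 1" and "taylor_coeff f n = a n"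
proof -
  have hol: "f holomorphic_on ball 0 1"
    by (rule power_series_holomorphic[where a = a]) (use assms in auto)
  then show "f holomorphic_on ball 0 1" .
  have "fps_conv_radius (Abs_fps a) \<ge> 1"
    unfolding fps_conv_radius_def
  proof (rule conv_radius_geI_ex)
    fix r :: real assume r: "0 < r" "ereal r < 1"
    then have "summable (\<lambda>n. a n * of_real r ^ n)" by (intro sums_summable[OF assms]) auto
    then show "\<exists>z. norm z = r \<and> summable (\<lambda>n. fps_nth (Abs_fps a) n * z ^ n)"
      using r by (intro exI[of _ "of_real r"]) auto
  qed
  moreover have "eventually (\<lambda>z. eval_fps (Abs_fps a) z = f z) (nhds 0)"
    using eventually_nhds_in_open[of "ball (0::complex) 1" 0]
    by (auto elim!: eventually_mono simp: eval_fps_def intro!: sums_unique[symmetric] assms)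
  ultimately have "f has_fps_expansion Abs_fps a"
    by (auto simp: has_fps_expansion_def intro: less_le_trans[of 0 1])
  then have "fps_expansion f 0 = Abs_fps a" by (rule fps_expansion_eqI)
  then show "taylor_coeff f n = a n"
    by (metis fps_expansion_def fps_nth_Abs_fps taylor_coeff_def)
qed

lemma taylor_coeff_lincomb:
  assumes "f holomorphic_on ball 0 1" "g holomorphic_on ball 0 1"
  shows "taylor_coeff (\<lambda>z. c * f z + d * g z) n = c * taylor_coeff f n + d * taylor_coeff g n"
  by (rule power_series_on_disc(2))
    (use sums_add[OF sums_mult[OF taylor_coeff_sums[OF assms(1)]] sums_mult[OF taylor_coeff_sums[OF assms(2)]]]
     in \<open>simp add: algebra_simps\<close>)

definition cmean :: "real \<Rightarrow> cfun \<Rightarrow> complex" where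
  "cmean r F = integral {0..2 * pi} (\<lambda>t. F (of_real r * cis t)) / of_real (2 * pi)"

lemma on_circle: "0 \<le> r \<Longrightarrow> of_real r * cis t \<in> sphere 0 r"
  by (simp add: norm_mult)

lemma continuous_on_circle:
  assumes "continuous_on (sphere 0 r) F" and "0 \<le> r"
  shows "continuous_on {0..2 * pi} (\<lambda>t. F (of_real r * cis t))"
  by (rule continuous_on_compose2[OF assms(1)]) (auto intro!: continuous_intros simp: norm_mult assms(2))

lemma cmean_cnj: "cmean r (\<lambda>z. cnj (F z)) = cnj (cmean r F)"
  by (simp add: cmean_def integral_cnj)

lemma cmean_mono:
  assumes "continuous_on (sphere 0 r) F" "continuous_on (sphere 0 r) G" and "0 \<le> r"
    and "\<And>z. cmod z = r \<Longrightarrow> Re (F z) \<le> Re (G z)"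
  shows "Re (cmean r F) \<le> Re (cmean r G)"
proof -
  have F: "(\<lambda>t. F (of_real r * cis t)) integrable_on {0..2 * pi}"
    and G: "(\<lambda>t. G (of_real r * cis t)) integrable_on {0..2 * pi}"
    using assms(1-3) by (auto intro!: integrable_continuous_interval continuous_on_circle)
  have "integral {0..2 * pi} (\<lambda>t. Re (F (of_real r * cis t))) \<le> integral {0..2 * pi} (\<lambda>t. Re (G (of_real r * cis t)))"
    using integrable_linear[OF F bounded_linear_Re] integrable_linear[OF G bounded_linear_Re] assms(3,4)
    by (intro integral_le) (auto simp: o_def norm_mult)
  then show ?thesis
    using integral_linear[OF F bounded_linear_Re] integral_linear[OF G bounded_linear_Re]
    by (simp add: cmean_def o_def divide_right_mono)
qed

lemma cmean_lincomb:
  assumes "continuous_on (sphere 0 r) F" "continuous_on (sphere 0 r) G" and "0 \<le> r"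
  shows "cmean r (\<lambda>z. c * F z + d * G z) = c * cmean r F + d * cmean r G"
proof -
  have F: "(\<lambda>t. F (of_real r * cis t)) integrable_on {0..2 * pi}"
    and G: "(\<lambda>t. G (of_real r * cis t)) integrable_on {0..2 * pi}"
    using assms(1-3) by (auto intro!: integrable_continuous_interval continuous_on_circle)
  show ?thesis
    unfolding cmean_def using F G
    by (subst integral_add) (auto simp: add_divide_distrib intro!: integrable_on_mult_right)
qed

lemma cmean_monomials:
  assumes "0 \<le> r"
  shows "cmean r (\<lambda>z. z ^ m * cnj (z ^ n)) = (if m = n then of_real (r ^ (2 * n)) else 0)"
proof -
  define k :: real where "k = real m - real n"
  have c: "cis t ^ m * cis (- t) ^ n = cis (k * t)" for t
  proof -
    have "cis t ^ m * cis (- t) ^ n = cis (real m * t + real n * (- t))"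
      by (simp only: Complex.DeMoivre cis_mult)
    also have "real m * t + real n * (- t) = k * t" by (simp add: k_def left_diff_distrib)
    finally show ?thesis .
  qed
  have e: "(of_real r * cis t) ^ m * cnj ((of_real r * cis t) ^ n) = of_real (r ^ (m + n)) * cis (k * t)" for t
  proof -
    have "(of_real r * cis t) ^ m * cnj ((of_real r * cis t) ^ n)
        = of_real (r ^ (m + n)) * (cis t ^ m * cis (- t) ^ n)"
      by (simp add: power_mult_distrib power_add cis_cnj)
    then show ?thesis by (simp only: c)
  qed
  have cm: "cmean r (\<lambda>z. z ^ m * cnj (z ^ n))
      = integral {0..2 * pi} (\<lambda>t. of_real (r ^ (m + n)) * cis (k * t)) / of_real (2 * pi)"
    by (simp only: cmean_def e)
  show ?thesis
  proof (cases "m = n")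
    case True
    then have "k = 0" by (simp add: k_def)
    then have "(\<lambda>t. of_real (r ^ (m + n)) * cis (k * t)) = (\<lambda>t. of_real (r ^ (2 * n)) :: complex)"
      using True by (simp add: mult_2)
    moreover have "integral {0..2 * pi} (\<lambda>t. of_real (r ^ (2 * n)) :: complex) = of_real (2 * pi) * of_real (r ^ (2 * n))"
      by (simp add: scaleR_conv_of_real)
    ultimately show ?thesis using True unfolding cm by simp
  next
    case False
    then have k: "k \<noteq> 0" by (simp add: k_def)
    define F :: "real \<Rightarrow> complex" where "F t = exp (\<i> * of_real k * of_real t) / (\<i> * of_real k)" for t
    have "((\<lambda>t. cis (k * t)) has_integral F (2 * pi) - F 0) {0..2 * pi}"
    proof (rule fundamental_theorem_of_calculus)
      fix t
      have "((\<lambda>z. exp (\<i> * of_real k * z) / (\<i> * of_real k)) has_field_derivative exp (\<i> * of_real k * of_real t))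
            (at (of_real t))"
        using k by (auto intro!: derivative_eq_intros)
      then have "(F has_vector_derivative exp (\<i> * of_real k * of_real t)) (at t within {0..2 * pi})"
        unfolding F_def by (rule has_vector_derivative_real_field)
      then show "(F has_vector_derivative cis (k * t)) (at t within {0..2 * pi})"
        by (simp add: cis_conv_exp mult.assoc)
    qed simp
    moreover have "F (2 * pi) = F 0"
    proof -
      have "exp (\<i> * of_real k * of_real (2 * pi)) = cis (2 * pi * of_int (int m - int n))"
        by (simp add: cis_conv_exp k_def mult_ac)
      then show ?thesis by (simp add: F_def cis_multiple_2pi)
    qed
    ultimately have "((\<lambda>t. of_real (r ^ (m + n)) * cis (k * t)) has_integral of_real (r ^ (m + n)) * 0) {0..2 * pi}"
      by (intro has_integral_mult_right) simp
    from integral_unique[OF this] show ?thesis unfolding cm using False by (simp del: integral_mult_right)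
  qed
qed

text \<open>A power series converges uniformly on smaller circles, and can be integrated termwise.\<close>

lemma cmean_power_series:
  assumes f: "f holomorphic_on ball 0 1" and G: "continuous_on (sphere 0 r) G" and r: "0 \<le> r" "r < 1"
  shows "(\<lambda>n. taylor_coeff f n * cmean r (\<lambda>z. z ^ n * G z)) sums cmean r (\<lambda>z. f z * G z)"
proof -
  let ?z = "\<lambda>t. of_real r * cis t :: complex"
  let ?h = "\<lambda>n t. taylor_coeff f n * (?z t ^ n * G (?z t))"
  have "compact ((\<lambda>z. G z) ` sphere 0 r)" using G by (intro compact_continuous_image) auto
  then obtain B where B: "\<And>z. z \<in> sphere 0 r \<Longrightarrow> norm (G z) \<le> B"
    using compact_imp_bounded bounded_iff by (metis imageI)
  have "(r + 1) / 2 < 1" "r < (r + 1) / 2" using r by auto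
  then have "summable (\<lambda>n. norm (taylor_coeff f n * of_real r ^ n))"
    using sums_summable[OF taylor_coeff_sums[OF f, of "of_real ((r + 1) / 2)"]] r
    by (intro powser_insidea[where x = "of_real ((r + 1) / 2) :: complex"]) auto
  then have sm: "summable (\<lambda>n. norm (taylor_coeff f n * of_real r ^ n) * B)" by (rule summable_mult2)
  have ul: "uniform_limit {0..2 * pi} (\<lambda>N t. \<Sum>n<N. ?h n t) (\<lambda>t. \<Sum>n. ?h n t) sequentially"
  proof (rule Weierstrass_m_test[OF _ sm])
    fix n t
    have "norm (?h n t) = norm (taylor_coeff f n * of_real r ^ n) * norm (G (?z t))"
      using r by (simp add: norm_mult norm_power)
    also have "\<dots> \<le> norm (taylor_coeff f n * of_real r ^ n) * B"
      using B[OF on_circle[OF r(1)]] by (intro mult_left_mono) auto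
    finally show "norm (?h n t) \<le> norm (taylor_coeff f n * of_real r ^ n) * B" .
  qed
  have lim: "(\<Sum>n. ?h n t) = f (?z t) * G (?z t)" for t
  proof -
    have "cmod (?z t) < 1" using r by (simp add: norm_mult)
    from sums_mult2[OF taylor_coeff_sums[OF f this], of "G (?z t)"]
    show ?thesis by (simp add: sums_iff mult.assoc)
  qed
  have cont: "continuous_on {0..2 * pi} (?h n)" for n
    using G r by (intro continuous_intros continuous_on_circle)
  then have conts: "continuous_on {0..2 * pi} (\<lambda>t. \<Sum>n<N. ?h n t)" for N
    by (intro continuous_on_sum)
  obtain I J where I: "\<And>N. ((\<lambda>t. \<Sum>n<N. ?h n t) has_integral I N) {0..2 * pi}"
    and J: "((\<lambda>t. \<Sum>n. ?h n t) has_integral J) {0..2 * pi}" and IJ: "I \<longlonglongrightarrow> J"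
    using uniform_limit_integral[OF ul conts] by auto
  have "I N = (\<Sum>n<N. taylor_coeff f n * (cmean r (\<lambda>z. z ^ n * G z) * of_real (2 * pi)))" for N
  proof -
    have "I N = integral {0..2 * pi} (\<lambda>t. \<Sum>n<N. ?h n t)" using integral_unique[OF I[of N]] by (rule sym)
    also have "\<dots> = (\<Sum>n<N. integral {0..2 * pi} (?h n))"
      by (intro integral_sum integrable_continuous_interval cont) auto
    also have "\<dots> = (\<Sum>n<N. taylor_coeff f n * (cmean r (\<lambda>z. z ^ n * G z) * of_real (2 * pi)))"
      by (intro sum.cong) (auto simp: cmean_def)
    finally show ?thesis .
  qed
  then have "I = (\<lambda>N. \<Sum>n<N. taylor_coeff f n * (cmean r (\<lambda>z. z ^ n * G z) * of_real (2 * pi)))"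
    by (rule ext)
  then have "(\<lambda>n. taylor_coeff f n * (cmean r (\<lambda>z. z ^ n * G z) * of_real (2 * pi))) sums J"
    using IJ unfolding sums_def by simp
  then have "(\<lambda>n. taylor_coeff f n * (cmean r (\<lambda>z. z ^ n * G z) * of_real (2 * pi)) / of_real (2 * pi)) sums (J / of_real (2 * pi))"
    by (rule sums_divide)
  moreover have "J / of_real (2 * pi) = cmean r (\<lambda>z. f z * G z)"
    using integral_unique[OF J] by (simp add: cmean_def lim)
  ultimately show ?thesis by simp
qed

text \<open>
  Integrating termwise first in \<open>f\<close> and then in \<open>g\<close> reduces Parseval's identity to the orthogonality
  of the monomials.
\<close>

lemma parseval_circle:
  assumes f: "f holomorphic_on ball 0 1" and g: "g holomorphic_on ball 0 1" and r: "0 \<le> r" "r < 1"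
  shows "(\<lambda>n. taylor_coeff f n * cnj (taylor_coeff g n) * of_real (r ^ (2 * n))) sums cmean r (\<lambda>z. f z * cnj (g z))"
proof -
  have sub: "sphere 0 r \<subseteq> ball (0::complex) 1" using r by auto
  have cg: "continuous_on (sphere 0 r) g"
    using holomorphic_on_imp_continuous_on[OF g] continuous_on_subset sub by blast
  have "cmean r (\<lambda>z. z ^ n * cnj (g z)) = cnj (taylor_coeff g n) * of_real (r ^ (2 * n))" for n
  proof -
    have "(\<lambda>m. taylor_coeff g m * cmean r (\<lambda>z. z ^ m * cnj (z ^ n))) sums cmean r (\<lambda>z. g z * cnj (z ^ n))"
      by (intro cmean_power_series g r continuous_intros)
    then have "(\<lambda>m. if m = n then taylor_coeff g m * of_real (r ^ (2 * n)) else 0) sums cmean r (\<lambda>z. g z * cnj (z ^ n))"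
      by (simp only: cmean_monomials[OF r(1)] if_distrib mult_zero_right)
    then have "cmean r (\<lambda>z. g z * cnj (z ^ n)) = taylor_coeff g n * of_real (r ^ (2 * n))"
      using sums_unique2 sums_single[of n "\<lambda>m. taylor_coeff g m * of_real (r ^ (2 * n))"] by blast
    then show ?thesis
      using cmean_cnj[of r "\<lambda>z. g z * cnj (z ^ n)"] by (simp add: mult.commute)
  qed
  then show ?thesis
    using cmean_power_series[OF f _ r, of "\<lambda>z. cnj (g z)"] cg
    by (simp add: mult.assoc continuous_intros)
qed

text \<open>Absolute convergence makes the series uniformly convergent for \<open>r\<close> in \<open>{0..1}\<close>.\<close>

lemma abel_limit_abs:
  fixes a :: "nat \<Rightarrow> complex"
  assumes "summable (\<lambda>n. cmod (a n))"
  shows "((\<lambda>r. \<Sum>n. a n * of_real (r ^ (2 * n))) \<longlongrightarrow> (\<Sum>n. a n)) (at_left 1)"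
proof -
  have "uniform_limit {0..1} (\<lambda>N r. \<Sum>n<N. a n * of_real (r ^ (2 * n))) (\<lambda>r. \<Sum>n. a n * of_real (r ^ (2 * n))) sequentially"
    by (rule Weierstrass_m_test[OF _ assms])
      (auto simp: norm_mult norm_power intro!: mult_left_le power_le_one)
  then have "continuous_on {0..1} (\<lambda>r::real. \<Sum>n. a n * of_real (r ^ (2 * n)))"
    by (rule uniform_limit_theorem[rotated]) (auto intro!: continuous_intros always_eventually)
  then have "((\<lambda>r. \<Sum>n. a n * of_real (r ^ (2 * n))) \<longlongrightarrow> (\<Sum>n. a n * of_real (1 ^ (2 * n)))) (at 1 within {0..1})"
    unfolding continuous_on_def by (rule bspec) simp
  moreover have "at 1 within {0..1} = at_left (1::real)"
    by (rule at_within_Icc_at_left) auto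
  ultimately show ?thesis by (simp del: of_real_power)
qed

section \<open>The Hardy space as a Hilbert space\<close>

lemma summable_mult_cnj:
  fixes a b :: "nat \<Rightarrow> complex"
  assumes "summable (\<lambda>n. (cmod (a n))\<^sup>2)" "summable (\<lambda>n. (cmod (b n))\<^sup>2)"
  shows "summable (\<lambda>n. cmod (a n * cnj (b n)))"
proof (rule summable_comparison_test'[of "\<lambda>n. (cmod (a n))\<^sup>2 + (cmod (b n))\<^sup>2" 0])
  show "summable (\<lambda>n. (cmod (a n))\<^sup>2 + (cmod (b n))\<^sup>2)" by (intro summable_add assms)
  show "norm (cmod (a n * cnj (b n))) \<le> (cmod (a n))\<^sup>2 + (cmod (b n))\<^sup>2" for n
  proof -
    have "0 \<le> cmod (a n) * cmod (b n)" by simp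
    with sum_squares_bound[of "cmod (a n)" "cmod (b n)"]
    have "cmod (a n) * cmod (b n) \<le> (cmod (a n))\<^sup>2 + (cmod (b n))\<^sup>2" by linarith
    then show ?thesis by (simp add: norm_mult)
  qed
qed

lemma summable_lincomb_sq:
  fixes a b :: "nat \<Rightarrow> complex"
  assumes "summable (\<lambda>n. (cmod (a n))\<^sup>2)" "summable (\<lambda>n. (cmod (b n))\<^sup>2)"
  shows "summable (\<lambda>n. (cmod (c * a n + d * b n))\<^sup>2)"
proof (rule summable_comparison_test'[of "\<lambda>n. 2 * ((cmod c)\<^sup>2 * (cmod (a n))\<^sup>2) + 2 * ((cmod d)\<^sup>2 * (cmod (b n))\<^sup>2)" 0])
  show "summable (\<lambda>n. 2 * ((cmod c)\<^sup>2 * (cmod (a n))\<^sup>2) + 2 * ((cmod d)\<^sup>2 * (cmod (b n))\<^sup>2))"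
    by (intro summable_add summable_mult assms)
  show "norm ((cmod (c * a n + d * b n))\<^sup>2) \<le> 2 * ((cmod c)\<^sup>2 * (cmod (a n))\<^sup>2) + 2 * ((cmod d)\<^sup>2 * (cmod (b n))\<^sup>2)" for n
  proof -
    have "(cmod (c * a n + d * b n))\<^sup>2 \<le> (cmod (c * a n) + cmod (d * b n))\<^sup>2"
      by (intro power_mono norm_triangle_ineq) auto
    also have "\<dots> \<le> 2 * (cmod (c * a n))\<^sup>2 + 2 * (cmod (d * b n))\<^sup>2"
      using sum_squares_bound[of "cmod (c * a n)" "cmod (d * b n)"] by (simp add: power2_sum)
    finally show ?thesis by (simp add: norm_mult power_mult_distrib)
  qed
qed

lemma H2_lincomb:
  assumes "f \<in> H2" "g \<in> H2"
  shows "(\<lambda>z. c * f z + d * g z) \<in> H2"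
proof -
  have hol: "f holomorphic_on ball 0 1" "g holomorphic_on ball 0 1"
    using assms by (auto simp: H2_def)
  then have "(\<lambda>z. c * f z + d * g z) holomorphic_on ball 0 1" by (intro holomorphic_intros)
  then show ?thesis
    using assms by (simp add: H2_def taylor_coeff_lincomb[OF hol] summable_lincomb_sq)
qed

lemma H2_zero: "(\<lambda>z. 0) \<in> H2"
proof -
  have "taylor_coeff (\<lambda>z. 0) n = 0" for n by (rule power_series_on_disc(2)) auto
  then show ?thesis by (simp add: H2_def)
qed

text \<open>
  As a type, the Hardy space becomes an instance of the classes of real Hilbert spaces; complex
  combinations and the complex inner product are provided separately.
\<close>

typedef h2 = H2 morphisms fn mk
  using H2_zero by blast

setup_lifting type_definition_h2

definition coef :: "h2 \<Rightarrow> nat \<Rightarrow> complex" where "coef x = taylor_coeff (fn x)"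

definition cip :: "h2 \<Rightarrow> h2 \<Rightarrow> complex" where "cip x y = H2_inner (fn x) (fn y)"

lemma holomorphic_fn: "fn x holomorphic_on ball 0 1"
  and fn_outside: "z \<notin> ball 0 1 \<Longrightarrow> fn x z = 0"
  and summable_coef: "summable (\<lambda>n. (cmod (coef x n))\<^sup>2)"
  using fn[of x] by (auto simp: H2_def coef_def)

lemma fn_sums: "cmod z < 1 \<Longrightarrow> (\<lambda>n. coef x n * z ^ n) sums fn x z"
  unfolding coef_def by (intro taylor_coeff_sums holomorphic_fn)

lemma h2_eqI: "(\<And>z. cmod z < 1 \<Longrightarrow> fn x z = fn y z) \<Longrightarrow> x = y"
proof -
  assume "\<And>z. cmod z < 1 \<Longrightarrow> fn x z = fn y z"
  then have "fn x z = fn y z" for z using fn_outside[of z x] fn_outside[of z y] by (cases "cmod z < 1") auto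
  then show "x = y" by (simp add: fn_inject[symmetric] fun_eq_iff)
qed

lemma coef_inject:
  assumes "\<And>n. coef x n = coef y n"
  shows "x = y"
proof (rule h2_eqI)
  fix z :: complex assume z: "cmod z < 1"
  show "fn x z = fn y z"
    using fn_sums[OF z, of y] by (intro sums_unique2[OF fn_sums[OF z, of x]]) (simp add: assms)
qed

lift_definition lincomb :: "complex \<Rightarrow> h2 \<Rightarrow> complex \<Rightarrow> h2 \<Rightarrow> h2" is
  "\<lambda>c f d g z. c * f z + d * g z" by (rule H2_lincomb)

lemma coef_lincomb: "coef (lincomb c x d y) n = c * coef x n + d * coef y n"
  unfolding coef_def lincomb.rep_eq by (rule taylor_coeff_lincomb) (rule holomorphic_fn)+

lemma summable_cip: "summable (\<lambda>n. cmod (coef x n * cnj (coef y n)))"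
  by (intro summable_mult_cnj summable_coef)

lemma cip_sums: "(\<lambda>n. coef x n * cnj (coef y n)) sums cip x y"
  unfolding cip_def H2_inner_def coef_def[symmetric]
  by (intro summable_sums summable_norm_cancel[OF summable_cip])

lemma cip_lincomb_left: "cip (lincomb c x d y) w = c * cip x w + d * cip y w"
  by (rule sums_unique2[OF cip_sums])
    (use sums_add[OF sums_mult[OF cip_sums[of x w]] sums_mult[OF cip_sums[of y w]], of c d]
     in \<open>simp add: coef_lincomb algebra_simps\<close>)

lemma cnj_cip: "cnj (cip x y) = cip y x"
  by (rule sums_unique2[OF _ cip_sums])
    (use sums_cnj[THEN iffD2, OF cip_sums[of x y]] in \<open>simp add: mult.commute\<close>)

lemma cip_lincomb_right: "cip w (lincomb c x d y) = cnj c * cip w x + cnj d * cip w y"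
  by (metis cnj_cip cip_lincomb_left complex_cnj_add complex_cnj_mult)

lemma cip_self_sums: "(\<lambda>n. (cmod (coef x n))\<^sup>2) sums Re (cip x x)"
  using sums_Re[OF cip_sums[of x x]] by (simp add: cmod_power2[symmetric] complex_mult_cnj)

lemma cip_self: "cip x x = of_real (Re (cip x x))"
  using cnj_cip[of x x] by (metis Reals_cnj_iff of_real_Re)

lemma cip_self_nonneg: "0 \<le> Re (cip x x)"
  using sums_le[OF _ sums_zero cip_self_sums] by simp

lemma cip_self_eq_0: "Re (cip x x) = 0 \<Longrightarrow> coef x n = 0"
  using cip_self_sums[of x] suminf_eq_zero_iff[OF summable_coef[of x]]
  by (simp add: sums_iff)

text \<open>The power series converges on the disc since the powers of \<open>z\<close> are square summable as well.\<close>

lemma h2_of_coefs: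
  assumes "summable (\<lambda>n. (cmod (a n))\<^sup>2)"
  obtains x where "\<And>n. coef x n = a n"
proof -
  define f where "f z = (if z \<in> ball 0 1 then \<Sum>n. a n * z ^ n else 0)" for z :: complex
  have "(\<lambda>n. a n * z ^ n) sums f z" if z: "cmod z < 1" for z
  proof -
    have "summable (\<lambda>n. (cmod (cnj (z ^ n)))\<^sup>2)"
      using z by (simp add: norm_power power_mult[symmetric] mult.commute[of _ 2])
        (simp add: power_mult summable_geometric power_less_one_iff abs_square_less_1)
    from summable_mult_cnj[OF assms this] have "summable (\<lambda>n. a n * z ^ n)"
      using summable_norm_cancel by fastforce
    then show ?thesis using z by (simp add: f_def summable_sums)
  qed
  note ps = power_series_on_disc[of a f, OF this]
  then have "f \<in> H2" using assms by (auto simp: H2_def f_def)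
  with ps(2) show ?thesis using that[of "mk f"] by (simp add: coef_def mk_inverse)
qed

instantiation h2 :: real_inner
begin

definition zero_h2 :: h2 where "zero_h2 = mk (\<lambda>z. 0)"
definition plus_h2 :: "h2 \<Rightarrow> h2 \<Rightarrow> h2" where "x + y = lincomb 1 x 1 y"
definition minus_h2 :: "h2 \<Rightarrow> h2 \<Rightarrow> h2" where "x - y = lincomb 1 x (-1) y"
definition uminus_h2 :: "h2 \<Rightarrow> h2" where "- x = lincomb (-1) x 0 (x :: h2)"
definition scaleR_h2 :: "real \<Rightarrow> h2 \<Rightarrow> h2" where "r *\<^sub>R x = lincomb (of_real r) x 0 (x :: h2)"
definition inner_h2 :: "h2 \<Rightarrow> h2 \<Rightarrow> real" where "inner x y = Re (cip x y)"
definition norm_h2 :: "h2 \<Rightarrow> real" where "norm x = sqrt (Re (cip x x))"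
definition dist_h2 :: "h2 \<Rightarrow> h2 \<Rightarrow> real" where "dist x y = norm (x - y :: h2)"
definition sgn_h2 :: "h2 \<Rightarrow> h2" where "sgn x = inverse (norm x) *\<^sub>R (x :: h2)"
definition uniformity_h2 :: "(h2 \<times> h2) filter"
  where "uniformity_h2 = (INF e\<in>{0 <..}. principal {(x, y). dist x y < e})"
definition open_h2 :: "h2 set \<Rightarrow> bool"
  where "open_h2 U \<longleftrightarrow> (\<forall>x\<in>U. eventually (\<lambda>(x', y). x' = x \<longrightarrow> y \<in> U) uniformity)"

instance
proof
  have z: "fn 0 = (\<lambda>z. 0)" by (simp add: zero_h2_def mk_inverse H2_zero)
  note d = plus_h2_def minus_h2_def uminus_h2_def scaleR_h2_def z lincomb.rep_eq
  fix x y w :: h2 and a b :: real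
  show "x + y + w = x + (y + w)" by (rule h2_eqI) (simp add: d)
  show "x + y = y + x" by (rule h2_eqI) (simp add: d)
  show "0 + x = x" by (rule h2_eqI) (simp add: d)
  show "- x + x = 0" by (rule h2_eqI) (simp add: d)
  show "x - y = x + - y" by (rule h2_eqI) (simp add: d)
  show "a *\<^sub>R (x + y) = a *\<^sub>R x + a *\<^sub>R y" by (rule h2_eqI) (simp add: d algebra_simps)
  show "(a + b) *\<^sub>R x = a *\<^sub>R x + b *\<^sub>R x" by (rule h2_eqI) (simp add: d algebra_simps)
  show "a *\<^sub>R b *\<^sub>R x = (a * b) *\<^sub>R x" by (rule h2_eqI) (simp add: d)
  show "1 *\<^sub>R x = x" by (rule h2_eqI) (simp add: d)
  show "dist x y = norm (x - y)" by (rule dist_h2_def)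
  show "sgn x = inverse (norm x) *\<^sub>R x" by (rule sgn_h2_def)
  show "uniformity = (INF e\<in>{0 <..}. principal {(x, y :: h2). dist x y < e})" by (rule uniformity_h2_def)
  show "open U \<longleftrightarrow> (\<forall>x\<in>U. \<forall>\<^sub>F (x', y) in uniformity. x' = x \<longrightarrow> y \<in> U)" for U :: "h2 set"
    by (rule open_h2_def)
  show "inner x y = inner y x" by (simp add: inner_h2_def cnj_cip[of x y, symmetric])
  show "inner (x + y) w = inner x w + inner y w" by (simp add: inner_h2_def plus_h2_def cip_lincomb_left)
  show "inner (a *\<^sub>R x) y = a * inner x y" by (simp add: inner_h2_def scaleR_h2_def cip_lincomb_left)
  show "0 \<le> inner x x" by (simp add: inner_h2_def cip_self_nonneg)
  show "norm x = sqrt (inner x x)" by (simp add: norm_h2_def inner_h2_def)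
  show "inner x x = 0 \<longleftrightarrow> x = 0"
  proof
    assume "inner x x = 0"
    then have c: "coef x n = 0" for n by (simp add: inner_h2_def cip_self_eq_0)
    show "x = 0"
    proof (rule h2_eqI)
      fix z :: complex assume "cmod z < 1"
      from fn_sums[OF this, of x] show "fn x z = fn 0 z" by (simp add: c z sums_unique2)
    qed
  next
    assume "x = 0"
    have "Re (cip 0 0) = 0"
      using cip_lincomb_left[of 0 0 0 0 0] by (simp add: cip_def H2_inner_def z) (simp add: H2_inner_def taylor_coeff_def)
    then show "inner x x = 0" by (simp add: \<open>x = 0\<close> inner_h2_def)
  qed
qed

end

lemma fn_zero: "fn 0 z = 0"
  and fn_plus: "fn (x + y) z = fn x z + fn y z"
  and fn_diff: "fn (x - y) z = fn x z - fn y z"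
  and fn_scaleR: "fn (r *\<^sub>R x) z = of_real r * fn x z"
  by (simp_all add: zero_h2_def plus_h2_def minus_h2_def scaleR_h2_def lincomb.rep_eq mk_inverse H2_zero)

lemmas fn_simps = fn_zero fn_plus fn_diff fn_scaleR lincomb.rep_eq

lemma coef_diff: "coef (x - y) n = coef x n - coef y n"
  by (simp add: minus_h2_def coef_lincomb)

lemma cip_add_left: "cip (x + y) w = cip x w + cip y w"
  and cip_diff_left: "cip (x - y) w = cip x w - cip y w"
  and cip_diff_right: "cip w (x - y) = cip w x - cip w y"
  and cip_zero_left: "cip 0 w = 0"
  and cip_zero_right: "cip w 0 = 0"
proof -
  show "cip (x + y) w = cip x w + cip y w" "cip (x - y) w = cip x w - cip y w"
    "cip w (x - y) = cip w x - cip w y"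
    by (simp_all add: plus_h2_def minus_h2_def cip_lincomb_left cip_lincomb_right)
  then show "cip 0 w = 0" "cip w 0 = 0"
    using cip_lincomb_left[of 1 0 "-1" 0 w] cip_lincomb_right[of w 1 0 "-1" 0]
    by (metis minus_h2_def diff_self cip_lincomb_left add.right_inverse mult_minus1 mult_1 complex_cnj_one complex_cnj_minus)+
qed

lemma norm_sq: "(norm x)\<^sup>2 = Re (cip x x)"
  by (simp add: norm_h2_def cip_self_nonneg)

lemma cip_self_norm: "cip x x = of_real ((norm x)\<^sup>2)"
  unfolding norm_sq by (rule cip_self)

lemma norm_sq_sums: "(\<lambda>n. (cmod (coef x n))\<^sup>2) sums (norm x)\<^sup>2"
  unfolding norm_sq by (rule cip_self_sums)

lemma norm_le_iff_partial_sums: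
  assumes "0 \<le> K"
  shows "norm x \<le> K \<longleftrightarrow> (\<forall>N. (\<Sum>n<N. (cmod (coef x n))\<^sup>2) \<le> K\<^sup>2)"
proof -
  have "(norm x)\<^sup>2 \<le> K\<^sup>2 \<longleftrightarrow> (\<forall>N. (\<Sum>n<N. (cmod (coef x n))\<^sup>2) \<le> K\<^sup>2)"
  proof
    assume *: "(norm x)\<^sup>2 \<le> K\<^sup>2"
    show "\<forall>N. (\<Sum>n<N. (cmod (coef x n))\<^sup>2) \<le> K\<^sup>2"
    proof
      fix N
      have "(\<Sum>n<N. (cmod (coef x n))\<^sup>2) \<le> (\<Sum>n. (cmod (coef x n))\<^sup>2)"
        by (intro sum_le_suminf summable_coef) auto
      with * show "(\<Sum>n<N. (cmod (coef x n))\<^sup>2) \<le> K\<^sup>2" by (simp add: sums_unique[OF norm_sq_sums[of x]])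
    qed
  next
    assume "\<forall>N. (\<Sum>n<N. (cmod (coef x n))\<^sup>2) \<le> K\<^sup>2"
    then show "(norm x)\<^sup>2 \<le> K\<^sup>2"
      using suminf_le_const[OF summable_coef[of x]] sums_unique[OF norm_sq_sums[of x]] by metis
  qed
  then show ?thesis using assms by (simp add: power2_le_iff_abs_le)
qed

lemma coef_le_norm: "cmod (coef x n) \<le> norm x"
proof -
  have "(\<Sum>n<Suc n. (cmod (coef x n))\<^sup>2) \<le> (norm x)\<^sup>2"
    using norm_le_iff_partial_sums[of "norm x" x] by (metis norm_ge_zero order_refl)
  moreover have "0 \<le> (\<Sum>n<n. (cmod (coef x n))\<^sup>2)" by (intro sum_nonneg) auto
  ultimately have "(cmod (coef x n))\<^sup>2 \<le> (norm x)\<^sup>2" unfolding sum.lessThan_Suc by linarith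
  then show ?thesis by (rule power2_le_imp_le) simp
qed

text \<open>Completeness: coefficients converge, and the norm is determined by finite partial sums.\<close>

instance h2 :: banach
proof
  fix X :: "nat \<Rightarrow> h2" assume X: "Cauchy X"
  have "Cauchy (\<lambda>k. coef (X k) n)" for n
  proof (rule metric_CauchyI)
    fix e :: real assume "e > 0"
    then obtain M where M: "\<And>i j. i \<ge> M \<Longrightarrow> j \<ge> M \<Longrightarrow> dist (X i) (X j) < e"
      using X by (metis Cauchy_def)
    have "dist (coef (X i) n) (coef (X j) n) < e" if "i \<ge> M" "j \<ge> M" for i j
      using coef_le_norm[of "X i - X j" n] M[OF that] by (simp add: dist_norm coef_diff)
    then show "\<exists>M. \<forall>i\<ge>M. \<forall>j\<ge>M. dist (coef (X i) n) (coef (X j) n) < e" by blast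
  qed
  then have "convergent (\<lambda>k. coef (X k) n)" for n by (rule Cauchy_convergent)
  then obtain a where a: "\<And>n. (\<lambda>k. coef (X k) n) \<longlonglongrightarrow> a n" unfolding convergent_def by metis
  obtain B where B: "\<And>k. norm (X k) \<le> B" using Cauchy_Bseq[OF X] by (auto simp: Bseq_def)
  have "B \<ge> 0" using B[of 0] norm_ge_zero order_trans by blast
  have "(\<Sum>n<N. (cmod (a n))\<^sup>2) \<le> B\<^sup>2" for N
  proof (rule LIMSEQ_le_const2)
    show "(\<lambda>k. \<Sum>n<N. (cmod (coef (X k) n))\<^sup>2) \<longlonglongrightarrow> (\<Sum>n<N. (cmod (a n))\<^sup>2)"
      by (intro tendsto_intros a)
    show "\<exists>M. \<forall>k\<ge>M. (\<Sum>n<N. (cmod (coef (X k) n))\<^sup>2) \<le> B\<^sup>2"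
      using norm_le_iff_partial_sums[OF \<open>B \<ge> 0\<close>] B by blast
  qed
  then have "summable (\<lambda>n. (cmod (a n))\<^sup>2)" by (intro summableI_nonneg_bounded) auto
  then obtain x where x: "\<And>n. coef x n = a n" using h2_of_coefs by blast
  have "X \<longlonglongrightarrow> x"
  proof (rule LIMSEQ_I)
    fix e :: real assume "e > 0"
    then obtain M where M: "\<And>i j. i \<ge> M \<Longrightarrow> j \<ge> M \<Longrightarrow> dist (X i) (X j) < e / 2"
      using X by (metis Cauchy_def half_gt_zero)
    have "norm (X i - x) < e" if i: "i \<ge> M" for i
    proof -
      have "(\<Sum>n<N. (cmod (coef (X i - x) n))\<^sup>2) \<le> (e / 2)\<^sup>2" for N
      proof (rule LIMSEQ_le_const2)
        show "(\<lambda>k. \<Sum>n<N. (cmod (coef (X i - X k) n))\<^sup>2) \<longlonglongrightarrow> (\<Sum>n<N. (cmod (coef (X i - x) n))\<^sup>2)"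
          unfolding coef_diff x by (intro tendsto_intros a)
        have "norm (X i - X k) \<le> e / 2" if "k \<ge> M" for k
          using M[OF i that] by (simp add: dist_norm)
        then show "\<exists>M. \<forall>k\<ge>M. (\<Sum>n<N. (cmod (coef (X i - X k) n))\<^sup>2) \<le> (e / 2)\<^sup>2"
          using norm_le_iff_partial_sums[of "e / 2"] \<open>e > 0\<close> by (metis half_gt_zero less_imp_le)
      qed
      then have "norm (X i - x) \<le> e / 2" using norm_le_iff_partial_sums[of "e / 2"] \<open>e > 0\<close> by auto
      then show ?thesis using \<open>e > 0\<close> by simp
    qed
    then show "\<exists>M. \<forall>i\<ge>M. norm (X i - x) < e" by blast
  qed
  then show "convergent X" by (auto simp: convergent_def)
qed

text \<open>
  Multiplying \<open>x\<close> by a unimodular constant makes the complex inner product real, which reduces the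
  claim to the Cauchy-Schwarz inequality of the real inner product.
\<close>

lemma cip_cauchy_schwarz: "cmod (cip x y) \<le> norm x * norm y"
proof -
  define c where "c = (if cip x y = 0 then 1 else cnj (cip x y) / of_real (cmod (cip x y)))"
  have c: "cmod c = 1" "c * cip x y = of_real (cmod (cip x y))"
    by (auto simp: c_def norm_divide complex_norm_square[symmetric] power2_eq_square mult.commute[of "cnj _"])
  define x' where "x' = lincomb c x 0 x"
  have "c * cnj c = 1" using complex_norm_square[of c] c(1) by simp
  then have "cip x' x' = cip x x"
    unfolding x'_def cip_lincomb_left cip_lincomb_right by (simp add: mult.assoc[symmetric] mult.commute[of "cnj c" c])
  then have "(norm x')\<^sup>2 = (norm x)\<^sup>2" by (simp add: norm_sq)
  then have n: "norm x' = norm x" by (simp add: power2_eq_iff_nonneg)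
  have "cmod (cip x y) = inner x' y"
    using c(2) by (simp add: inner_h2_def x'_def cip_lincomb_left)
  also have "\<dots> \<le> norm x * norm y" using norm_cauchy_schwarz[of x' y] n by simp
  finally show ?thesis .
qed

text \<open>The real part at \<open>\<i> * x\<close> yields the imaginary part at \<open>x\<close>.\<close>

lemma cip_eqI_Re:
  assumes "\<And>c. Re (cip (lincomb c x 0 x) y) = Re (c * d)"
  shows "cip x y = d"
  using assms[of 1] assms[of \<i>] by (simp add: cip_lincomb_left complex_eq_iff)

lemma h2_eqI_cip: "(\<And>w. cip w x = cip w y) \<Longrightarrow> x = y"
  using cip_self_norm[of "x - y"] by (simp add: cip_diff_right cip_diff_left)

subsection \<open>Reproducing kernels\<close>

lemma kern_exists:
  assumes w: "cmod w < 1"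
  shows "\<exists>k. \<forall>n. coef k n = cnj w ^ n"
proof -
  have "(cmod w)\<^sup>2 < 1" using w by (simp add: abs_square_less_1)
  then have "summable (\<lambda>n. ((cmod w)\<^sup>2) ^ n)" by (intro summable_geometric) simp
  moreover have "((cmod w)\<^sup>2) ^ n = (cmod (cnj w ^ n))\<^sup>2" for n
    by (simp add: norm_power power_mult[symmetric] mult.commute)
  ultimately have "summable (\<lambda>n. (cmod (cnj w ^ n))\<^sup>2)" by simp
  from h2_of_coefs[OF this] show ?thesis by metis
qed

definition kern :: "complex \<Rightarrow> h2" where
  "kern w = (SOME k. \<forall>n. coef k n = cnj w ^ n)"

lemma coef_kern: "cmod w < 1 \<Longrightarrow> coef (kern w) n = cnj w ^ n"
  unfolding kern_def by (drule kern_exists) (drule someI_ex, blast)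

lemma cip_kern: "cmod w < 1 \<Longrightarrow> cip x (kern w) = fn x w"
  using cip_sums[of x "kern w"] fn_sums[of w x] by (simp add: coef_kern sums_unique2)

lemma fn_kern:
  assumes "cmod w < 1" "cmod z < 1"
  shows "fn (kern w) z = 1 / (1 - cnj w * z)"
proof -
  have "cmod (cnj w * z) < 1"
    using mult_strict_mono'[OF assms] by (simp add: norm_mult)
  from geometric_sums[OF this] show ?thesis
    using fn_sums[OF assms(2), of "kern w"] assms(1)
    by (simp add: coef_kern power_mult_distrib sums_unique2)
qed

subsection \<open>The inner product as a limit of circle means\<close>

lemma continuous_on_fn:
  assumes "f holomorphic_on ball 0 1" "r < 1"
  shows "continuous_on (sphere 0 r) f"
  using holomorphic_on_imp_continuous_on[OF assms(1)] by (rule continuous_on_subset) (use assms(2) in auto)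

lemma continuous_fn: "r < 1 \<Longrightarrow> continuous_on (sphere 0 r) (fn x)"
  by (rule continuous_on_fn[OF holomorphic_fn])

text \<open>
  This formula is the link between function values and the inner product: by it, identities and
  inequalities that hold pointwise on circles pass to \<open>H2\<close> without boundary functions.
\<close>

lemma cmean_tendsto_cip:
  "((\<lambda>r. cmean r (\<lambda>z. fn x z * cnj (fn y z))) \<longlongrightarrow> cip x y) (at_left 1)"
proof -
  have "((\<lambda>r. \<Sum>n. coef x n * cnj (coef y n) * of_real (r ^ (2 * n))) \<longlongrightarrow> cip x y) (at_left 1)"
    using abel_limit_abs[OF summable_cip[of x y]] sums_unique[OF cip_sums[of x y]] by simp
  moreover have "eventually (\<lambda>r. (\<Sum>n. coef x n * cnj (coef y n) * of_real (r ^ (2 * n)))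
      = cmean r (\<lambda>z. fn x z * cnj (fn y z))) (at_left 1)"
    using eventually_at_left_real[of 0 1]
    by (auto elim!: eventually_mono intro!: sums_unique[symmetric] parseval_circle holomorphic_fn
        simp: coef_def simp del: of_real_power)
  ultimately show ?thesis by (rule Lim_transform_eventually)
qed

lemma parseval_circle_norm:
  assumes "f holomorphic_on ball 0 1" "0 \<le> r" "r < 1"
  shows "(\<lambda>n. (cmod (taylor_coeff f n))\<^sup>2 * r ^ (2 * n)) sums Re (cmean r (\<lambda>z. f z * cnj (f z)))"
  using sums_Re[OF parseval_circle[OF assms(1,1,2,3)]]
  unfolding complex_norm_square[symmetric] of_real_mult[symmetric] Re_complex_of_real .

subsection \<open>Multiplication operators\<close>

text \<open>
  On every circle the mean of \<open>cmod (b * x)^2\<close> is at most \<open>C^2\<close> times the mean of \<open>cmod x^2\<close>; by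
  Parseval's identity this bounds the partial sums of the squared coefficients of \<open>b * x\<close>.
\<close>

lemma mult_op_H2:
  assumes b: "b holomorphic_on ball 0 1" and C: "\<And>z. cmod z < 1 \<Longrightarrow> cmod (b z) \<le> C"
  shows "mult_op b (fn x) \<in> H2"
proof -
  let ?f = "\<lambda>z. b z * fn x z"
  define K where "K = C\<^sup>2"
  have hol: "?f holomorphic_on ball 0 1" by (intro holomorphic_intros b holomorphic_fn)
  have mean: "(\<Sum>n<N. (cmod (taylor_coeff ?f n))\<^sup>2 * r ^ (2 * n)) \<le> K * (norm x)\<^sup>2" if r: "0 \<le> r" "r < 1" for r N
  proof -
    have "(\<Sum>n<N. (cmod (taylor_coeff ?f n))\<^sup>2 * r ^ (2 * n)) \<le> Re (cmean r (\<lambda>z. ?f z * cnj (?f z)))"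
      using parseval_circle_norm[OF hol r] r
      by (intro sum_le_suminf[THEN order_trans]) (auto simp: sums_iff)
    also have "\<dots> \<le> Re (cmean r (\<lambda>z. of_real K * (fn x z * cnj (fn x z)) + 0 * (fn x z * cnj (fn x z))))"
    proof (rule cmean_mono)
      fix z :: complex assume z: "cmod z = r"
      have "(cmod (b z))\<^sup>2 * (cmod (fn x z))\<^sup>2 \<le> K * (cmod (fn x z))\<^sup>2"
        using C[of z] z r unfolding K_def by (intro mult_right_mono power_mono) auto
      then show "Re (?f z * cnj (?f z)) \<le> Re (of_real K * (fn x z * cnj (fn x z)) + 0 * (fn x z * cnj (fn x z)))"
        unfolding complex_norm_square[symmetric] of_real_mult[symmetric]
        by (simp add: norm_mult power_mult_distrib del: of_real_power)
    qed (use r in \<open>auto intro!: continuous_intros continuous_fn continuous_on_fn[OF b]\<close>)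
    also have "\<dots> = K * Re (cmean r (\<lambda>z. fn x z * cnj (fn x z)))"
      using r by (subst cmean_lincomb) (auto intro!: continuous_intros continuous_fn)
    also have "\<dots> \<le> K * (norm x)\<^sup>2"
    proof -
      have "(\<lambda>n. (cmod (coef x n))\<^sup>2 * r ^ (2 * n)) sums Re (cmean r (\<lambda>z. fn x z * cnj (fn x z)))"
        using parseval_circle_norm[OF holomorphic_fn r] by (simp add: coef_def)
      then have "Re (cmean r (\<lambda>z. fn x z * cnj (fn x z))) \<le> (norm x)\<^sup>2"
        by (rule sums_le[OF _ _ norm_sq_sums, rotated]) (use r in \<open>auto intro!: mult_left_le power_le_one\<close>)
      then show ?thesis unfolding K_def by (intro mult_left_mono) auto
    qed
    finally show ?thesis .
  qed
  have "(\<Sum>n<N. (cmod (taylor_coeff ?f n))\<^sup>2) \<le> K * (norm x)\<^sup>2" for N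
  proof -
    have "((\<lambda>r. \<Sum>n<N. (cmod (taylor_coeff ?f n))\<^sup>2 * r ^ (2 * n)) \<longlongrightarrow> (\<Sum>n<N. (cmod (taylor_coeff ?f n))\<^sup>2 * 1 ^ (2 * n))) (at_left (1::real))"
      by (intro tendsto_intros)
    moreover have "eventually (\<lambda>r. (\<Sum>n<N. (cmod (taylor_coeff ?f n))\<^sup>2 * r ^ (2 * n)) \<le> K * (norm x)\<^sup>2) (at_left (1::real))"
      using eventually_at_left_real[of 0 1] by (auto elim!: eventually_mono intro: mean)
    ultimately show ?thesis using tendsto_upperbound[OF _ _ trivial_limit_at_left_real] by (simp only: power_one mult_1_right)
  qed
  then have "summable (\<lambda>n. (cmod (taylor_coeff ?f n))\<^sup>2)" by (intro summableI_nonneg_bounded) auto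
  then show ?thesis using hol by (auto simp: H2_def mult_op_def fn_outside)
qed

definition mul :: "cfun \<Rightarrow> h2 \<Rightarrow> h2" where "mul b x = mk (mult_op b (fn x))"

definition bdd_hol :: "cfun \<Rightarrow> bool" where
  "bdd_hol b \<longleftrightarrow> b holomorphic_on ball 0 1 \<and> bounded (b ` ball 0 1)"

lemma fn_mul: "bdd_hol b \<Longrightarrow> fn (mul b x) = mult_op b (fn x)"
proof -
  assume b: "bdd_hol b"
  then obtain C where "\<And>z. cmod z < 1 \<Longrightarrow> cmod (b z) \<le> C" by (force simp: bdd_hol_def bounded_iff)
  then have "mult_op b (fn x) \<in> H2" using b by (intro mult_op_H2) (auto simp: bdd_hol_def)
  then show ?thesis by (simp add: mul_def mk_inverse)
qed

lemma fn_mul_apply: "bdd_hol b \<Longrightarrow> fn (mul b x) z = b z * fn x z"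
  by (simp add: fn_mul mult_op_def)

text \<open>Pointwise inequalities between moduli integrate to inequalities between norms.\<close>

lemma norm_sum_squares_le:
  assumes "\<And>z. cmod z < 1 \<Longrightarrow> (cmod (fn x z))\<^sup>2 + (cmod (fn y z))\<^sup>2 \<le> (cmod (fn w z))\<^sup>2"
  shows "(norm x)\<^sup>2 + (norm y)\<^sup>2 \<le> (norm w)\<^sup>2"
proof -
  let ?m = "\<lambda>x r. Re (cmean r (\<lambda>z. fn x z * cnj (fn x z)))"
  have lim: "((\<lambda>r. ?m x r) \<longlongrightarrow> (norm x)\<^sup>2) (at_left 1)" for x
    unfolding norm_sq by (intro tendsto_Re cmean_tendsto_cip)
  have "?m x r + ?m y r \<le> ?m w r" if r: "0 < r" "r < 1" for r
  proof -
    have "Re (cmean r (\<lambda>z. 1 * (fn x z * cnj (fn x z)) + 1 * (fn y z * cnj (fn y z)))) \<le> ?m w r"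
    proof (rule cmean_mono)
      fix z :: complex assume "cmod z = r"
      with assms[of z] r show "Re (1 * (fn x z * cnj (fn x z)) + 1 * (fn y z * cnj (fn y z))) \<le> Re (fn w z * cnj (fn w z))"
        by (simp add: complex_mult_cnj cmod_power2)
    qed (use r in \<open>auto intro!: continuous_intros continuous_fn\<close>)
    then show ?thesis
      using r by (subst (asm) cmean_lincomb) (auto intro!: continuous_intros continuous_fn)
  qed
  then have "eventually (\<lambda>r. ?m x r + ?m y r \<le> ?m w r) (at_left 1)"
    using eventually_at_left_real[of 0 1] by (auto elim!: eventually_mono)
  then show ?thesis
    by (rule tendsto_le[OF trivial_limit_at_left_real lim tendsto_add[OF lim lim]])
qed

lemma norm_le_of_cmod_le:
  assumes "\<And>z. cmod z < 1 \<Longrightarrow> cmod (fn x z) \<le> C * cmod (fn y z)" and "0 \<le> C"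
  shows "norm x \<le> C * norm y"
proof -
  have "(norm x)\<^sup>2 + (norm (0::h2))\<^sup>2 \<le> (norm (C *\<^sub>R y))\<^sup>2"
  proof (rule norm_sum_squares_le)
    fix z :: complex assume "cmod z < 1"
    from power_mono[OF assms(1)[OF this], of 2] \<open>0 \<le> C\<close>
    show "(cmod (fn x z))\<^sup>2 + (cmod (fn 0 z))\<^sup>2 \<le> (cmod (fn (C *\<^sub>R y) z))\<^sup>2"
      by (simp add: fn_simps norm_mult)
  qed
  then show ?thesis using \<open>0 \<le> C\<close> by (simp add: power2_le_iff_abs_le)
qed

text \<open>
  Multiplication operators are hyponormal: \<open>cip (b * y) x\<close> is bounded through the pairing of \<open>y\<close>
  with the antianalytic multiple \<open>cnj b * x\<close>, which has on each circle the same modulus as \<open>b * x\<close>.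
\<close>

lemma cip_mul_le:
  assumes b: "bdd_hol b"
  shows "2 * Re (cip (mul b y) x) \<le> (norm (mul b x))\<^sup>2 + (norm y)\<^sup>2"
proof -
  let ?m = "\<lambda>x y r. Re (cmean r (\<lambda>z. fn x z * cnj (fn y z)))"
  have lim: "((\<lambda>r. ?m x y r) \<longlongrightarrow> Re (cip x y)) (at_left 1)" for x y
    by (intro tendsto_Re cmean_tendsto_cip)
  have le: "2 * ?m (mul b y) x r \<le> ?m (mul b x) (mul b x) r + ?m y y r" if r: "0 < r" "r < 1" for r
  proof -
    note cont = continuous_intros continuous_fn
    have "Re (cmean r (\<lambda>z. 2 * (fn (mul b y) z * cnj (fn x z)) + 0 * (fn (mul b y) z * cnj (fn x z))))
        \<le> Re (cmean r (\<lambda>z. 1 * (fn (mul b x) z * cnj (fn (mul b x) z)) + 1 * (fn y z * cnj (fn y z))))"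
    proof (rule cmean_mono)
      fix z :: complex assume "cmod z = r"
      have "2 * Re (b z * fn y z * cnj (fn x z)) \<le> 2 * cmod (b z * fn y z * cnj (fn x z))"
        using complex_Re_le_cmod[of "b z * fn y z * cnj (fn x z)"] by linarith
      also have "\<dots> = 2 * cmod (b z * fn x z) * cmod (fn y z)" by (simp add: norm_mult)
      also have "\<dots> \<le> (cmod (b z * fn x z))\<^sup>2 + (cmod (fn y z))\<^sup>2" by (rule sum_squares_bound)
      finally show "Re (2 * (fn (mul b y) z * cnj (fn x z)) + 0 * (fn (mul b y) z * cnj (fn x z)))
          \<le> Re (1 * (fn (mul b x) z * cnj (fn (mul b x) z)) + 1 * (fn y z * cnj (fn y z)))"
        unfolding fn_mul_apply[OF b] complex_norm_square[symmetric] by (simp del: of_real_power)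
    qed (use r in \<open>auto intro!: cont\<close>)
    then show ?thesis
      using r by (subst (asm) (1 2) cmean_lincomb) (auto intro!: cont)
  qed
  then have "eventually (\<lambda>r. 2 * ?m (mul b y) x r \<le> ?m (mul b x) (mul b x) r + ?m y y r) (at_left 1)"
    using eventually_at_left_real[of 0 1] by (auto elim!: eventually_mono)
  then show ?thesis unfolding norm_sq
    by (rule tendsto_le[OF trivial_limit_at_left_real tendsto_add[OF lim lim] tendsto_mult_left[OF lim]])
qed

subsection \<open>Complex linear operators\<close>

lemma le_if_double_square_le:
  fixes a b :: real
  assumes "2 * a\<^sup>2 \<le> b\<^sup>2 + a\<^sup>2" "0 \<le> b"
  shows "a \<le> b"
proof -
  have "a\<^sup>2 \<le> b\<^sup>2" using assms(1) by linarith
  then show ?thesis using assms(2) by (rule power2_le_imp_le)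
qed

definition clinear_h2 :: "(h2 \<Rightarrow> h2) \<Rightarrow> bool" where
  "clinear_h2 T \<longleftrightarrow> (\<forall>c x d y. T (lincomb c x d y) = lincomb c (T x) d (T y))"

lemma clinear_h2D: "clinear_h2 T \<Longrightarrow> T (lincomb c x d y) = lincomb c (T x) d (T y)"
  by (simp add: clinear_h2_def)

lemma lincomb_scaleR: "lincomb (of_real r) x 0 x = r *\<^sub>R x"
  by (simp add: scaleR_h2_def)

lemma clinear_h2_simps:
  assumes "clinear_h2 T"
  shows "T (x + y) = T x + T y" "T (x - y) = T x - T y" "T (r *\<^sub>R x) = r *\<^sub>R T x" "T 0 = 0"
proof -
  show "T (x + y) = T x + T y" "T (x - y) = T x - T y" "T (r *\<^sub>R x) = r *\<^sub>R T x"
    using clinear_h2D[OF assms] by (simp_all add: plus_h2_def minus_h2_def scaleR_h2_def)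
  have "T (0 - 0) = T 0 - T 0" using clinear_h2D[OF assms] by (simp only: minus_h2_def)
  then show "T 0 = 0" by simp
qed

lemma clinear_h2_bounded_linear:
  assumes "clinear_h2 T" "\<And>x. norm (T x) \<le> C * norm x"
  shows "bounded_linear T"
proof (rule bounded_linear_intro[where K = C])
  show "norm (T x) \<le> norm x * C" for x using assms(2)[of x] by (subst mult.commute)
qed (rule clinear_h2_simps[OF assms(1)])+

lemma clinear_mul: "bdd_hol b \<Longrightarrow> clinear_h2 (mul b)"
  unfolding clinear_h2_def
  by (intro allI h2_eqI) (simp add: fn_mul_apply lincomb.rep_eq distrib_left mult.left_commute)

lemma mul_mul: "bdd_hol b \<Longrightarrow> bdd_hol c \<Longrightarrow> mul b (mul c x) = mul c (mul b x)"
  by (rule h2_eqI) (simp add: fn_mul_apply mult_ac)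

lemma norm_mul_le:
  assumes "bdd_hol b" "\<And>z. cmod z < 1 \<Longrightarrow> cmod (b z) \<le> C" "0 \<le> C"
  shows "norm (mul b x) \<le> C * norm x"
  using assms by (intro norm_le_of_cmod_le) (auto simp: fn_mul_apply norm_mult intro: mult_right_mono)

lemma norm_mul_bounded: "bdd_hol b \<Longrightarrow> \<exists>C. \<forall>x. norm (mul b x) \<le> C * norm x"
proof -
  assume b: "bdd_hol b"
  then obtain C where C: "\<And>z. cmod z < 1 \<Longrightarrow> cmod (b z) \<le> C" by (force simp: bdd_hol_def bounded_iff)
  moreover have "0 \<le> C" using C[of 0] norm_ge_zero[of "b 0"] by (simp del: norm_ge_zero)
  ultimately show ?thesis using norm_mul_le[OF b] by blast
qed

subsection \<open>Adjoints\<close>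

text \<open>
  The real part of \<open>x \<mapsto> cip (T x) g\<close> has a Riesz representative, and by complex linearity the real
  part determines the functional.
\<close>

lemma adjoint_exists:
  assumes T: "clinear_h2 T" and C: "\<And>x. norm (T x) \<le> C * norm x"
  shows "\<exists>u. \<forall>x. cip (T x) g = cip x u"
proof -
  have le: "\<bar>Re (cip (T x) g)\<bar> \<le> C * norm g * norm x" for x
  proof -
    have "\<bar>Re (cip (T x) g)\<bar> \<le> norm (T x) * norm g"
      by (rule order_trans[OF abs_Re_le_cmod cip_cauchy_schwarz])
    also have "\<dots> \<le> C * norm x * norm g" by (intro mult_right_mono C) auto
    finally show ?thesis by (simp add: mult_ac)
  qed
  have "\<exists>u\<in>closure UNIV. \<forall>x\<in>UNIV. Re (cip (T x) g) = inner x u"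
  proof (rule riesz_on_subspace)
    show "Re (cip (T (x + y)) g) = Re (cip (T x) g) + Re (cip (T y) g)" for x y
      by (simp add: clinear_h2_simps[OF T] cip_add_left)
    show "Re (cip (T (c *\<^sub>R x)) g) = c * Re (cip (T x) g)" for c x
      by (simp add: clinear_h2_simps[OF T] inner_h2_def[symmetric])
  qed (use le in auto)
  then obtain u where u: "\<And>x. Re (cip (T x) g) = inner x u" by blast
  have "cip (T x) g = cip x u" for x
  proof (rule cip_eqI_Re)
    show "Re (cip (lincomb c (T x) 0 (T x)) g) = Re (c * cip x u)" for c
      using u[of "lincomb c x 0 x"] by (simp add: clinear_h2D[OF T] inner_h2_def cip_lincomb_left)
  qed
  then show ?thesis by blast
qed

definition adj :: "cfun \<Rightarrow> h2 \<Rightarrow> h2" where "adj b x = mk (H2_adjoint (mult_op b) (fn x))"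

lemma H2_obtain: assumes "f \<in> H2" obtains x where "f = fn x"
  using mk_inverse[OF assms] by metis

lemma H2_adjoint_mult:
  assumes b: "bdd_hol b"
  shows fn_adj: "fn (adj b g) = H2_adjoint (mult_op b) (fn g)"
    and cip_adj: "cip (mul b x) g = cip x (adj b g)"
proof -
  obtain C where "\<And>x. norm (mul b x) \<le> C * norm x" using norm_mul_bounded[OF b] by blast
  then obtain u where u: "\<And>x. cip (mul b x) g = cip x u"
    using adjoint_exists[OF clinear_mul[OF b]] by blast
  have "H2_adjoint (mult_op b) (fn g) = fn u"
    unfolding H2_adjoint_def
  proof (rule the_equality)
    show "fn u \<in> H2 \<and> (\<forall>f\<in>H2. H2_inner (mult_op b f) (fn g) = H2_inner f (fn u))"
    proof (intro conjI ballI fn)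
      fix f assume "f \<in> H2"
      then obtain x where "f = fn x" by (rule H2_obtain)
      then show "H2_inner (mult_op b f) (fn g) = H2_inner f (fn u)"
        using u[of x] by (simp add: cip_def fn_mul[OF b])
    qed
  next
    fix h assume h: "h \<in> H2 \<and> (\<forall>f\<in>H2. H2_inner (mult_op b f) (fn g) = H2_inner f h)"
    then obtain y where y: "h = fn y" by (auto elim: H2_obtain)
    have "cip x y = cip x u" for x
      using h fn[of x] u[of x] by (simp add: y cip_def fn_mul[OF b])
    then show "h = fn u" using y h2_eqI_cip by metis
  qed
  then have "adj b g = u" by (simp add: adj_def fn_inverse)
  then show "fn (adj b g) = H2_adjoint (mult_op b) (fn g)" "cip (mul b x) g = cip x (adj b g)"
    using \<open>H2_adjoint (mult_op b) (fn g) = fn u\<close> u by auto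
qed

lemma clinear_adj: "bdd_hol b \<Longrightarrow> clinear_h2 (adj b)"
  unfolding clinear_h2_def by (auto intro!: h2_eqI_cip simp: cip_adj[symmetric] cip_lincomb_right)

lemma norm_adj_le: 
  assumes b: "bdd_hol b"
  shows "norm (adj b x) \<le> norm (mul b x)"
proof (rule le_if_double_square_le)
  show "2 * (norm (adj b x))\<^sup>2 \<le> (norm (mul b x))\<^sup>2 + (norm (adj b x))\<^sup>2"
    using cip_mul_le[OF b, of "adj b x" x] by (simp add: cip_adj[OF b] norm_sq)
qed simp

text \<open>Pairing with \<open>kern w\<close> evaluates at \<open>w\<close>, where \<open>b * x\<close> has the value \<open>b w * x w\<close>.\<close>

lemma adj_kern:
  assumes b: "bdd_hol b" and w: "cmod w < 1"
  shows "adj b (kern w) = lincomb (cnj (b w)) (kern w) 0 (kern w)"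
  by (rule h2_eqI_cip)
    (simp add: cip_adj[OF b, symmetric] cip_kern[OF w] cip_lincomb_right fn_mul_apply[OF b])

section \<open>The Hilbert space structure of de Branges-Rovnyak spaces\<close>

locale schur_function =
  fixes b :: cfun
  assumes unit_ball: "b \<in> Hinf_unit_ball"
begin

lemma bdd_hol: "bdd_hol b"
  using unit_ball by (simp add: Hinf_unit_ball_def Hinf_def bdd_hol_def)

lemma cmod_le_1: "cmod z < 1 \<Longrightarrow> cmod (b z) \<le> 1"
proof -
  assume z: "cmod z < 1"
  have "bdd_above ((\<lambda>z. cmod (b z)) ` ball 0 1)"
    using bdd_hol by (auto simp: bdd_hol_def bounded_iff bdd_above_def)
  then have "cmod (b z) \<le> Hinf_norm b"
    unfolding Hinf_norm_def using z by (intro cSUP_upper) auto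
  also have "\<dots> \<le> 1" using unit_ball by (simp add: Hinf_unit_ball_def)
  finally show ?thesis .
qed

definition defect :: "h2 \<Rightarrow> h2" where "defect x = x - mul b (adj b x)"

lemma norm_adj_le_norm: "norm (adj b x) \<le> norm x"
  using norm_adj_le[OF bdd_hol, of x] norm_mul_le[OF bdd_hol, of 1 x] cmod_le_1 by auto

text \<open>
  A witness for the choice in \<open>H2_sqrt\<close>. The root commutes with multiplication by the imaginary unit
  because \<open>T T*\<close> does; that makes it complex linear, and its quadratic form real.
\<close>

lemma defect_sqrt_exists:
  "\<exists>S. clinear_h2 S \<and> (\<forall>x. S (S x) = defect x) \<and> (\<forall>x. cip (S x) x \<in> \<real>\<^sub>\<ge>\<^sub>0) \<and>
       (\<exists>C. \<forall>x. norm (S x) \<le> C * norm x)"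
proof -
  let ?T = "\<lambda>x. mul b (adj b x)"
  have Tlin: "clinear_h2 ?T"
    using clinear_mul[OF bdd_hol] clinear_adj[OF bdd_hol] by (simp add: clinear_h2_def)
  have Tcontr: "norm (?T x) \<le> norm x" for x
    using norm_mul_le[OF bdd_hol, of 1 "adj b x"] norm_adj_le_norm[of x] cmod_le_1 by auto
  have Tsym: "cip (?T x) y = cip x (?T y)" for x y
    by (metis cip_adj[OF bdd_hol] cnj_cip)
  obtain S where S: "bounded_linear S" "\<And>x. S (S x) = x - ?T x" "\<And>x y. inner (S x) y = inner x (S y)"
      "\<And>x. inner (S x) x \<ge> 0"
      "\<And>J x. bounded_linear J \<Longrightarrow> (\<And>x. J (?T x) = ?T (J x)) \<Longrightarrow> J (S x) = S (J x)"
  proof (rule contraction_complement_sqrt[of ?T])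
    show "bounded_linear ?T" by (rule clinear_h2_bounded_linear[OF Tlin, of 1]) (simp add: Tcontr)
    show "inner (?T x) y = inner x (?T y)" for x y using Tsym by (simp add: inner_h2_def)
  qed (use Tcontr in auto)
  let ?J = "\<lambda>x. lincomb \<i> x 0 x"
  have J: "?J (S x) = S (?J x)" for x
  proof (rule S(5))
    show "bounded_linear ?J"
    proof (rule bounded_linear_intro[where K = 1])
      show "norm (?J x) \<le> norm x * 1" for x
        using norm_le_of_cmod_le[of "?J x" 1 x] by (simp add: fn_simps norm_mult)
      show "?J (x + y) = ?J x + ?J y" for x y by (rule h2_eqI) (simp add: fn_simps distrib_left)
      show "?J (r *\<^sub>R x) = r *\<^sub>R ?J x" for r x by (rule h2_eqI) (simp add: fn_simps)
    qed
    show "?J (?T x) = ?T (?J x)" for x using clinear_h2D[OF Tlin, of \<i> x 0 x] by simp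
  qed
  note Slin = bounded_linear.linear[OF S(1)]
  have lin: "clinear_h2 S"
  proof -
    have dec: "lincomb c x d y = (Re c *\<^sub>R x + Im c *\<^sub>R ?J x) + (Re d *\<^sub>R y + Im d *\<^sub>R ?J y)" for c x d y
    proof (rule h2_eqI)
      fix z
      have "c * u = of_real (Re c) * u + of_real (Im c) * (\<i> * u)" for c u
        by (simp add: complex_eq_iff)
      from this[of c "fn x z"] this[of d "fn y z"]
      show "fn (lincomb c x d y) z = fn ((Re c *\<^sub>R x + Im c *\<^sub>R ?J x) + (Re d *\<^sub>R y + Im d *\<^sub>R ?J y)) z"
        by (simp add: fn_simps)
    qed
    show ?thesis
      unfolding clinear_h2_def
      by (intro allI, subst (1 2) dec) (simp add: linear_add[OF Slin] linear_scale[OF Slin] J)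
  qed
  have real: "cip (S x) x \<in> \<real>\<^sub>\<ge>\<^sub>0" for x
  proof -
    have "inner (S x) (?J x) = inner (?J x) (S x)" by (rule inner_commute)
    also have "inner (?J x) (S x) = inner (?J (S x)) x" using S(3)[of "?J x" x] J[of x] by simp
    finally have "Im (cip (S x) x) = 0"
      by (simp add: inner_h2_def cip_lincomb_left cip_lincomb_right)
    then show ?thesis using S(4)[of x] by (simp add: inner_h2_def complex_nonneg_Reals_iff)
  qed
  obtain C where "\<And>x. norm (S x) \<le> norm x * C" using bounded_linear.bounded[OF S(1)] by blast
  then have "norm (S x) \<le> C * norm x" for x by (subst mult.commute)
  then have "\<exists>C. \<forall>x. norm (S x) \<le> C * norm x" by blast
  moreover have "\<forall>x. S (S x) = defect x" using S(2) by (simp add: defect_def)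
  moreover have "\<forall>x. cip (S x) x \<in> \<real>\<^sub>\<ge>\<^sub>0" using real by blast
  ultimately show ?thesis using lin by (intro exI[of _ S] conjI)
qed

lemma H2_norm_fn: "H2_norm (fn x) = norm x"
  by (simp add: H2_norm_def norm_h2_def cip_def)

lemma fn_defect: "fn (defect x) = (\<lambda>z. fn x z - mult_op b (H2_adjoint (mult_op b) (fn x)) z)"
  by (rule ext) (simp add: defect_def fn_simps fn_mul[OF bdd_hol] fn_adj[OF bdd_hol])

text \<open>The properties of the chosen root on which everything below is based.\<close>

lemma dBR_root_spec:
  "H2_positive (dBR_root b)" "\<And>x. dBR_root b (dBR_root b (fn x)) = fn (defect x)"
proof -
  let ?P = "\<lambda>R. H2_positive R \<and> (\<forall>f\<in>H2. R (R f) = (\<lambda>z. f z - mult_op b (H2_adjoint (mult_op b) f) z))"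
  obtain S where S: "clinear_h2 S" "\<And>x. S (S x) = defect x" "\<And>x. cip (S x) x \<in> \<real>\<^sub>\<ge>\<^sub>0"
    and "\<exists>C. \<forall>x. norm (S x) \<le> C * norm x"
    using defect_sqrt_exists by auto
  then obtain C where C: "\<And>x. norm (S x) \<le> C * norm x" by blast
  define R where "R f = fn (S (mk f))" for f
  have R: "R (fn x) = fn (S x)" for x by (simp add: R_def fn_inverse)
  have "?P R"
  proof (intro conjI ballI)
    show "H2_positive R"
      unfolding H2_positive_def H2_bounded_operator_def linear_map_on_def
    proof (intro conjI ballI allI exI[of _ C])
      show "R ` H2 \<subseteq> H2" by (auto simp: R_def fn)
      show "R (\<lambda>z. c * f z + d * g z) = (\<lambda>z. c * R f z + d * R g z)" if fg: "f \<in> H2" "g \<in> H2" for f g c d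
      proof -
        obtain x y where xy: "f = fn x" "g = fn y" using fg by (meson H2_obtain)
        show ?thesis using R[of "lincomb c x d y"] unfolding clinear_h2D[OF S(1)]
          by (simp add: xy R lincomb.rep_eq)
      qed
      show "H2_norm (R f) \<le> C * H2_norm f" if f: "f \<in> H2" for f
        by (rule H2_obtain[OF f]) (simp add: R H2_norm_fn C)
      show "H2_inner (R f) f \<in> \<real>\<^sub>\<ge>\<^sub>0" if f: "f \<in> H2" for f
        by (rule H2_obtain[OF f]) (use S(3) in \<open>simp add: R cip_def\<close>)
    qed
    show "R (R f) = (\<lambda>z. f z - mult_op b (H2_adjoint (mult_op b) f) z)" if "f \<in> H2" for f
      by (rule H2_obtain[OF that]) (simp add: R S(2) fn_defect)
  qed
  then have *: "?P (dBR_root b)"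
    unfolding dBR_root_def H2_sqrt_def by (rule someI[of ?P])
  then show "H2_positive (dBR_root b)" by blast
  show "dBR_root b (dBR_root b (fn x)) = fn (defect x)" for x
    using * fn[of x] by (simp add: fn_defect)
qed

definition root :: "h2 \<Rightarrow> h2" where "root x = mk (dBR_root b (fn x))"

lemma fn_root: "fn (root x) = dBR_root b (fn x)"
proof -
  have "dBR_root b ` H2 \<subseteq> H2"
    using dBR_root_spec(1) unfolding H2_positive_def H2_bounded_operator_def by blast
  then show ?thesis using fn[of x] unfolding root_def by (intro mk_inverse) blast
qed

lemma clinear_root: "clinear_h2 root"
proof -
  have "root (lincomb c x d y) = lincomb c (root x) d (root y)" for c x d y
  proof -
    have "dBR_root b (\<lambda>z. c * fn x z + d * fn y z) = (\<lambda>z. c * dBR_root b (fn x) z + d * dBR_root b (fn y) z)"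
      using dBR_root_spec(1) fn[of x] fn[of y]
      by (simp add: H2_positive_def H2_bounded_operator_def linear_map_on_def)
    then have "fn (root (lincomb c x d y)) = fn (lincomb c (root x) d (root y))"
      by (simp add: fn_root lincomb.rep_eq)
    then show ?thesis by (simp add: fn_inject)
  qed
  then show ?thesis by (simp add: clinear_h2_def)
qed

lemmas root_simps = clinear_h2_simps[OF clinear_root]

lemma bounded_linear_root: "bounded_linear root"
proof -
  have "\<exists>C. \<forall>f\<in>H2. H2_norm (dBR_root b f) \<le> C * H2_norm f"
    using dBR_root_spec(1) unfolding H2_positive_def H2_bounded_operator_def by blast
  then obtain C where C: "\<And>f. f \<in> H2 \<Longrightarrow> H2_norm (dBR_root b f) \<le> C * H2_norm f" by blast
  have "norm (root x) \<le> C * norm x" for x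
    using C[OF fn[of x]] unfolding fn_root[symmetric] H2_norm_fn .
  then show ?thesis by (rule clinear_h2_bounded_linear[OF clinear_root])
qed

lemma root_root: "root (root x) = defect x"
  using dBR_root_spec(2)[of x] by (simp add: fn_root[symmetric] fn_inject)

text \<open>A complex operator with real quadratic form is symmetric, by polarisation.\<close>

lemma root_sym: "cip (root x) y = cip x (root y)"
proof -
  have real: "Im (cip (root x) x) = 0" for x
  proof -
    have "H2_inner (dBR_root b (fn x)) (fn x) \<in> \<real>\<^sub>\<ge>\<^sub>0"
      using dBR_root_spec(1) fn[of x] unfolding H2_positive_def by blast
    then have "cip (root x) x \<in> \<real>\<^sub>\<ge>\<^sub>0" unfolding cip_def fn_root .
    then show ?thesis by (simp add: complex_nonneg_Reals_iff)
  qed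
  have "cip (root x) y = cnj (cip (root y) x)"
    using real[of x] real[of y] real[of "lincomb 1 x 1 y"] real[of "lincomb 1 x \<i> y"]
    unfolding clinear_h2D[OF clinear_root] cip_lincomb_left cip_lincomb_right
    by (simp add: complex_eq_iff)
  then show ?thesis by (simp add: cnj_cip)
qed

lemma norm_root_sq: "(norm (root x))\<^sup>2 = (norm x)\<^sup>2 - (norm (adj b x))\<^sup>2"
proof -
  have "cip (root x) (root x) = cip (defect x) x" unfolding root_root[symmetric] by (rule root_sym[symmetric])
  also have "\<dots> = cip x x - cip (adj b x) (adj b x)"
    by (simp add: defect_def cip_diff_left cip_adj[OF bdd_hol])
  finally show ?thesis by (simp add: norm_sq)
qed

lemma fn_root_in_dBR: "fn (root x) \<in> dBR b"
  by (simp add: dBR_def fn_root fn)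

text \<open>The orthogonal complement of the kernel, on which the root is injective.\<close>

definition coker :: "h2 set" where
  "coker = {y. \<forall>k. root k = 0 \<longrightarrow> cip y k = 0}"

lemma root_in_coker: "root x \<in> coker"
  by (simp add: coker_def root_sym cip_zero_right)

lemma coker_lincomb: "x \<in> coker \<Longrightarrow> y \<in> coker \<Longrightarrow> lincomb c x d y \<in> coker"
  by (simp add: coker_def cip_lincomb_left)

lemma root_inj_on_coker:
  assumes "x \<in> coker" "y \<in> coker" "root x = root y"
  shows "x = y"
proof -
  have "x - y \<in> coker" using coker_lincomb[OF assms(1,2), of 1 "-1"] by (simp add: minus_h2_def)
  moreover have "root (x - y) = 0" using assms(3) by (simp add: root_simps)
  ultimately have "cip (x - y) (x - y) = 0" by (simp add: coker_def)
  then show ?thesis using cip_self_norm[of "x - y"] by simp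
qed

text \<open>
  Subtracting from a preimage its orthogonal projection to the kernel of the root leaves its image
  unchanged.
\<close>

lemma dBR_cases:
  assumes "f \<in> dBR b"
  obtains y where "y \<in> coker" "f = fn (root y)"
proof -
  obtain x where x: "f = fn (root x)"
    using assms by (auto simp: dBR_def fn_root elim!: H2_obtain)
  let ?K = "{k. root k = 0}"
  have sub: "subspace ?K" by (auto simp: subspace_def root_simps)
  have "closed ?K"
    by (intro closed_Collect_eq linear_continuous_on[OF bounded_linear_root] continuous_on_const)
  have "\<exists>u\<in>closure ?K. \<forall>k\<in>?K. inner k x = inner k u"
  proof (rule riesz_on_subspace[OF sub])
    show "\<bar>inner k x\<bar> \<le> norm x * norm k" for k
      using Cauchy_Schwarz_ineq2[of k x] by (simp add: mult.commute)
  qed (auto simp: inner_add_left)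
  then obtain u where u: "u \<in> closure ?K" "\<And>k. k \<in> ?K \<Longrightarrow> inner k x = inner k u" by blast
  have "root u = 0" using u(1) \<open>closed ?K\<close> by simp
  then have "root (x - u) = root x" by (simp add: root_simps)
  moreover have "x - u \<in> coker"
    unfolding coker_def
  proof (intro CollectI allI impI)
    fix k assume k: "root k = 0"
    have "cip k (x - u) = 0"
    proof (rule cip_eqI_Re)
      fix c
      have "root (lincomb c k 0 k) = 0"
        using k by (simp add: clinear_h2D[OF clinear_root]) (rule h2_eqI, simp add: fn_simps)
      then show "Re (cip (lincomb c k 0 k) (x - u)) = Re (c * 0)"
        using u(2)[of "lincomb c k 0 k"] by (simp add: inner_h2_def cip_diff_right)
    qed
    then show "cip (x - u) k = 0" by (metis cnj_cip complex_cnj_zero)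
  qed
  ultimately show ?thesis using that x by metis
qed

lemma dBR_preimage_root:
  assumes y: "y \<in> coker"
  shows "dBR_preimage b (fn (root y)) = fn y"
  unfolding dBR_preimage_def
proof (rule the_equality)
  have ker: "k \<in> dBR_root_ker b \<longleftrightarrow> (\<exists>x. k = fn x \<and> root x = 0)" for k
  proof
    assume k: "k \<in> dBR_root_ker b"
    then obtain x where x: "k = fn x" by (auto simp: dBR_root_ker_def elim: H2_obtain)
    with k have "fn (root x) = (\<lambda>z. 0)" by (simp add: dBR_root_ker_def fn_root)
    then have "root x = 0" by (intro h2_eqI) (simp add: fn_zero)
    with x show "\<exists>x. k = fn x \<and> root x = 0" by blast
  next
    assume "\<exists>x. k = fn x \<and> root x = 0"
    then obtain x where x: "k = fn x" "root x = 0" by blast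
    have "dBR_root b k = (\<lambda>z. 0)"
      unfolding x(1) fn_root[symmetric] x(2) by (simp add: fun_eq_iff fn_zero)
    then show "k \<in> dBR_root_ker b" by (simp add: dBR_root_ker_def x(1) fn)
  qed
  show "fn y \<in> H2 \<and> (\<forall>k\<in>dBR_root_ker b. H2_inner (fn y) k = 0) \<and> dBR_root b (fn y) = fn (root y)"
    using y by (auto simp: fn fn_root ker coker_def cip_def[symmetric])
  fix f assume f: "f \<in> H2 \<and> (\<forall>k\<in>dBR_root_ker b. H2_inner f k = 0) \<and> dBR_root b f = fn (root y)"
  then obtain x where x: "f = fn x" by (auto elim: H2_obtain)
  have "x \<in> coker" using f by (auto simp: coker_def ker x cip_def)
  moreover have "root x = root y" using f by (simp add: x fn_root[symmetric] fn_inject)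
  ultimately show "f = fn y" using root_inj_on_coker[OF _ y] x by metis
qed

lemma dBR_inner_root: "x \<in> coker \<Longrightarrow> y \<in> coker \<Longrightarrow> dBR_inner b (fn (root x)) (fn (root y)) = cip x y"
  by (simp add: dBR_inner_def dBR_preimage_root cip_def)

text \<open>
  A function \<open>g\<close> belongs to the range of the root as soon as it defines a functional that is bounded
  for the seminorm \<open>norm (root h)\<close>: the Riesz representative of \<open>root h \<mapsto> cip h g\<close> is a preimage.
\<close>

lemma dBR_memI:
  assumes C: "\<And>h. cmod (cip h g) \<le> C * norm (root h)"
  shows "fn g \<in> dBR b"
proof -
  define \<phi> where "\<phi> m = Re (cip (SOME h. root h = m) g)" for m
  have \<phi>: "\<phi> (root h) = Re (cip h g)" for h
  proof -
    define h' where "h' = (SOME h'. root h' = root h)"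
    have "root h' = root h" unfolding h'_def by (rule someI) simp
    then have "cmod (cip (h' - h) g) \<le> C * 0" using C[of "h' - h"] by (simp add: root_simps)
    then show ?thesis by (simp add: \<phi>_def h'_def[symmetric] cip_diff_left)
  qed
  have "\<exists>u\<in>closure (range root). \<forall>m\<in>range root. \<phi> m = inner m u"
  proof (rule riesz_on_subspace)
    show "subspace (range root)"
      using linear_subspace_image[OF bounded_linear.linear[OF bounded_linear_root] subspace_UNIV] .
    show "\<phi> (x + y) = \<phi> x + \<phi> y" if "x \<in> range root" "y \<in> range root" for x y
      using that by (auto simp: root_simps(1)[symmetric] \<phi> cip_add_left)
    show "\<phi> (c *\<^sub>R x) = c * \<phi> x" if "x \<in> range root" for x c
      using that by (auto simp: root_simps(3)[symmetric] \<phi> inner_h2_def[symmetric])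
    show "\<bar>\<phi> x\<bar> \<le> C * norm x" if "x \<in> range root" for x
      using that order_trans[OF abs_Re_le_cmod C] by (auto simp: \<phi>)
  qed
  then obtain u where u: "\<And>h. \<phi> (root h) = inner (root h) u" by blast
  have "g = root u"
  proof (rule h2_eqI_cip)
    fix w show "cip w g = cip w (root u)"
    proof (rule cip_eqI_Re)
      fix c
      show "Re (cip (lincomb c w 0 w) g) = Re (c * cip w (root u))"
        using u[of "lincomb c w 0 w"] \<phi>[of "lincomb c w 0 w"]
        by (simp add: inner_h2_def root_sym cip_lincomb_left)
    qed
  qed
  then show ?thesis using fn_root_in_dBR by simp
qed

end

section \<open>Functions analytic on the closed disc\<close>

lemma analytic_cball_bdd_hol:
  assumes "g analytic_on cball 0 1"
  shows "bdd_hol g"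
  unfolding bdd_hol_def
proof
  have hol: "g holomorphic_on cball 0 1" using assms by (rule analytic_imp_holomorphic)
  then show "g holomorphic_on ball 0 1" by (rule holomorphic_on_subset) auto
  have "compact (g ` cball 0 1)"
    using holomorphic_on_imp_continuous_on[OF hol] by (intro compact_continuous_image) auto
  then show "bounded (g ` ball 0 1)"
    using compact_imp_bounded bounded_subset image_mono ball_subset_cball by metis
qed

text \<open>As \<open>kern 0\<close> is the constant 1, \<open>hol g\<close> is the restriction of \<open>g\<close> to the disc.\<close>

definition hol :: "cfun \<Rightarrow> h2" where "hol g = mul g (kern 0)"

lemma fn_hol: "bdd_hol g \<Longrightarrow> cmod z < 1 \<Longrightarrow> fn (hol g) z = g z"
  by (simp add: hol_def fn_mul_apply fn_kern)

abbreviation zmul :: "h2 \<Rightarrow> h2" where "zmul \<equiv> mul (\<lambda>z. z)"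

lemma bdd_hol_ident: "bdd_hol (\<lambda>z. z)"
  by (intro analytic_cball_bdd_hol analytic_on_ident)

lemma fn_zmul: "fn (zmul x) = shift (fn x)"
  by (simp add: fn_mul[OF bdd_hol_ident] mult_op_def shift_def)

lemma coef_zmul: "coef (zmul x) n = (case n of 0 \<Rightarrow> 0 | Suc m \<Rightarrow> coef x m)"
  unfolding coef_def[of "zmul x"] fn_zmul
proof (rule power_series_on_disc(2))
  fix z :: complex assume z: "cmod z < 1"
  have "(\<lambda>n. (case Suc n of 0 \<Rightarrow> 0 | Suc m \<Rightarrow> coef x m) * z ^ Suc n) sums (z * fn x z)"
    using sums_mult[OF fn_sums[OF z, of x], of z] by (simp add: mult_ac)
  then show "(\<lambda>n. (case n of 0 \<Rightarrow> 0 | Suc m \<Rightarrow> coef x m) * z ^ n) sums shift (fn x) z"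
    by (subst (asm) sums_Suc_iff) (simp add: shift_def)
qed

lemma cip_zmul: "cip (zmul x) (zmul y) = cip x y"
proof (rule sums_unique2[OF cip_sums])
  have "(\<lambda>n. coef (zmul x) (Suc n) * cnj (coef (zmul y) (Suc n))) sums cip x y"
    using cip_sums[of x y] by (simp add: coef_zmul)
  then show "(\<lambda>n. coef (zmul x) n * cnj (coef (zmul y) n)) sums cip x y"
    by (subst (asm) sums_Suc_iff) (simp add: coef_zmul)
qed

lemma cip_zmul_one: "cip (zmul x) (kern 0) = 0"
  by (simp add: cip_kern fn_zmul shift_def)

text \<open>The function \<open>y\<close> is the backward shift of \<open>h\<close>.\<close>

lemma split_constant_term:
  obtains y where "h = lincomb (fn h 0) (kern 0) 1 (zmul y)"
proof -
  have "summable (\<lambda>n. (cmod (coef h (Suc n)))\<^sup>2)"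
    using summable_coef[of h] summable_Suc_iff[of "\<lambda>n. (cmod (coef h n))\<^sup>2"] by simp
  from h2_of_coefs[OF this] obtain y where y: "\<And>n. coef y n = coef h (Suc n)" by metis
  have h0: "coef h 0 = fn h 0" using fn_sums[of 0 h] by (simp add: powser_sums_zero_iff)
  have "h = lincomb (fn h 0) (kern 0) 1 (zmul y)"
    by (rule coef_inject) (simp add: coef_lincomb coef_kern coef_zmul y h0 split: nat.split)
  then show ?thesis using that by blast
qed

lemma norm_split_constant_term: "(norm (lincomb c (kern 0) 1 (zmul y)))\<^sup>2 = (cmod c)\<^sup>2 + (norm y)\<^sup>2"
proof -
  have "cip (kern 0) (zmul y) = 0" using cnj_cip[of "zmul y" "kern 0"] by (simp add: cip_zmul_one)
  moreover have "cip (kern 0) (kern 0) = 1" by (simp add: cip_kern fn_kern)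
  ultimately have "cip (lincomb c (kern 0) 1 (zmul y)) (lincomb c (kern 0) 1 (zmul y)) = c * cnj c + cip y y"
    by (simp add: cip_lincomb_left cip_lincomb_right cip_zmul_one cip_zmul)
  then show ?thesis unfolding norm_sq complex_norm_square[symmetric] by simp
qed

lemma analytic_difference_quotient:
  assumes f: "f analytic_on S"
  shows "\<exists>q. q analytic_on S \<and> (\<forall>z. f z - f a = (z - a) * q z)"
proof (intro exI conjI allI)
  let ?q = "\<lambda>z. if z = a then deriv (\<lambda>z. f z - f a) a else (f z - f a) / (z - a)"
  show "f z - f a = (z - a) * ?q z" for z by simp
  show "?q analytic_on S"
  proof (rule pole_theorem_analytic_0)
    show "(\<lambda>z. f z - f a) analytic_on S" using f by (intro analytic_intros)
    show "\<exists>d>0. \<forall>w\<in>ball z d - {a}. f w - f a = (w - a) * ?q w" for z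
      by (intro exI[of _ 1]) auto
  qed auto
qed

definition root_poly :: "complex list \<Rightarrow> cfun" where
  "root_poly zs z = (\<Prod>\<zeta>\<leftarrow>zs. z - \<zeta>)"

lemma root_poly_analytic: "root_poly zs analytic_on S"
  unfolding root_poly_def by (induction zs) (auto intro!: analytic_intros)

lemma bdd_hol_root_poly: "bdd_hol (root_poly zs)"
  by (intro analytic_cball_bdd_hol root_poly_analytic)

text \<open>
  A function \<open>g\<close> that is analytic on the closed disc lies in the range of the adjoint of the
  multiplication by \<open>z - \<zeta>\<close>, with a preimage \<open>u\<close> that is again analytic on the closed disc: the
  equation for \<open>u\<close> is \<open>(1 - cnj \<zeta> * z) * u z = z * g z + u 0\<close>, and the choice \<open>u 0 = - \<zeta> * g \<zeta>\<close>
  removes the singularity at \<open>\<zeta>\<close>.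
\<close>

lemma adjoint_linear_factor_surj:
  assumes g: "g analytic_on cball 0 1" and \<zeta>: "cmod \<zeta> = 1"
  shows "\<exists>u. u analytic_on cball 0 1 \<and> (\<forall>h. cip (mul (\<lambda>z. z - \<zeta>) h) (hol u) = cip h (hol g))"
proof -
  have "(\<lambda>z. z * g z) analytic_on cball 0 1" by (intro analytic_intros g)
  then obtain q where q: "q analytic_on cball 0 1" and qeq: "\<And>z. z * g z - \<zeta> * g \<zeta> = (z - \<zeta>) * q z"
    using analytic_difference_quotient by blast
  define u where "u z = - \<zeta> * q z" for z
  have u: "u analytic_on cball 0 1" unfolding u_def by (intro analytic_intros q)
  have bg: "bdd_hol g" "bdd_hol u" using g u by (auto intro: analytic_cball_bdd_hol)
  have \<zeta>1: "\<zeta> * cnj \<zeta> = 1" using \<zeta> complex_norm_square[of \<zeta>] by simp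
  have ueq: "u z = - \<zeta> * g \<zeta> + z * (g z + cnj \<zeta> * u z)" for z
  proof -
    have "z * (cnj \<zeta> * u z) = - (\<zeta> * cnj \<zeta>) * (z * q z)" by (simp add: u_def)
    also have "\<dots> = - (z * q z)" by (simp add: \<zeta>1)
    finally have "z * (g z + cnj \<zeta> * u z) = z * g z - z * q z" by (simp add: distrib_left)
    moreover have "z * g z = \<zeta> * g \<zeta> + (z - \<zeta>) * q z" using qeq[of z] by (simp add: algebra_simps)
    ultimately show ?thesis by (simp add: u_def algebra_simps)
  qed
  have hu: "hol u = lincomb (- \<zeta> * g \<zeta>) (kern 0) 1 (zmul (lincomb 1 (hol g) (cnj \<zeta>) (hol u)))"
  proof (rule h2_eqI)
    fix z :: complex assume z: "cmod z < 1"
    show "fn (hol u) z = fn (lincomb (- \<zeta> * g \<zeta>) (kern 0) 1 (zmul (lincomb 1 (hol g) (cnj \<zeta>) (hol u)))) z"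
      using ueq[of z] z by (simp add: lincomb.rep_eq fn_mul_apply[OF bdd_hol_ident] fn_hol bg fn_kern)
  qed
  have "cip (mul (\<lambda>z. z - \<zeta>) h) (hol u) = cip h (hol g)" for h
  proof -
    have "bdd_hol (\<lambda>z. z - \<zeta>)" by (intro analytic_cball_bdd_hol analytic_intros)
    then have "mul (\<lambda>z. z - \<zeta>) h = lincomb 1 (zmul h) (- \<zeta>) h"
      by (intro h2_eqI) (simp add: fn_mul_apply bdd_hol_ident lincomb.rep_eq left_diff_distrib)
    moreover have "cip (zmul h) (hol u) = cip h (hol g) + \<zeta> * cip h (hol u)"
      by (subst hu) (simp add: cip_lincomb_right cip_zmul_one cip_zmul)
    ultimately show ?thesis by (simp add: cip_lincomb_left)
  qed
  with u show ?thesis by blast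
qed

text \<open>
  Moving the linear factors one by one from \<open>g\<close> to \<open>h\<close> leaves the pairing of \<open>root_poly zs * h\<close> with
  some function of \<open>H2\<close>.
\<close>

lemma analytic_pairing_bound:
  assumes "\<And>\<zeta>. \<zeta> \<in> set zs \<Longrightarrow> cmod \<zeta> = 1" and "g analytic_on cball 0 1"
  shows "\<exists>C. \<forall>h. cmod (cip h (hol g)) \<le> C * norm (mul (root_poly zs) h)"
  using assms
proof (induction zs arbitrary: g)
  case Nil
  have "mul (root_poly []) h = h" for h
    by (rule h2_eqI) (simp add: fn_mul_apply[OF bdd_hol_root_poly] root_poly_def)
  then show ?case using cip_cauchy_schwarz[of _ "hol g"] by (metis mult.commute)
next
  case (Cons \<zeta> zs)
  obtain u where u: "u analytic_on cball 0 1" and uh: "\<And>h. cip (mul (\<lambda>z. z - \<zeta>) h) (hol u) = cip h (hol g)"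
    using adjoint_linear_factor_surj[OF Cons.prems(2), of \<zeta>] Cons.prems(1) by auto
  obtain C where C: "\<And>h. cmod (cip h (hol u)) \<le> C * norm (mul (root_poly zs) h)"
    using Cons.IH[OF _ u] Cons.prems(1) by auto
  have lin: "bdd_hol (\<lambda>z. z - \<zeta>)" by (intro analytic_cball_bdd_hol analytic_intros)
  have "mul (root_poly zs) (mul (\<lambda>z. z - \<zeta>) h) = mul (root_poly (\<zeta> # zs)) h" for h
    by (rule h2_eqI) (simp add: fn_mul_apply bdd_hol_root_poly lin, simp add: root_poly_def mult_ac)
  then show ?case using C[of "mul (\<lambda>z. z - \<zeta>) _"] uh by metis
qed

section \<open>Non-extreme symbols\<close>

text \<open>
  The last assumption is a quantitative form of non-extremality: up to a constant, the polynomial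
  \<open>root_poly zs\<close> takes the place of a Pythagorean mate of the symbol, that is, of an outer function \<open>a\<close>
  with \<open>cmod (a z)^2 + cmod (b z)^2 = 1\<close> almost everywhere on the circle.
\<close>

locale nonextreme_schur = schur_function +
  fixes B :: cfun and zs :: "complex list" and c :: real
  assumes B_analytic: "B analytic_on cball 0 1"
    and b_eq_B: "\<And>z. cmod z < 1 \<Longrightarrow> b z = B z"
    and zs_unit: "\<And>\<zeta>. \<zeta> \<in> set zs \<Longrightarrow> cmod \<zeta> = 1"
    and c_pos: "c > 0"
    and gap: "\<And>z. cmod z < 1 \<Longrightarrow> (cmod (b z))\<^sup>2 + c * (cmod (root_poly zs z))\<^sup>2 \<le> 1"
begin

text \<open>
  The square of \<open>norm (root h)\<close> is \<open>norm h ^ 2 - norm (adj b h) ^ 2\<close>. Hyponormality allows to replace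
  \<open>adj b h\<close> by \<open>b * h\<close>, and for the latter the gap condition can be integrated.
\<close>

lemma norm_root_lower: "c * (norm (mul (root_poly zs) h))\<^sup>2 \<le> (norm (root h))\<^sup>2"
proof -
  have "(norm (mul b h))\<^sup>2 + (norm (sqrt c *\<^sub>R mul (root_poly zs) h))\<^sup>2 \<le> (norm h)\<^sup>2"
  proof (rule norm_sum_squares_le)
    fix z :: complex assume z: "cmod z < 1"
    have "((cmod (b z))\<^sup>2 + c * (cmod (root_poly zs z))\<^sup>2) * (cmod (fn h z))\<^sup>2 \<le> 1 * (cmod (fn h z))\<^sup>2"
      using gap[OF z] by (intro mult_right_mono) auto
    then show "(cmod (fn (mul b h) z))\<^sup>2 + (cmod (fn (sqrt c *\<^sub>R mul (root_poly zs) h) z))\<^sup>2 \<le> (cmod (fn h z))\<^sup>2"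
      using c_pos
      by (simp add: fn_mul_apply bdd_hol bdd_hol_root_poly fn_simps norm_mult power_mult_distrib distrib_right)
  qed
  moreover have "(norm (sqrt c *\<^sub>R mul (root_poly zs) h))\<^sup>2 = c * (norm (mul (root_poly zs) h))\<^sup>2"
    using c_pos by (simp add: power_mult_distrib)
  moreover have "(norm (adj b h))\<^sup>2 \<le> (norm (mul b h))\<^sup>2"
    using norm_adj_le[OF bdd_hol] by (intro power_mono) auto
  ultimately show ?thesis using norm_root_sq[of h] by linarith
qed

lemma pairing_le_norm_root:
  assumes "g analytic_on cball 0 1"
  shows "\<exists>C\<ge>0. \<forall>h. cmod (cip h (hol g)) \<le> C * norm (root h)"
proof -
  obtain C where C: "\<And>h. cmod (cip h (hol g)) \<le> C * norm (mul (root_poly zs) h)"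
    using analytic_pairing_bound[OF zs_unit assms] by blast
  have "cmod (cip h (hol g)) \<le> (\<bar>C\<bar> / sqrt c) * norm (root h)" for h
  proof -
    have "(sqrt c * norm (mul (root_poly zs) h))\<^sup>2 \<le> (norm (root h))\<^sup>2"
      using norm_root_lower[of h] c_pos by (simp add: power_mult_distrib)
    then have "sqrt c * norm (mul (root_poly zs) h) \<le> norm (root h)"
      by (rule power2_le_imp_le) simp
    then have "norm (mul (root_poly zs) h) \<le> norm (root h) / sqrt c"
      using c_pos by (simp add: pos_le_divide_eq mult.commute)
    then have "\<bar>C\<bar> * norm (mul (root_poly zs) h) \<le> \<bar>C\<bar> * (norm (root h) / sqrt c)"
      by (intro mult_left_mono) auto
    moreover have "C * norm (mul (root_poly zs) h) \<le> \<bar>C\<bar> * norm (mul (root_poly zs) h)"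
      by (intro mult_right_mono) auto
    ultimately show ?thesis using C[of h] by simp
  qed
  moreover have "0 \<le> \<bar>C\<bar> / sqrt c" using c_pos by simp
  ultimately show ?thesis by blast
qed

lemma analytic_in_dBR:
  assumes "g analytic_on cball 0 1"
  shows "fn (hol g) \<in> dBR b"
  using pairing_le_norm_root[OF assms] dBR_memI by blast

lemma hol_B: "cip h (hol B) = cip h (mul b (kern 0))"
proof -
  have "hol B = mul b (kern 0)"
    by (rule h2_eqI) (simp add: fn_hol analytic_cball_bdd_hol B_analytic fn_mul_apply bdd_hol fn_kern b_eq_B)
  then show ?thesis by simp
qed

text \<open>
  The multiplication by \<open>z\<close> commutes with that by \<open>b\<close>, and so \<open>adj b y\<close> is the backward shift of
  \<open>adj b h\<close>. The two norms therefore differ only through constant terms, and that of \<open>adj b h\<close> is the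
  pairing of \<open>h\<close> with \<open>b\<close>.
\<close>

lemma norm_root_backward_shift:
  assumes h: "h = lincomb d (kern 0) 1 (zmul y)"
  shows "(norm (root y))\<^sup>2 \<le> (norm (root h))\<^sup>2 + (cmod (cip h (hol B)))\<^sup>2"
proof -
  obtain v where v: "adj b h = lincomb (fn (adj b h) 0) (kern 0) 1 (zmul v)"
    using split_constant_term by blast
  have "cip x v = cip x (adj b y)" for x
  proof -
    have "cip x v = cip (zmul x) (adj b h)"
      by (subst v) (simp add: cip_lincomb_right cip_zmul_one cip_zmul)
    also have "\<dots> = cip (zmul (mul b x)) h"
      by (simp add: cip_adj[OF bdd_hol, symmetric] mul_mul[OF bdd_hol bdd_hol_ident])
    also have "\<dots> = cip x (adj b y)"
      by (simp add: h cip_lincomb_right cip_zmul_one cip_zmul cip_adj[OF bdd_hol])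
    finally show ?thesis .
  qed
  then have vy: "v = adj b y" by (rule h2_eqI_cip)
  have "fn (adj b h) 0 = cip (adj b h) (kern 0)" by (simp add: cip_kern)
  also have "\<dots> = cip h (mul b (kern 0))" by (metis cip_adj[OF bdd_hol] cnj_cip)
  finally have "(norm (adj b h))\<^sup>2 = (cmod (cip h (hol B)))\<^sup>2 + (norm (adj b y))\<^sup>2"
    by (subst v) (simp add: norm_split_constant_term vy hol_B)
  moreover have "(norm h)\<^sup>2 = (cmod d)\<^sup>2 + (norm y)\<^sup>2" by (simp add: h norm_split_constant_term)
  ultimately show ?thesis using norm_root_sq[of h] norm_root_sq[of y] by simp
qed

text \<open>
  The pairing of \<open>h\<close> with \<open>z * root x\<close> is the pairing of the backward shift of \<open>h\<close> with \<open>root x\<close>.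
\<close>

lemma dBR_shift_invariant:
  assumes f: "f \<in> dBR b"
  shows "shift f \<in> dBR b"
proof -
  obtain x where x: "f = fn (root x)" using dBR_cases[OF f] by metis
  obtain C where C: "\<And>h. cmod (cip h (hol B)) \<le> C * norm (root h)" "C \<ge> 0"
    using pairing_le_norm_root[OF B_analytic] by blast
  have "cmod (cip h (zmul (root x))) \<le> (sqrt (1 + C\<^sup>2) * norm x) * norm (root h)" for h
  proof -
    obtain y where y: "h = lincomb (fn h 0) (kern 0) 1 (zmul y)" using split_constant_term by blast
    have "cip (kern 0) (zmul (root x)) = 0"
      using cnj_cip[of "zmul (root x)" "kern 0"] by (simp add: cip_zmul_one)
    then have "cip h (zmul (root x)) = cip (root y) x"
      by (subst y) (simp add: cip_lincomb_left cip_zmul root_sym)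
    then have le: "cmod (cip h (zmul (root x))) \<le> norm (root y) * norm x"
      using cip_cauchy_schwarz by simp
    have "(norm (root y))\<^sup>2 \<le> (norm (root h))\<^sup>2 + (C * norm (root h))\<^sup>2"
      using norm_root_backward_shift[OF y] power_mono[OF C(1)[of h], of 2] by simp
    also have "\<dots> = (sqrt (1 + C\<^sup>2) * norm (root h))\<^sup>2"
      by (simp add: power_mult_distrib distrib_right)
    finally have "norm (root y) \<le> sqrt (1 + C\<^sup>2) * norm (root h)"
      by (rule power2_le_imp_le) simp
    then have "norm (root y) * norm x \<le> sqrt (1 + C\<^sup>2) * norm (root h) * norm x"
      by (rule mult_right_mono) simp
    with le show ?thesis by (simp add: mult_ac)
  qed
  then have "fn (zmul (root x)) \<in> dBR b" by (rule dBR_memI)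
  then show ?thesis by (simp add: fn_zmul x)
qed

end

section \<open>Point evaluations on de Branges-Rovnyak spaces\<close>

context schur_function
begin

text \<open>
  The value at \<open>w\<close> of \<open>root y\<close> is \<open>cip y (root (kern w))\<close>, and the squared norm of \<open>root (kern w)\<close> is
  the value on the diagonal of the reproducing kernel.
\<close>

lemma cmod_dBR_le:
  assumes w: "cmod w < 1" and y: "y \<in> coker"
  shows "(cmod (fn (root y) w))\<^sup>2 \<le> (norm y)\<^sup>2 * ((1 - (cmod (b w))\<^sup>2) / (1 - (cmod w)\<^sup>2))"
proof -
  have kn: "(norm (kern w))\<^sup>2 = 1 / (1 - (cmod w)\<^sup>2)"
  proof -
    have "cip (kern w) (kern w) = 1 / (1 - w * cnj w)"
      using w by (simp add: cip_kern fn_kern mult.commute)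
    also have "\<dots> = of_real (1 / (1 - (cmod w)\<^sup>2))"
      unfolding complex_norm_square[symmetric] by simp
    finally show ?thesis unfolding norm_sq by (simp only: Re_complex_of_real)
  qed
  have "cip (adj b (kern w)) (adj b (kern w)) = cnj (b w) * b w * cip (kern w) (kern w)"
    using w by (simp add: adj_kern[OF bdd_hol] cip_lincomb_left cip_lincomb_right)
  also have "cnj (b w) * b w = of_real ((cmod (b w))\<^sup>2)"
    using complex_norm_square[of "b w"] by (simp add: mult.commute)
  finally have "(norm (adj b (kern w)))\<^sup>2 = (cmod (b w))\<^sup>2 * (norm (kern w))\<^sup>2"
    unfolding cip_self_norm of_real_mult[symmetric] of_real_eq_iff .
  then have rn: "(norm (root (kern w)))\<^sup>2 = (1 - (cmod (b w))\<^sup>2) / (1 - (cmod w)\<^sup>2)"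
    unfolding norm_root_sq kn by (simp add: diff_divide_distrib)
  have "cmod (fn (root y) w) = cmod (cip y (root (kern w)))"
    using w by (simp add: cip_kern[symmetric] root_sym)
  also have "\<dots> \<le> norm y * norm (root (kern w))" by (rule cip_cauchy_schwarz)
  finally have "(cmod (fn (root y) w))\<^sup>2 \<le> (norm y * norm (root (kern w)))\<^sup>2" by (rule power_mono) simp
  then show ?thesis by (simp only: power_mult_distrib rn)
qed

lemma dBR_inner_self: "y \<in> coker \<Longrightarrow> Re (dBR_inner b (fn (root y)) (fn (root y))) = (norm y)\<^sup>2"
  by (simp add: dBR_inner_root norm_sq)

lemma dBR_lincomb:
  assumes "f \<in> dBR b" "g \<in> dBR b"
  shows "(\<lambda>z. c * f z + d * g z) \<in> dBR b"
proof -
  obtain x where x: "f = fn (root x)" using dBR_cases[OF assms(1)] by metis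
  obtain y where y: "g = fn (root y)" using dBR_cases[OF assms(2)] by metis
  have "(\<lambda>z. c * f z + d * g z) = fn (root (lincomb c x d y))"
    by (simp add: x y clinear_h2D[OF clinear_root] lincomb.rep_eq)
  then show ?thesis using fn_root_in_dBR by simp
qed

lemma closed_coker: "closed coker"
proof -
  have "coker = (\<Inter>k\<in>{k. root k = 0}. {y. cip y k = 0})" by (auto simp: coker_def)
  moreover have "closed {y. cip y k = 0}" for k
  proof -
    have "bounded_linear (\<lambda>y. cip y k)"
    proof (rule bounded_linear_intro)
      show "cip (x + y) k = cip x k + cip y k" for x y by (rule cip_add_left)
      show "cip (r *\<^sub>R x) k = r *\<^sub>R cip x k" for r x
        by (simp add: scaleR_h2_def cip_lincomb_left scaleR_conv_of_real)
      show "norm (cip x k) \<le> norm x * norm k" for x by (rule cip_cauchy_schwarz)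
    qed
    then show ?thesis by (intro closed_Collect_eq linear_continuous_on continuous_on_const)
  qed
  ultimately show ?thesis by (auto intro: closed_INT)
qed

end

section \<open>Density of the range of the shift minus a constant\<close>

text \<open>
  Here \<open>d\<close> is the error of the approximation of \<open>f\<close> by an element of the range of \<open>S - \<zeta>\<close>, where \<open>S\<close> is
  the shift.
\<close>

definition range_shift_minus_dense :: "cfun set \<Rightarrow> (cfun \<Rightarrow> cfun \<Rightarrow> complex) \<Rightarrow> complex \<Rightarrow> bool" where
  "range_shift_minus_dense V ip \<zeta> \<longleftrightarrow>
     (\<forall>f\<in>V. \<forall>\<epsilon>>0. \<exists>g\<in>V. \<exists>d. (\<forall>z. d z = f z - (shift g z - \<zeta> * g z)) \<and> Re (ip d d) < \<epsilon>)"

text \<open>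
  The unitary map carries \<open>g\<close> and the error \<open>d\<close> to the other space, in both directions since it is
  onto. The invariance of \<open>V\<^sub>1\<close> under the shift makes its linearity applicable to \<open>shift g\<close>.
\<close>

lemma range_shift_minus_dense_unitary:
  assumes lin1: "\<And>f g c d. f \<in> V\<^sub>1 \<Longrightarrow> g \<in> V\<^sub>1 \<Longrightarrow> (\<lambda>z. c * f z + d * g z) \<in> V\<^sub>1"
    and shift1: "\<And>f. f \<in> V\<^sub>1 \<Longrightarrow> shift f \<in> V\<^sub>1"
    and eq: "unitarily_equivalent V\<^sub>1 ip\<^sub>1 shift V\<^sub>2 ip\<^sub>2 shift"
  shows "range_shift_minus_dense V\<^sub>1 ip\<^sub>1 \<zeta> \<longleftrightarrow> range_shift_minus_dense V\<^sub>2 ip\<^sub>2 \<zeta>"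
proof -
  obtain U where U: "linear_map_on V\<^sub>1 U" "U ` V\<^sub>1 = V\<^sub>2"
    and iso: "\<And>f g. f \<in> V\<^sub>1 \<Longrightarrow> g \<in> V\<^sub>1 \<Longrightarrow> ip\<^sub>2 (U f) (U g) = ip\<^sub>1 f g"
    and intertw: "\<And>f. f \<in> V\<^sub>1 \<Longrightarrow> U (shift f) = shift (U f)"
    using eq unfolding unitarily_equivalent_def by blast
  have lin: "U (\<lambda>z. c * f z + d * g z) = (\<lambda>z. c * U f z + d * U g z)" if "f \<in> V\<^sub>1" "g \<in> V\<^sub>1" for f g c d
    using U(1) that unfolding linear_map_on_def by blast
  define res where "res f g = (\<lambda>z. f z - (shift g z - \<zeta> * g z))" for f g :: cfun
  have res_eq: "res f g = (\<lambda>z. 1 * f z + (-1) * (1 * shift g z + (- \<zeta>) * g z))" for f g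
    by (simp add: res_def algebra_simps)
  have res: "ip\<^sub>2 (res (U f) (U g)) (res (U f) (U g)) = ip\<^sub>1 (res f g) (res f g)"
    if f: "f \<in> V\<^sub>1" and g: "g \<in> V\<^sub>1" for f g
  proof -
    have m: "(\<lambda>z. 1 * shift g z + (- \<zeta>) * g z) \<in> V\<^sub>1" by (rule lin1[OF shift1[OF g] g])
    have "U (res f g) = (\<lambda>z. 1 * U f z + (-1) * U (\<lambda>z. 1 * shift g z + (- \<zeta>) * g z) z)"
      unfolding res_eq by (rule lin[OF f m])
    also have "\<dots> = res (U f) (U g)"
      unfolding res_eq lin[OF shift1[OF g] g] intertw[OF g] ..
    finally have Ur: "U (res f g) = res (U f) (U g)" .
    have "res f g \<in> V\<^sub>1" unfolding res_eq by (rule lin1[OF f m])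
    from iso[OF this this] show ?thesis unfolding Ur .
  qed
  have D: "range_shift_minus_dense V ip \<zeta> \<longleftrightarrow> (\<forall>f\<in>V. \<forall>\<epsilon>>0. \<exists>g\<in>V. Re (ip (res f g) (res f g)) < \<epsilon>)" for V ip
  proof -
    have "(\<exists>d. (\<forall>z. d z = f z - (shift g z - \<zeta> * g z)) \<and> Re (ip d d) < \<epsilon>) \<longleftrightarrow> Re (ip (res f g) (res f g)) < \<epsilon>" for f g \<epsilon>
      unfolding fun_eq_iff[symmetric, of _ "\<lambda>z. f z - (shift g z - \<zeta> * g z)"] res_def by simp
    then show ?thesis unfolding range_shift_minus_dense_def by simp
  qed
  show ?thesis unfolding D U(2)[symmetric] by (simp add: res)
qed

context nonextreme_schur
begin

text \<open>The reproducing kernel at \<open>w\<close>, continued across the circle by means of \<open>B\<close>.\<close>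

definition kernel_fun :: "complex \<Rightarrow> cfun" where
  "kernel_fun w z = (1 - cnj (b w) * B z) / (1 - cnj w * z)"

lemma kernel_fun_analytic:
  assumes "cmod w < 1"
  shows "kernel_fun w analytic_on cball 0 1"
  unfolding kernel_fun_def
proof (intro analytic_intros B_analytic)
  fix z :: complex assume "z \<in> cball 0 1"
  then have "cmod (cnj w * z) \<le> cmod w * 1" unfolding norm_mult complex_mod_cnj by (intro mult_left_mono) auto
  then show "1 - cnj w * z \<noteq> 0" using assms by auto
qed

lemma defect_kern:
  assumes w: "cmod w < 1"
  shows "defect (kern w) = hol (kernel_fun w)"
proof (rule h2_eqI)
  fix z :: complex assume z: "cmod z < 1"
  show "fn (defect (kern w)) z = fn (hol (kernel_fun w)) z"
    using w z
    by (simp add: defect_def adj_kern[OF bdd_hol] fn_simps fn_mul_apply[OF bdd_hol] fn_kern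
        fn_hol analytic_cball_bdd_hol kernel_fun_analytic kernel_fun_def b_eq_B diff_divide_distrib mult_ac)
qed

lemma radial_lipschitz:
  assumes \<zeta>: "cmod \<zeta> = 1"
  shows "\<exists>M>0. eventually (\<lambda>r::real. cmod (B (of_real r * \<zeta>) - B \<zeta>) \<le> M * (1 - r)) (at_left 1)"
proof -
  have "B field_differentiable (at \<zeta>)"
    using B_analytic \<zeta> analytic_on_imp_differentiable_at by (metis mem_cball dist_0_norm order_refl)
  then obtain D where "(B has_field_derivative D) (at \<zeta>)" by (auto simp: field_differentiable_def)
  then have lim: "((\<lambda>w. (B w - B \<zeta>) / (w - \<zeta>)) \<longlongrightarrow> D) (at \<zeta>)" by (simp add: has_field_derivative_iff)
  have fl: "filterlim (\<lambda>r::real. of_real r * \<zeta>) (at \<zeta>) (at_left 1)"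
    unfolding filterlim_at
  proof
    show "((\<lambda>r::real. of_real r * \<zeta>) \<longlongrightarrow> \<zeta>) (at_left 1)" by (auto intro!: tendsto_eq_intros)
    show "eventually (\<lambda>r::real. of_real r * \<zeta> \<in> UNIV \<and> of_real r * \<zeta> \<noteq> \<zeta>) (at_left 1)"
      using eventually_at_left_real[of 0 1] \<zeta> by (auto elim!: eventually_mono)
  qed
  have "((\<lambda>r::real. cmod ((B (of_real r * \<zeta>) - B \<zeta>) / (of_real r * \<zeta> - \<zeta>))) \<longlongrightarrow> cmod D) (at_left 1)"
    by (intro tendsto_norm filterlim_compose[OF lim fl])
  then have "eventually (\<lambda>r::real. cmod ((B (of_real r * \<zeta>) - B \<zeta>) / (of_real r * \<zeta> - \<zeta>)) < cmod D + 1) (at_left 1)"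
    by (rule order_tendstoD) simp
  moreover have "eventually (\<lambda>r::real. r \<in> {0<..<1}) (at_left 1)" by (rule eventually_at_left_real) simp
  ultimately have "eventually (\<lambda>r::real. cmod (B (of_real r * \<zeta>) - B \<zeta>) \<le> (cmod D + 1) * (1 - r)) (at_left 1)"
  proof eventually_elim
    case (elim r)
    have "cmod (of_real r * \<zeta> - \<zeta>) = 1 - r"
    proof -
      have "of_real r * \<zeta> - \<zeta> = of_real (r - 1) * \<zeta>" by (simp add: left_diff_distrib)
      then show ?thesis using elim(2) by (simp only: norm_mult norm_of_real \<zeta>) simp
    qed
    then have "cmod (B (of_real r * \<zeta>) - B \<zeta>) / (1 - r) < cmod D + 1" using elim(1) by (simp add: norm_divide)
    then show ?case using elim(2) by (simp add: pos_divide_less_eq)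
  qed
  then show ?thesis by (intro exI[of _ "cmod D + 1"]) (auto intro: add_nonneg_pos)
qed

text \<open>
  A point at which \<open>B\<close> is unimodular: the reproducing kernels are bounded along the radius, so that
  elements of the space that are close to each other are uniformly close on the radius. But
  \<open>(z - \<zeta>) * g\<close> tends to 0 along the radius, and so cannot approximate the constant 1.
\<close>

lemma not_dense_if_unimodular:
  assumes \<zeta>: "cmod \<zeta> = 1" and B\<zeta>: "cmod (B \<zeta>) = 1"
  shows "\<not> range_shift_minus_dense (dBR b) (dBR_inner b) \<zeta>"
proof
  assume dense: "range_shift_minus_dense (dBR b) (dBR_inner b) \<zeta>"
  obtain M where M: "M > 0"
    and ev: "eventually (\<lambda>r::real. cmod (B (of_real r * \<zeta>) - B \<zeta>) \<le> M * (1 - r)) (at_left 1)"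
    using radial_lipschitz[OF \<zeta>] by blast
  have bound: "(cmod (fn (root y) (of_real r * \<zeta>)))\<^sup>2 \<le> (norm y)\<^sup>2 * (2 * M)"
    if r: "0 < r" "r < 1" and Br: "cmod (B (of_real r * \<zeta>) - B \<zeta>) \<le> M * (1 - r)" and y: "y \<in> coker" for r y
  proof -
    let ?w = "of_real r * \<zeta>"
    have nw: "cmod ?w = r" using r \<zeta> by (simp add: norm_mult)
    have b1: "cmod (b ?w) \<le> 1" using cmod_le_1[of ?w] nw r by simp
    have "1 - cmod (b ?w) \<le> cmod (B ?w - B \<zeta>)"
      using norm_triangle_ineq3[of "B \<zeta>" "B ?w"] B\<zeta> nw r by (simp add: b_eq_B norm_minus_commute)
    then have le: "1 - cmod (b ?w) \<le> M * (1 - r)" using Br by linarith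
    have "1 - (cmod (b ?w))\<^sup>2 = (1 - cmod (b ?w)) * (1 + cmod (b ?w))"
      by (simp add: power2_eq_square algebra_simps)
    also have "\<dots> \<le> M * (1 - r) * 2" using le b1 r M by (intro mult_mono) auto
    finally have num: "1 - (cmod (b ?w))\<^sup>2 \<le> 2 * M * (1 - r)" by simp
    have "1 - (cmod ?w)\<^sup>2 = (1 - r) * (1 + r)" unfolding nw by (simp add: power2_eq_square algebra_simps)
    moreover have "(1 - r) * 1 \<le> (1 - r) * (1 + r)" using r by (intro mult_left_mono) auto
    ultimately have den: "1 - r \<le> 1 - (cmod ?w)\<^sup>2" by simp
    have "(1 - (cmod (b ?w))\<^sup>2) / (1 - (cmod ?w)\<^sup>2) \<le> (2 * M * (1 - r)) / (1 - r)"
      using num den r M by (intro frac_le) auto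
    also have "\<dots> = 2 * M" using r by simp
    finally have "(norm y)\<^sup>2 * ((1 - (cmod (b ?w))\<^sup>2) / (1 - (cmod ?w)\<^sup>2)) \<le> (norm y)\<^sup>2 * (2 * M)"
      by (intro mult_left_mono) auto
    with cmod_dBR_le[of ?w y] y nw r show ?thesis by simp
  qed
  have one: "fn (hol (\<lambda>z. 1)) \<in> dBR b" by (intro analytic_in_dBR analytic_intros)
  \<comment> \<open>A squared norm below \<open>1 / (8 * M)\<close> forces values of modulus at most \<open>1 / 2\<close> on the radius.\<close>
  have "1 / (8 * M) > 0" using M by simp
  with dense one obtain g d where g: "g \<in> dBR b"
    and d: "\<And>z. d z = fn (hol (\<lambda>z. 1)) z - (shift g z - \<zeta> * g z)" and small: "Re (dBR_inner b d d) < 1 / (8 * M)"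
    unfolding range_shift_minus_dense_def by blast
  obtain x where x: "x \<in> coker" "g = fn (root x)" using dBR_cases[OF g] by metis
  have deq: "d = (\<lambda>z. 1 * fn (hol (\<lambda>z. 1)) z + (-1) * (1 * shift g z + (- \<zeta>) * g z))"
    using d by (simp add: fun_eq_iff)
  have "d \<in> dBR b" unfolding deq by (rule dBR_lincomb[OF one dBR_lincomb[OF dBR_shift_invariant[OF g] g]])
  then obtain y where y: "y \<in> coker" "d = fn (root y)" using dBR_cases by metis
  have ny: "(norm y)\<^sup>2 < 1 / (8 * M)" using small y by (simp add: dBR_inner_self)
  have "((\<lambda>r. (1 - r) * (sqrt (2 * M) * norm x)) \<longlongrightarrow> (1 - 1) * (sqrt (2 * M) * norm x)) (at_left (1::real))"
    by (intro tendsto_intros)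
  then have "eventually (\<lambda>r. (1 - r) * (sqrt (2 * M) * norm x) < 1 / 2) (at_left (1::real))"
    by (rule order_tendstoD) simp
  then have "eventually (\<lambda>r::real. False) (at_left 1)"
    using ev eventually_at_left_real[OF zero_less_one]
  proof eventually_elim
    case (elim r)
    let ?w = "of_real r * \<zeta>"
    have r: "0 < r" "r < 1" using elim(3) by auto
    have nw: "cmod ?w < 1" using r \<zeta> by (simp add: norm_mult)
    have "(cmod (d ?w))\<^sup>2 \<le> (norm y)\<^sup>2 * (2 * M)" using bound[OF r elim(2) y(1)] y(2) by simp
    also have "\<dots> \<le> 1 / (8 * M) * (2 * M)" using ny M by (intro mult_right_mono) auto
    also have "\<dots> = (1 / 2)\<^sup>2" using M by (simp add: power2_eq_square)
    finally have d2: "cmod (d ?w) \<le> 1 / 2" by (rule power2_le_imp_le) simp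
    have "(cmod (g ?w))\<^sup>2 \<le> (norm x)\<^sup>2 * (2 * M)" using bound[OF r elim(2) x(1)] x(2) by simp
    also have "\<dots> = (sqrt (2 * M) * norm x)\<^sup>2" using M by (simp add: power_mult_distrib)
    finally have g2: "cmod (g ?w) \<le> sqrt (2 * M) * norm x" by (rule power2_le_imp_le) (use M in simp)
    have "d ?w = 1 + of_real (1 - r) * \<zeta> * g ?w"
      using nw by (simp add: d fn_hol analytic_cball_bdd_hol shift_def algebra_simps)
    then have "1 = d ?w - of_real (1 - r) * \<zeta> * g ?w" by simp
    then have "1 \<le> cmod (d ?w) + cmod (of_real (1 - r) * \<zeta> * g ?w)" by (metis norm_one norm_triangle_ineq4)
    also have "cmod (of_real (1 - r) * \<zeta> * g ?w) = (1 - r) * cmod (g ?w)"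
      unfolding norm_mult norm_of_real \<zeta> using r by simp
    also have "\<dots> \<le> (1 - r) * (sqrt (2 * M) * norm x)" using g2 r by (intro mult_left_mono) auto
    finally show False using d2 elim(1) by linarith
  qed
  then show False by simp
qed

text \<open>
  A point \<open>\<zeta>\<close> at which \<open>B\<close> is not unimodular: for \<open>k\<close> orthogonal to the range, the functional
  \<open>f \<mapsto> dBR_inner b f k\<close> vanishes on every analytic \<open>f\<close> with \<open>f \<zeta> = 0\<close>. Applied to a combination of
  the kernels at \<open>w\<close> and at \<open>r * \<zeta>\<close> this expresses \<open>k w\<close> through \<open>k (r * \<zeta>)\<close>, with a factor of
  order \<open>1 - r\<close>, while \<open>k (r * \<zeta>)\<close> grows at most like \<open>1 / sqrt (1 - r)\<close>.
\<close>

lemma orthogonal_to_range_zero: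
  assumes \<zeta>: "cmod \<zeta> = 1" and B\<zeta>: "cmod (B \<zeta>) < 1" and y: "y \<in> coker"
    and orth: "\<And>g m. g \<in> dBR b \<Longrightarrow> m \<in> coker \<Longrightarrow> (\<And>z. fn (root m) z = shift g z - \<zeta> * g z) \<Longrightarrow> cip m y = 0"
    and w: "cmod w < 1"
  shows "fn (root y) w = 0"
proof -
  define \<alpha> where "\<alpha> = kernel_fun w \<zeta>"
  define C where "C = (cmod \<alpha> / (1 - cmod (B \<zeta>)))\<^sup>2 * (norm y)\<^sup>2"
  have main: "(cmod (fn (root y) w))\<^sup>2 \<le> C * (1 - r)" if r: "0 < r" "r < 1" for r
  proof -
    let ?v = "of_real r * \<zeta>"
    have nv: "cmod ?v = r" using r \<zeta> by (simp add: norm_mult)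
    then have v: "cmod ?v < 1" using r by simp
    define \<beta> where "\<beta> = kernel_fun ?v \<zeta>"
    have "cnj ?v * \<zeta> = of_real r" using complex_norm_square[of \<zeta>] \<zeta> by (simp add: mult_ac)
    then have \<beta>: "\<beta> = (1 - cnj (b ?v) * B \<zeta>) / of_real (1 - r)" by (simp add: \<beta>_def kernel_fun_def)
    have "cmod (cnj (b ?v) * B \<zeta>) \<le> 1 * cmod (B \<zeta>)"
      unfolding norm_mult complex_mod_cnj using cmod_le_1[OF v] by (intro mult_right_mono) auto
    then have "1 - cmod (B \<zeta>) \<le> cmod (1 - cnj (b ?v) * B \<zeta>)"
      using norm_triangle_ineq2[of 1 "cnj (b ?v) * B \<zeta>"] by simp
    then have \<beta>_ge: "(1 - cmod (B \<zeta>)) / (1 - r) \<le> cmod \<beta>"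
      unfolding \<beta> norm_divide norm_of_real using r by (simp add: divide_right_mono)
    moreover have pos: "0 < (1 - cmod (B \<zeta>)) / (1 - r)" using B\<zeta> r by simp
    ultimately have \<beta>0: "\<beta> \<noteq> 0" by auto
    define f where "f z = kernel_fun w z - (\<alpha> / \<beta>) * kernel_fun ?v z" for z
    have fan: "f analytic_on cball 0 1" unfolding f_def by (intro analytic_intros kernel_fun_analytic w v)
    have f\<zeta>: "f \<zeta> = 0" using \<beta>0 by (simp add: f_def \<alpha>_def \<beta>_def)
    obtain q where q: "q analytic_on cball 0 1" and fq: "\<And>z. f z - f \<zeta> = (z - \<zeta>) * q z"
      using analytic_difference_quotient[OF fan] by blast
    define m where "m = lincomb 1 (root (kern w)) (- (\<alpha> / \<beta>)) (root (kern ?v))"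
    have mc: "m \<in> coker" unfolding m_def by (intro coker_lincomb root_in_coker)
    have rm: "root m = lincomb 1 (hol (kernel_fun w)) (- (\<alpha> / \<beta>)) (hol (kernel_fun ?v))"
      unfolding m_def clinear_h2D[OF clinear_root] root_root defect_kern[OF w] defect_kern[OF v] ..
    have "fn (root m) z = shift (fn (hol q)) z - \<zeta> * fn (hol q) z" for z
    proof (cases "cmod z < 1")
      case True
      then have "fn (root m) z = f z"
        unfolding rm lincomb.rep_eq by (simp add: fn_hol analytic_cball_bdd_hol kernel_fun_analytic w v f_def)
      also have "\<dots> = (z - \<zeta>) * q z" using fq[of z] f\<zeta> by simp
      finally show ?thesis using True q by (simp add: shift_def fn_hol analytic_cball_bdd_hol left_diff_distrib)
    next
      case False
      then show ?thesis by (simp add: fn_outside shift_def)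
    qed
    then have "cip m y = 0" using orth[OF analytic_in_dBR[OF q] mc] by blast
    then have "cip (root (kern w)) y = (\<alpha> / \<beta>) * cip (root (kern ?v)) y"
      by (simp add: m_def cip_lincomb_left)
    then have "cip (root y) (kern w) = cnj (\<alpha> / \<beta>) * cip (root y) (kern ?v)"
      using root_sym cnj_cip complex_cnj_mult by metis
    then have "fn (root y) w = cnj (\<alpha> / \<beta>) * fn (root y) ?v" using w v by (simp add: cip_kern)
    then have e: "(cmod (fn (root y) w))\<^sup>2 = (cmod \<alpha> / cmod \<beta>)\<^sup>2 * (cmod (fn (root y) ?v))\<^sup>2"
      by (simp only: norm_mult complex_mod_cnj norm_divide power_mult_distrib)
    have "cmod \<alpha> / cmod \<beta> \<le> cmod \<alpha> / ((1 - cmod (B \<zeta>)) / (1 - r))"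
      using \<beta>_ge mult_pos_pos[OF _ pos, of "cmod \<beta>"] \<beta>0 by (intro divide_left_mono) auto
    also have "\<dots> = (cmod \<alpha> / (1 - cmod (B \<zeta>))) * (1 - r)" by simp
    finally have ab: "(cmod \<alpha> / cmod \<beta>)\<^sup>2 \<le> ((cmod \<alpha> / (1 - cmod (B \<zeta>))) * (1 - r))\<^sup>2" by (intro power_mono) auto
    have "(1 - (cmod (b ?v))\<^sup>2) / (1 - (cmod ?v)\<^sup>2) \<le> 1 / (1 - r)"
    proof (rule frac_le)
      have "r\<^sup>2 \<le> r" using r by (simp add: power2_eq_square mult_left_le)
      then show "1 - r \<le> 1 - (cmod ?v)\<^sup>2" unfolding nv by simp
    qed (use r in auto)
    then have "(norm y)\<^sup>2 * ((1 - (cmod (b ?v))\<^sup>2) / (1 - (cmod ?v)\<^sup>2)) \<le> (norm y)\<^sup>2 * (1 / (1 - r))"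
      by (intro mult_left_mono) auto
    with cmod_dBR_le[OF v y] have "(cmod (fn (root y) ?v))\<^sup>2 \<le> (norm y)\<^sup>2 * (1 / (1 - r))" by linarith
    then have "(cmod (fn (root y) w))\<^sup>2 \<le> ((cmod \<alpha> / (1 - cmod (B \<zeta>))) * (1 - r))\<^sup>2 * ((norm y)\<^sup>2 * (1 / (1 - r)))"
      unfolding e using ab by (intro mult_mono) auto
    also have "\<dots> = C * ((1 - r)\<^sup>2 * (1 / (1 - r)))" unfolding C_def power_mult_distrib by (simp only: mult_ac)
    also have "(1 - r)\<^sup>2 * (1 / (1 - r)) = 1 - r" using r by (simp add: power2_eq_square)
    finally show ?thesis .
  qed
  have "((\<lambda>r. C * (1 - r)) \<longlongrightarrow> C * (1 - 1)) (at_left (1::real))" by (intro tendsto_intros)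
  moreover have "eventually (\<lambda>r. (cmod (fn (root y) w))\<^sup>2 \<le> C * (1 - r)) (at_left (1::real))"
    using eventually_at_left_real[OF zero_less_one] by eventually_elim (use main in auto)
  ultimately have "(cmod (fn (root y) w))\<^sup>2 \<le> C * (1 - 1)"
    using tendsto_lowerbound[OF _ _ trivial_limit_at_left_real] by blast
  then show ?thesis by simp
qed

text \<open>
  The projection theorem reduces density to the triviality of the orthogonal complement. It is applied
  in \<open>H2\<close>, to the preimages under the root of the functions in the range.
\<close>

lemma dense_if_not_unimodular:
  assumes \<zeta>: "cmod \<zeta> = 1" and B\<zeta>: "cmod (B \<zeta>) < 1"
  shows "range_shift_minus_dense (dBR b) (dBR_inner b) \<zeta>"
  unfolding range_shift_minus_dense_def
proof (intro ballI allI impI)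
  fix f and \<epsilon> :: real assume f: "f \<in> dBR b" and \<epsilon>: "\<epsilon> > 0"
  obtain x where x: "x \<in> coker" "f = fn (root x)" using dBR_cases[OF f] by metis
  define M where "M = {m \<in> coker. \<exists>g\<in>dBR b. \<forall>z. fn (root m) z = shift g z - \<zeta> * g z}"
  have M_lincomb: "lincomb c m d n \<in> M" if mn: "m \<in> M" "n \<in> M" for c d m n
  proof -
    obtain g h where g: "g \<in> dBR b" "\<And>z. fn (root m) z = shift g z - \<zeta> * g z"
      and h: "h \<in> dBR b" "\<And>z. fn (root n) z = shift h z - \<zeta> * h z"
      using mn unfolding M_def by blast
    let ?k = "\<lambda>z. c * g z + d * h z"
    have "fn (root (lincomb c m d n)) z = shift ?k z - \<zeta> * ?k z" for z
      unfolding clinear_h2D[OF clinear_root] lincomb.rep_eq g(2) h(2) by (simp add: shift_def algebra_simps)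
    moreover have "?k \<in> dBR b" by (rule dBR_lincomb[OF g(1) h(1)])
    ultimately show ?thesis using mn coker_lincomb unfolding M_def by blast
  qed
  have M_range: "m \<in> M" if "g \<in> dBR b" "m \<in> coker" "\<And>z. fn (root m) z = shift g z - \<zeta> * g z" for g m
    using that unfolding M_def by blast
  have "0 \<in> M"
  proof (rule M_range)
    show "fn 0 \<in> dBR b" using fn_root_in_dBR[of 0] by (simp add: root_simps)
    show "0 \<in> coker" by (simp add: coker_def cip_zero_left)
  qed (simp add: root_simps fn_zero shift_def)
  then have sub: "subspace M"
    unfolding subspace_def plus_h2_def lincomb_scaleR[symmetric] using M_lincomb by blast
  have "\<exists>u\<in>closure M. \<forall>m\<in>M. inner m x = inner m u"
  proof (rule riesz_on_subspace[OF sub])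
    show "\<bar>inner m x\<bar> \<le> norm x * norm m" for m
      using Cauchy_Schwarz_ineq2[of m x] by (simp add: mult.commute)
  qed (auto simp: inner_add_left)
  then obtain u where u: "u \<in> closure M" and xu: "\<And>m. m \<in> M \<Longrightarrow> inner m x = inner m u" by blast
  have "M \<subseteq> coker" by (auto simp: M_def)
  then have "u \<in> coker" using u closed_coker closure_minimal by blast
  then have xuc: "x - u \<in> coker" using coker_lincomb[OF x(1), of u 1 "-1"] by (simp add: minus_h2_def)
  have orth: "cip m (x - u) = 0" if m: "m \<in> M" for m
  proof (rule cip_eqI_Re)
    show "Re (cip (lincomb c m 0 m) (x - u)) = Re (c * 0)" for c
      using xu[OF M_lincomb[OF m m, of c 0]] by (simp add: inner_h2_def cip_diff_right)
  qed
  have "root (x - u) = 0"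
  proof (rule h2_eqI)
    fix w :: complex assume w: "cmod w < 1"
    show "fn (root (x - u)) w = fn 0 w"
      unfolding fn_zero
    proof (rule orthogonal_to_range_zero[OF \<zeta> B\<zeta> xuc _ w])
      show "cip m (x - u) = 0"
        if "g \<in> dBR b" "m \<in> coker" "\<And>z. fn (root m) z = shift g z - \<zeta> * g z" for g m
        by (rule orth[OF M_range[OF that]])
    qed
  qed
  then have "root x = root u" by (simp add: root_simps)
  then have "x = u" by (rule root_inj_on_coker[OF x(1) \<open>u \<in> coker\<close>])
  then have "x \<in> closure M" using u by simp
  then obtain m where m: "m \<in> M" "dist m x < sqrt \<epsilon>"
    using closure_approachable[of x M] \<epsilon> by (metis real_sqrt_gt_zero)
  then obtain g where g: "g \<in> dBR b" "\<And>z. fn (root m) z = shift g z - \<zeta> * g z" unfolding M_def by blast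
  have xm: "x - m \<in> coker"
    using coker_lincomb[OF x(1), of m 1 "-1"] m(1) by (simp add: minus_h2_def M_def)
  have "(norm (x - m))\<^sup>2 < (sqrt \<epsilon>)\<^sup>2"
    using m(2) by (intro power_strict_mono) (auto simp: dist_norm norm_minus_commute)
  then have "Re (dBR_inner b (fn (root (x - m))) (fn (root (x - m)))) < \<epsilon>"
    unfolding dBR_inner_self[OF xm] using \<epsilon> by simp
  moreover have "fn (root (x - m)) z = f z - (shift g z - \<zeta> * g z)" for z
    by (simp add: root_simps fn_diff x(2) g(2))
  ultimately show "\<exists>g\<in>dBR b. \<exists>d. (\<forall>z. d z = f z - (shift g z - \<zeta> * g z)) \<and> Re (dBR_inner b d d) < \<epsilon>"
    using g(1) by blast
qed

end

section \<open>Rational symbols\<close>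

lemma poly_analytic: "(\<lambda>z :: complex. poly p z) analytic_on S"
  by (induction p) (auto intro!: analytic_intros)

text \<open>
  In a representation of minimal degree a zero of the denominator on the circle is not a zero of the
  numerator, and would make the quotient unbounded.
\<close>

lemma bounded_rational_no_boundary_poles:
  assumes rat: "rational_on_disc b" and bnd: "bounded (b ` ball 0 1)"
  shows "\<exists>p q. (\<forall>z\<in>cball 0 1. poly q z \<noteq> 0) \<and> (\<forall>z\<in>ball 0 1. b z = poly p z / poly q z)"
proof -
  define R where "R d \<longleftrightarrow> (\<exists>p q. degree q = d \<and> (\<forall>z\<in>ball 0 1. poly q z \<noteq> 0 \<and> b z = poly p z / poly q z))" for d
  have "\<exists>d. R d" using rat unfolding rational_on_disc_def R_def by blast
  then have "R (LEAST d. R d)" by (rule LeastI_ex)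
  then obtain p q where deg: "degree q = (LEAST d. R d)"
    and pq: "\<And>z. z \<in> ball 0 1 \<Longrightarrow> poly q z \<noteq> 0" "\<And>z. z \<in> ball 0 1 \<Longrightarrow> b z = poly p z / poly q z"
    unfolding R_def by blast
  have q: "poly q \<zeta> \<noteq> 0" if \<zeta>: "\<zeta> \<in> cball 0 1" for \<zeta>
  proof
    assume q0: "poly q \<zeta> = 0"
    have \<zeta>1: "cmod \<zeta> = 1" using \<zeta> q0 pq(1)[of \<zeta>] by (cases "cmod \<zeta> < 1") auto
    show False
    proof (cases "poly p \<zeta> = 0")
      case True
      then obtain p' where p': "p = [:- \<zeta>, 1:] * p'" by (metis poly_eq_0_iff_dvd dvdE)
      from q0 obtain q' where q': "q = [:- \<zeta>, 1:] * q'" by (metis poly_eq_0_iff_dvd dvdE)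
      have "q \<noteq> 0" using pq(1)[of 0] by auto
      then have "q' \<noteq> 0" using q' by auto
      then have "degree q = 1 + degree q'" unfolding q' by (subst degree_mult_eq) auto
      moreover have "poly q' z \<noteq> 0 \<and> b z = poly p' z / poly q' z" if z: "z \<in> ball 0 1" for z
      proof -
        have "z \<noteq> \<zeta>" using z \<zeta>1 by auto
        moreover have "poly p z = (z - \<zeta>) * poly p' z" "poly q z = (z - \<zeta>) * poly q' z"
          by (simp_all add: p' q' left_diff_distrib)
        ultimately show ?thesis using pq(1)[OF z] pq(2)[OF z] by simp
      qed
      then have "R (degree q')" unfolding R_def by blast
      then have "(LEAST d. R d) \<le> degree q'" by (rule Least_le)
      ultimately show False using deg by simp
    next
      case False
      obtain C where C: "\<And>z. z \<in> ball 0 1 \<Longrightarrow> cmod (b z) \<le> C" using bnd by (force simp: bounded_iff)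
      have "((\<lambda>r::real. C * cmod (poly q (of_real r * \<zeta>)) - cmod (poly p (of_real r * \<zeta>))) \<longlongrightarrow>
             C * cmod (poly q (of_real 1 * \<zeta>)) - cmod (poly p (of_real 1 * \<zeta>))) (at_left 1)"
        by (intro tendsto_intros)
      moreover have "eventually (\<lambda>r::real. 0 \<le> C * cmod (poly q (of_real r * \<zeta>)) - cmod (poly p (of_real r * \<zeta>))) (at_left 1)"
        using eventually_at_left_real[OF zero_less_one]
      proof eventually_elim
        case (elim r)
        then have z: "of_real r * \<zeta> \<in> ball 0 1" using \<zeta>1 by (simp add: norm_mult)
        have "cmod (poly p (of_real r * \<zeta>)) = cmod (b (of_real r * \<zeta>)) * cmod (poly q (of_real r * \<zeta>))"
          using pq[OF z] by (simp add: norm_divide)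
        also have "\<dots> \<le> C * cmod (poly q (of_real r * \<zeta>))" by (intro mult_right_mono C z) auto
        finally show ?case by simp
      qed
      ultimately have "0 \<le> C * cmod (poly q (of_real 1 * \<zeta>)) - cmod (poly p (of_real 1 * \<zeta>))"
        by (rule tendsto_lowerbound) simp
      then show False using q0 False by simp
    qed
  qed
  show ?thesis by (rule exI[of _ p], rule exI[of _ q], intro conjI ballI q pq(2))
qed

lemma split_off_circle_roots:
  fixes W :: "complex poly"
  assumes "W \<noteq> 0"
  shows "\<exists>zs V. (\<forall>\<zeta>\<in>set zs. cmod \<zeta> = 1) \<and> (\<forall>z. poly W z = root_poly zs z * poly V z) \<and>
               (\<forall>z. cmod z = 1 \<longrightarrow> poly V z \<noteq> 0)"
  using assms
proof (induction "degree W" arbitrary: W rule: less_induct)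
  case less
  show ?case
  proof (cases "\<exists>\<zeta>. cmod \<zeta> = 1 \<and> poly W \<zeta> = 0")
    case False
    then show ?thesis by (intro exI[of _ "[]"] exI[of _ W]) (auto simp: root_poly_def)
  next
    case True
    then obtain \<zeta> where \<zeta>: "cmod \<zeta> = 1" "poly W \<zeta> = 0" by blast
    then obtain W' where W': "W = [:- \<zeta>, 1:] * W'" by (metis poly_eq_0_iff_dvd dvdE)
    then have "W' \<noteq> 0" using less.prems by auto
    then have "degree W = 1 + degree W'" unfolding W' by (subst degree_mult_eq) auto
    then obtain zs V where zs: "\<forall>\<zeta>\<in>set zs. cmod \<zeta> = 1" "\<forall>z. poly W' z = root_poly zs z * poly V z"
        "\<forall>z. cmod z = 1 \<longrightarrow> poly V z \<noteq> 0"
      using less.hyps[of W'] \<open>W' \<noteq> 0\<close> by auto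
    show ?thesis
      by (intro exI[of _ "\<zeta> # zs"] exI[of _ V]) (use zs \<zeta> in \<open>auto simp: W' root_poly_def left_diff_distrib mult.assoc\<close>)
  qed
qed

text \<open>
  On the circle \<open>cnj z = 1 / z\<close>, so that there the difference of the squared moduli of two polynomials
  is, up to a power of \<open>z\<close>, again a polynomial.
\<close>

lemma cmod_square_difference_poly:
  "\<exists>W. \<forall>z. cmod z = 1 \<longrightarrow> poly W z = z ^ (degree p + degree q) * of_real ((cmod (poly q z))\<^sup>2 - (cmod (poly p z))\<^sup>2)"
proof -
  define s where "s f = reflect_poly (map_poly cnj f)" for f :: "complex poly"
  have s: "poly (s f) z = z ^ degree f * cnj (poly f z)" if z: "cmod z = 1" for f z
  proof -
    have "z * cnj z = 1" using complex_norm_square[of z] z by simp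
    then have inv: "inverse z = cnj z" by (rule inverse_unique)
    have z0: "z \<noteq> 0" using z by auto
    have deg: "degree (map_poly cnj f) = degree f" by (rule degree_map_poly) simp
    show ?thesis
      unfolding s_def poly_reflect_poly_nz[OF z0] inv deg poly_cnj[of f z] by (rule refl)
  qed
  have "poly (monom 1 (degree p) * q * s q - monom 1 (degree q) * p * s p) z
      = z ^ (degree p + degree q) * of_real ((cmod (poly q z))\<^sup>2 - (cmod (poly p z))\<^sup>2)" if z: "cmod z = 1" for z
  proof -
    have "poly (monom 1 (degree p) * q * s q - monom 1 (degree q) * p * s p) z
        = z ^ (degree p + degree q) * (poly q z * cnj (poly q z) - poly p z * cnj (poly p z))"
      by (simp add: poly_monom s[OF z] power_add algebra_simps)
    then show ?thesis by (simp only: complex_norm_square of_real_diff)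
  qed
  then show ?thesis by blast
qed

text \<open>The maximum principle for \<open>(f, g)\<close>, applied to the pairing with its value at the point.\<close>

lemma sum_squares_maximum_principle:
  assumes f: "f analytic_on cball 0 1" and g: "g analytic_on cball 0 1"
    and circle: "\<And>z. cmod z = 1 \<Longrightarrow> (cmod (f z))\<^sup>2 + (cmod (g z))\<^sup>2 \<le> 1"
    and w: "cmod w < 1"
  shows "(cmod (f w))\<^sup>2 + (cmod (g w))\<^sup>2 \<le> 1"
proof -
  define S where "S = (cmod (f w))\<^sup>2 + (cmod (g w))\<^sup>2"
  define F where "F z = cnj (f w) * f z + cnj (g w) * g z" for z
  have F: "F analytic_on cball 0 1" unfolding F_def by (intro analytic_intros f g)
  then have hol: "F holomorphic_on cball 0 1" by (rule analytic_imp_holomorphic)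
  have S0: "0 \<le> S" by (simp add: S_def)
  \<comment> \<open>\<open>F w = S\<close>, and an upper bound \<open>(S + 1) / 2\<close> for \<open>S\<close> amounts to \<open>S \<le> 1\<close>.\<close>
  have "cmod (F w) \<le> (S + 1) / 2"
  proof (rule maximum_modulus_frontier[of F "cball 0 1"])
    show "F holomorphic_on interior (cball 0 1)" using hol by (rule holomorphic_on_subset) auto
    show "continuous_on (closure (cball 0 1)) F" using holomorphic_on_imp_continuous_on[OF hol] by simp
    fix z :: complex assume "z \<in> frontier (cball 0 1)"
    then have z: "cmod z = 1" by simp
    have "cmod (F z) \<le> cmod (f w) * cmod (f z) + cmod (g w) * cmod (g z)"
      using norm_triangle_ineq[of "cnj (f w) * f z" "cnj (g w) * g z"] by (simp add: F_def norm_mult)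
    also have "\<dots> \<le> (S + ((cmod (f z))\<^sup>2 + (cmod (g z))\<^sup>2)) / 2"
      using sum_squares_bound[of "cmod (f w)" "cmod (f z)"] sum_squares_bound[of "cmod (g w)" "cmod (g z)"]
      unfolding S_def by argo
    also have "\<dots> \<le> (S + 1) / 2" using circle[OF z] by simp
    finally show "cmod (F z) \<le> (S + 1) / 2" .
  qed (use w in auto)
  moreover have "F w = of_real S"
    unfolding F_def S_def of_real_add complex_norm_square by (simp add: mult.commute)
  ultimately have "S \<le> (S + 1) / 2" using S0 by simp
  then show ?thesis unfolding S_def by argo
qed

text \<open>
  On the circle \<open>cmod (q z)^2 * (1 - cmod (B z)^2)\<close> is the modulus of a polynomial. Its factor without
  zeros on the circle is bounded below, and there remains the modulus of \<open>root_poly zs\<close>, which bounds a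
  multiple of its square. The maximum principle extends the inequality to the disc.
\<close>

lemma rational_gap:
  fixes p q :: "complex poly"
  defines "B \<equiv> \<lambda>z. poly p z / poly q z"
  assumes q: "\<And>z. z \<in> cball 0 1 \<Longrightarrow> poly q z \<noteq> 0"
    and le: "\<And>z. cmod z < 1 \<Longrightarrow> cmod (B z) \<le> 1"
    and strict: "\<exists>z. cmod z = 1 \<and> cmod (B z) \<noteq> 1"
  shows "\<exists>zs c. (\<forall>\<zeta>\<in>set zs. cmod \<zeta> = 1) \<and> c > 0 \<and>
           (\<forall>z. cmod z < 1 \<longrightarrow> (cmod (B z))\<^sup>2 + c * (cmod (root_poly zs z))\<^sup>2 \<le> 1)"
proof -
  have B: "B analytic_on cball 0 1"
    unfolding B_def using q by (intro analytic_intros poly_analytic) auto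
  have contB: "continuous_on (cball 0 1) B"
    by (rule holomorphic_on_imp_continuous_on[OF analytic_imp_holomorphic[OF B]])
  have le': "cmod (B z) \<le> 1" if z: "cmod z = 1" for z
  proof -
    have "cmod (B z) \<le> 1"
    proof (rule continuous_le_on_closure[of "ball 0 1" "\<lambda>z. cmod (B z)"])
      show "continuous_on (closure (ball 0 1)) (\<lambda>z. cmod (B z))"
        using contB by (simp add: continuous_on_norm)
    qed (use z le in auto)
    then show ?thesis .
  qed
  obtain W where W: "\<And>z. cmod z = 1 \<Longrightarrow> poly W z = z ^ (degree p + degree q) * of_real ((cmod (poly q z))\<^sup>2 - (cmod (poly p z))\<^sup>2)"
    using cmod_square_difference_poly by blast
  have Wmod: "cmod (poly W z) = (cmod (poly q z))\<^sup>2 * (1 - (cmod (B z))\<^sup>2)" if z: "cmod z = 1" for z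
  proof -
    have qz: "poly q z \<noteq> 0" using q z by simp
    have e: "(cmod (poly q z))\<^sup>2 - (cmod (poly p z))\<^sup>2 = (cmod (poly q z))\<^sup>2 * (1 - (cmod (B z))\<^sup>2)"
      using qz by (simp add: B_def norm_divide power_divide right_diff_distrib)
    have "(cmod (B z))\<^sup>2 \<le> 1" using le'[OF z] by (simp add: power_le_one)
    then show ?thesis
      unfolding W[OF z] e norm_mult norm_power z norm_of_real by (simp add: abs_mult)
  qed
  obtain z0 where z0: "cmod z0 = 1" "cmod (B z0) \<noteq> 1" using strict by blast
  have "cmod (poly W z0) \<noteq> 0"
    unfolding Wmod[OF z0(1)] using z0 q[of z0] norm_ge_zero[of "B z0"] by (auto simp: power2_eq_1_iff simp del: norm_ge_zero)
  then have "W \<noteq> 0" by auto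
  from split_off_circle_roots[OF this] obtain zs V where zs: "\<And>\<zeta>. \<zeta> \<in> set zs \<Longrightarrow> cmod \<zeta> = 1"
    and WV: "\<And>z. poly W z = root_poly zs z * poly V z" and V: "\<And>z. cmod z = 1 \<Longrightarrow> poly V z \<noteq> 0"
    by blast
  have cont_rp: "continuous_on (sphere 0 1) (root_poly zs)"
    by (rule holomorphic_on_imp_continuous_on[OF analytic_imp_holomorphic[OF root_poly_analytic]])
  have bdd: "\<exists>M>0. \<forall>z\<in>sphere 0 1. cmod (f z) \<le> M" if "continuous_on (sphere 0 1) f" for f :: cfun
  proof -
    have "bounded (f ` sphere 0 1)" using that by (intro compact_imp_bounded compact_continuous_image) auto
    then obtain M where "\<forall>z\<in>sphere 0 1. cmod (f z) \<le> M" by (auto simp: bounded_iff)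
    then show ?thesis by (intro exI[of _ "max M 1"]) auto
  qed
  obtain m where m: "m > 0" "\<And>z. cmod z = 1 \<Longrightarrow> cmod (root_poly zs z) \<le> m"
    using bdd[OF cont_rp] by auto
  have "continuous_on (sphere 0 1) (\<lambda>z. (poly q z)\<^sup>2 / poly V z)"
    using V by (intro continuous_intros) auto
  from bdd[OF this] obtain K where K: "K > 0" "\<And>z. cmod z = 1 \<Longrightarrow> cmod ((poly q z)\<^sup>2 / poly V z) \<le> K"
    by auto
  define c where "c = 1 / (K * m)"
  have c: "c > 0" using K m by (simp add: c_def)
  have sqrt_c: "(cmod (of_real (sqrt c) * w))\<^sup>2 = c * (cmod w)\<^sup>2" for w
    using c by (simp add: norm_mult power_mult_distrib)
  have circle: "(cmod (B z))\<^sup>2 + (cmod (of_real (sqrt c) * root_poly zs z))\<^sup>2 \<le> 1" if z: "cmod z = 1" for z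
  proof -
    let ?P = "cmod (root_poly zs z)" and ?Q = "(cmod (poly q z))\<^sup>2" and ?V = "cmod (poly V z)"
    have pos: "?Q > 0" "?V > 0" using q[of z] V[OF z] z by auto
    have "?Q / ?V \<le> K" using K(2)[OF z] by (simp add: norm_divide norm_power)
    then have "?Q \<le> K * ?V" using pos by (simp add: pos_divide_le_eq)
    then have "?Q * ?P \<le> (K * ?V) * ?P" by (intro mult_right_mono) auto
    also have "\<dots> = K * cmod (poly W z)" by (simp add: WV norm_mult)
    also have "\<dots> = ?Q * (K * (1 - (cmod (B z))\<^sup>2))" by (simp add: Wmod[OF z])
    finally have P: "?P \<le> K * (1 - (cmod (B z))\<^sup>2)" using pos by simp
    have "?P\<^sup>2 \<le> m * ?P" unfolding power2_eq_square using m(2)[OF z] by (intro mult_right_mono) auto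
    also have "\<dots> \<le> m * (K * (1 - (cmod (B z))\<^sup>2))" using m P by (intro mult_left_mono) auto
    finally have "c * ?P\<^sup>2 \<le> c * (m * (K * (1 - (cmod (B z))\<^sup>2)))" using c by (intro mult_left_mono) auto
    also have "\<dots> = (c * (K * m)) * (1 - (cmod (B z))\<^sup>2)" by (simp only: mult_ac)
    also have "c * (K * m) = 1" using K(1) m(1) by (simp add: c_def)
    finally show ?thesis unfolding sqrt_c mult_1 by linarith
  qed
  have gap: "\<forall>z. cmod z < 1 \<longrightarrow> (cmod (B z))\<^sup>2 + c * (cmod (root_poly zs z))\<^sup>2 \<le> 1"
  proof (intro allI impI)
    fix z :: complex assume z: "cmod z < 1"
    have "(\<lambda>z. of_real (sqrt c) * root_poly zs z) analytic_on cball 0 1"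
      by (intro analytic_intros root_poly_analytic)
    from sum_squares_maximum_principle[OF B this circle z]
    show "(cmod (B z))\<^sup>2 + c * (cmod (root_poly zs z))\<^sup>2 \<le> 1" unfolding sqrt_c .
  qed
  have "\<forall>\<zeta>\<in>set zs. cmod \<zeta> = 1" by (rule ballI) (rule zs)
  from conjI[OF this conjI[OF c gap]] show ?thesis by (intro exI)
qed

lemma continuous_boundary_limit:
  assumes B: "B analytic_on cball 0 1" and bB: "\<And>z. cmod z < 1 \<Longrightarrow> b z = B z" and \<zeta>: "cmod \<zeta> = 1"
  shows "(b \<longlongrightarrow> B \<zeta>) (at \<zeta> within ball 0 1)"
proof -
  have "isCont B \<zeta>"
    using B \<zeta> analytic_at_imp_isCont analytic_on_analytic_at by (metis mem_cball dist_0_norm order_refl)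
  then have "(B \<longlongrightarrow> B \<zeta>) (at \<zeta> within ball 0 1)"
    by (auto simp: isCont_def intro: tendsto_within_subset)
  then show ?thesis
    by (rule Lim_transform_eventually) (auto simp: eventually_at_filter bB)
qed

lemma inner_if_unimodular:
  assumes B: "B analytic_on cball 0 1" and bB: "\<And>z. cmod z < 1 \<Longrightarrow> b z = B z" and b: "b \<in> Hinf"
    and uni: "\<And>z. cmod z = 1 \<Longrightarrow> cmod (B z) = 1"
  shows "inner_function b"
  unfolding inner_function_def
proof (intro conjI b AE_I2 exI)
  fix t :: real
  show "cmod (B (cis t)) = 1" by (rule uni) simp
  have l: "(b \<longlongrightarrow> B (cis t)) (at (cis t) within ball 0 1)"
    by (rule continuous_boundary_limit[OF B bB]) auto
  have "filterlim (\<lambda>r::real. of_real r * cis t) (at (cis t) within ball 0 1) (at_left 1)"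
    unfolding filterlim_at
  proof
    show "((\<lambda>r::real. of_real r * cis t) \<longlongrightarrow> cis t) (at_left 1)" by (auto intro!: tendsto_eq_intros)
    show "eventually (\<lambda>r::real. of_real r * cis t \<in> ball 0 1 \<and> of_real r * cis t \<noteq> cis t) (at_left 1)"
      using eventually_at_left_real[OF zero_less_one] by eventually_elim (auto simp: norm_mult)
  qed
  then show "((\<lambda>r. b (of_real r * cis t)) \<longlongrightarrow> B (cis t)) (at_left 1)"
    by (rule filterlim_compose[OF l])
qed

text \<open>This is where the hypothesis enters that the symbol is not inner.\<close>

lemma rational_noninner_nonextreme:
  assumes b: "b \<in> Hinf_unit_ball" and rat: "rational_on_disc b" and inner: "\<not> inner_function b"
  shows "\<exists>B zs c. nonextreme_schur b B zs c"
proof -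
  interpret schur_function b by unfold_locales (rule b)
  have Hinf: "b \<in> Hinf" using b by (simp add: Hinf_unit_ball_def)
  obtain p q where q: "\<And>z. z \<in> cball 0 1 \<Longrightarrow> poly q z \<noteq> 0"
    and pq: "\<And>z. z \<in> ball 0 1 \<Longrightarrow> b z = poly p z / poly q z"
    using bounded_rational_no_boundary_poles[OF rat] Hinf unfolding Hinf_def by blast
  let ?B = "\<lambda>z. poly p z / poly q z"
  have B: "?B analytic_on cball 0 1" using q by (intro analytic_intros poly_analytic) auto
  have bB: "b z = ?B z" if "cmod z < 1" for z using pq[of z] that by simp
  have "\<exists>z. cmod z = 1 \<and> cmod (?B z) \<noteq> 1"
    using inner_if_unimodular[OF B bB Hinf] inner by blast
  then have "\<exists>zs c. (\<forall>\<zeta>\<in>set zs. cmod \<zeta> = 1) \<and> c > 0 \<and>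
      (\<forall>z. cmod z < 1 \<longrightarrow> (cmod (?B z))\<^sup>2 + c * (cmod (root_poly zs z))\<^sup>2 \<le> 1)"
    using cmod_le_1 bB by (intro rational_gap[OF q]) simp_all
  then obtain zs c where gap: "\<forall>\<zeta>\<in>set zs. cmod \<zeta> = 1" "c > 0"
      "\<forall>z. cmod z < 1 \<longrightarrow> (cmod (?B z))\<^sup>2 + c * (cmod (root_poly zs z))\<^sup>2 \<le> 1"
    by (elim exE conjE)
  have "nonextreme_schur b ?B zs c"
  proof (unfold_locales)
    show "?B analytic_on cball 0 1" by (rule B)
    show "b z = ?B z" if "cmod z < 1" for z using that by (rule bB)
    show "cmod \<zeta> = 1" if "\<zeta> \<in> set zs" for \<zeta> using gap(1) that by blast
    show "c > 0" by (rule gap(2))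
    show "(cmod (b z))\<^sup>2 + c * (cmod (root_poly zs z))\<^sup>2 \<le> 1" if "cmod z < 1" for z
      using gap(3) that unfolding bB[OF that] by simp
  qed
  then show ?thesis by (intro exI)
qed

section \<open>Angular derivatives\<close>

text \<open>
  For a symbol that is analytic across the circle both non-tangential limits exist everywhere, and
  the only condition left is that the boundary value is unimodular.
\<close>

lemma angular_derivative_iff_unimodular:
  assumes B: "B analytic_on cball 0 1" and bB: "\<And>z. cmod z < 1 \<Longrightarrow> b z = B z" and \<zeta>: "cmod \<zeta> = 1"
  shows "has_caratheodory_angular_derivative b \<zeta> \<longleftrightarrow> cmod (B \<zeta>) = 1"
proof -
  have sub: "stolz_region \<zeta> \<alpha> \<subseteq> ball 0 1" for \<alpha> by (auto simp: stolz_region_def)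
  have ntB: "nontangential_limit b \<zeta> (B \<zeta>)"
    unfolding nontangential_limit_def
    using tendsto_within_subset[OF continuous_boundary_limit[OF B bB \<zeta>] sub] by blast
  have "deriv b z = deriv B z" if z: "cmod z < 1" for z
  proof (rule deriv_cong_ev)
    show "eventually (\<lambda>z. b z = B z) (nhds z)"
      using eventually_nhds_in_open[of "ball 0 1" z] z by (auto elim!: eventually_mono simp: bB)
  qed simp
  then have ntB': "nontangential_limit (deriv b) \<zeta> (deriv B \<zeta>)"
    unfolding nontangential_limit_def
    using tendsto_within_subset[OF continuous_boundary_limit[OF analytic_deriv[OF B] _ \<zeta>] sub] by blast
  have unique: "L = B \<zeta>" if "nontangential_limit b \<zeta> L" for L
  proof (rule tendsto_unique)
    show "(b \<longlongrightarrow> L) (at \<zeta> within stolz_region \<zeta> 2)" "(b \<longlongrightarrow> B \<zeta>) (at \<zeta> within stolz_region \<zeta> 2)"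
      using that ntB by (simp_all add: nontangential_limit_def)
    have "filterlim (\<lambda>r::real. of_real r * \<zeta>) (at \<zeta> within stolz_region \<zeta> 2) (at_left 1)"
      unfolding filterlim_at
    proof
      show "((\<lambda>r::real. of_real r * \<zeta>) \<longlongrightarrow> \<zeta>) (at_left 1)" by (auto intro!: tendsto_eq_intros)
      show "eventually (\<lambda>r::real. of_real r * \<zeta> \<in> stolz_region \<zeta> 2 \<and> of_real r * \<zeta> \<noteq> \<zeta>) (at_left 1)"
        using eventually_at_left_real[OF zero_less_one]
      proof eventually_elim
        case (elim r)
        have "of_real r * \<zeta> - \<zeta> = of_real (r - 1) * \<zeta>" by (simp add: left_diff_distrib)
        then have "cmod (of_real r * \<zeta> - \<zeta>) = 1 - r" using elim by (simp only: norm_mult norm_of_real \<zeta>) simp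
        then show ?case using elim \<zeta> by (auto simp: stolz_region_def norm_mult)
      qed
    qed
    then show "at \<zeta> within stolz_region \<zeta> 2 \<noteq> bot"
      using trivial_limit_at_left_real[of 1] by (auto simp: filterlim_def bot_unique filtermap_bot_iff)
  qed
  show ?thesis
    unfolding has_caratheodory_angular_derivative_def using unique ntB ntB' by blast
qed

context nonextreme_schur
begin

text \<open>
  On the circle \<open>cmod (B \<zeta>) \<le> 1\<close>, so that the two results on the range cover all cases.
\<close>

lemma angular_derivative_iff_not_dense:
  assumes \<zeta>: "cmod \<zeta> = 1"
  shows "has_caratheodory_angular_derivative b \<zeta> \<longleftrightarrow> \<not> range_shift_minus_dense (dBR b) (dBR_inner b) \<zeta>"
proof -
  have "((\<lambda>z. cmod (b z)) \<longlongrightarrow> cmod (B \<zeta>)) (at \<zeta> within ball 0 1)"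
    by (intro tendsto_norm continuous_boundary_limit B_analytic b_eq_B \<zeta>)
  moreover have "eventually (\<lambda>z. cmod (b z) \<le> 1) (at \<zeta> within ball 0 1)"
    using cmod_le_1 by (auto simp: eventually_at_filter)
  moreover have "at \<zeta> within ball 0 1 \<noteq> bot"
    using \<zeta> by (simp add: at_within_eq_bot_iff trivial_limit_within islimpt_ball)
  ultimately have "cmod (B \<zeta>) \<le> 1" using tendsto_upperbound by blast
  then have "cmod (B \<zeta>) = 1 \<longleftrightarrow> \<not> range_shift_minus_dense (dBR b) (dBR_inner b) \<zeta>"
    using dense_if_not_unimodular[OF \<zeta>] not_dense_if_unimodular[OF \<zeta>] by linarith
  then show ?thesis using angular_derivative_iff_unimodular[OF B_analytic b_eq_B \<zeta>] by blast
qed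

end

theorem theorem4p1:
  fixes b\<^sub>1 b\<^sub>2 :: "complex \<Rightarrow> complex"
  assumes "b\<^sub>1 \<in> Hinf_unit_ball" and "b\<^sub>2 \<in> Hinf_unit_ball"
    and "rational_on_disc b\<^sub>1" and "rational_on_disc b\<^sub>2"
    and "\<not> inner_function b\<^sub>1" and "\<not> inner_function b\<^sub>2"
    and "unitarily_equivalent (dBR b\<^sub>1) (dBR_inner b\<^sub>1) shift (dBR b\<^sub>2) (dBR_inner b\<^sub>2) shift"
  shows "\<forall>\<zeta>\<in>sphere 0 1. has_caratheodory_angular_derivative b\<^sub>1 \<zeta> \<longleftrightarrow>
                         has_caratheodory_angular_derivative b\<^sub>2 \<zeta>"
proof
  fix \<zeta> :: complex assume "\<zeta> \<in> sphere 0 1"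
  then have \<zeta>: "cmod \<zeta> = 1" by simp
  obtain B\<^sub>1 zs\<^sub>1 c\<^sub>1 where "nonextreme_schur b\<^sub>1 B\<^sub>1 zs\<^sub>1 c\<^sub>1"
    using rational_noninner_nonextreme[OF assms(1,3,5)] by blast
  then interpret b1: nonextreme_schur b\<^sub>1 B\<^sub>1 zs\<^sub>1 c\<^sub>1 .
  obtain B\<^sub>2 zs\<^sub>2 c\<^sub>2 where "nonextreme_schur b\<^sub>2 B\<^sub>2 zs\<^sub>2 c\<^sub>2"
    using rational_noninner_nonextreme[OF assms(2,4,6)] by blast
  then interpret b2: nonextreme_schur b\<^sub>2 B\<^sub>2 zs\<^sub>2 c\<^sub>2 .
  have "range_shift_minus_dense (dBR b\<^sub>1) (dBR_inner b\<^sub>1) \<zeta> \<longleftrightarrow> range_shift_minus_dense (dBR b\<^sub>2) (dBR_inner b\<^sub>2) \<zeta>"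
    by (rule range_shift_minus_dense_unitary[OF b1.dBR_lincomb b1.dBR_shift_invariant assms(7)])
  then show "has_caratheodory_angular_derivative b\<^sub>1 \<zeta> \<longleftrightarrow> has_caratheodory_angular_derivative b\<^sub>2 \<zeta>"
    by (simp add: b1.angular_derivative_iff_not_dense[OF \<zeta>] b2.angular_derivative_iff_not_dense[OF \<zeta>])
qed

end
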